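(* The upper covering polynomials of the weight posets of the irreducible weight multiplicity free representations of simple Lie algebras (taken up to isomorphism of posets) are as follows: - $\mathbf A_n$: $\ \mathcal K_{\mathcal P(\varpi_m)}(t)=\sum_{r\ge0}\binom{m}{r}\binom{n-m+1}{r}t^r$; - $\mathbf D_n$: $\ \mathcal K_{\mathcal P(\varpi_n)}(t)=\sum_{r\ge0}\binom{n}{2r}t^r$ and $\ \mathcal K_{\mathcal P(\varpi_1)}(t)=1+(2n-2)t+t^2$; - $\mathbf C_3$: $\ \mathcal K_{\mathcal P(\varpi_3)}(t)=1+9t+4t^2$; - $\mathbf E_6$: $\ \mathcal K_{\mathcal P(\varpi_1)}(t)=1+16t+10t^2$; - $\mathbf E_7$: $\ \mathcal K_{\mathcal P(\varpi_1)}(t)=1+27t+27t^2+t^3$.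
   Context: The ground field is algebraically closed of characteristic zero. A representation is weight multiplicity free if all its weight spaces are one-dimensional. For a simple Lie algebra $\mathfrak g$ with fixed Cartan subalgebra and simple roots and a dominant weight $\lambda$, $\mathcal P(\lambda)=\mathcal P(\mathfrak g,\lambda)$ is the set of weights of the simple $\mathfrak g$-module with highest weight $\lambda$, with the root order: $\mu$ covers $\gamma$ if and only if $\mu-\gamma$ is a simple root. The upper covering polynomial of a finite poset $\mathcal P$ is $\mathcal K_{\mathcal P}(t)=\sum_{j\ge0}\#(\mathcal P^{(j)})\,t^j$, where $\mathcal P^{(j)}$ is the set of elements of $\mathcal P$ that cover exactly $j$ elements of $\mathcal P$. By Howe's classification, the nontrivial irreducible weight multiplicity free representations of simple Lie algebras have highest weights: $\mathbf A_n$: $\varpi_m$, $m\varpi_1$, $m\varpi_n$; $\mathbf B_n$: $\varpi_1,\varpi_n$; $\mathbf C_n$: $\varpi_1$, and $\varpi_3$ for $n=3$; $\mathbf D_n$: $\varpi_1,\varpi_{n-1},\varpi_n$; $\mathbf E_6$: $\varpi_1$ and its dual; $\mathbf E_7$: $\varpi_1$; $\mathbf G_2$: $\varpi_1$. Up to isomorphism their weight posets are: $\mathcal P(\mathbf A_n,\varpi_m)$ with $1\le m\le(n+1)/2$; $\mathcal P(\mathbf D_n,\varpi_n)$ with $n\ge5$; $\mathcal P(\mathbf D_n,\varpi_1)$ with $n\ge4$; $\mathcal P(\mathbf E_6,\varpi_1)$; $\mathcal P(\mathbf E_7,\varpi_1)$; $\mathcal P(\mathbf C_3,\varpi_3)$.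 Numbering of fundamental weights: for $\mathbf A_n=\mathfrak{sl}_{n+1}$, $\varpi_m$ corresponds to the $m$-th exterior power of the tautological representation; for $\mathbf D_n=\mathfrak{so}_{2n}$, $\varpi_1$ corresponds to the $2n$-dimensional vector representation and $\varpi_n$ to a half-spinor representation (dimension $2^{n-1}$); for $\mathbf C_3=\mathfrak{sp}_6$, $\varpi_3$ corresponds to the $14$-dimensional representation contained in the third exterior power of the $6$-dimensional one; for $\mathbf E_6$, $\varpi_1$ corresponds to a $27$-dimensional representation; for $\mathbf E_7$, $\varpi_1$ corresponds to the $56$-dimensional representation. *)

theory Defs
  imports Complex_Main "HOL-Computational_Algebra.Polynomial"
begin

section \<open>Upper covering polynomial of a finite poset\<close>

definition poset_covers :: "'a set \<Rightarrow> ('a \<Rightarrow> 'a \<Rightarrow> bool) \<Rightarrow> 'a \<Rightarrow> 'a \<Rightarrow> bool" where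
  "poset_covers P le x y \<longleftrightarrow>
     x \<in> P \<and> y \<in> P \<and> y \<noteq> x \<and> le y x \<and>
     (\<forall>z\<in>P. le y z \<and> le z x \<longrightarrow> z = y \<or> z = x)"

text \<open>An element covers at most \<open>card P\<close> elements, so the sum over all j may be cut off there.\<close>

definition upper_covering_poly :: "'a set \<Rightarrow> ('a \<Rightarrow> 'a \<Rightarrow> bool) \<Rightarrow> int poly" where
  "upper_covering_poly P le =
     (\<Sum>j\<le>card P. monom (int (card {x \<in> P. card {y. poset_covers P le x y} = j})) j)"

section \<open>Lie algebras and their modules\<close>

locale lie_algebra = vector_space sg
  for sg :: "'k::field \<Rightarrow> 'g::ab_group_add \<Rightarrow> 'g" +
  fixes br :: "'g \<Rightarrow> 'g \<Rightarrow> 'g"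
  assumes linear_br_right: "Vector_Spaces.linear sg sg (\<lambda>y. br x y)"
    and linear_br_left: "Vector_Spaces.linear sg sg (\<lambda>x. br x y)"
    and br_self: "br x x = 0"
    and jacobi: "br x (br y z) + br y (br z x) + br z (br x y) = 0"

locale simple_lie_algebra = lie_algebra sg br
  for sg :: "'k::field \<Rightarrow> 'g::ab_group_add \<Rightarrow> 'g" and br :: "'g \<Rightarrow> 'g \<Rightarrow> 'g" +
  assumes finite_dim: "\<exists>B. finite B \<and> span B = UNIV"
    and nonabelian: "\<exists>x y. br x y \<noteq> 0"
    and ideals: "subspace I \<Longrightarrow> (\<forall>x. \<forall>y\<in>I. br x y \<in> I) \<Longrightarrow> I = {0} \<or> I = UNIV"

locale lie_module = lie_algebra sg br + V: vector_space sv
  for sg :: "'k::field \<Rightarrow> 'g::ab_group_add \<Rightarrow> 'g" and br :: "'g \<Rightarrow> 'g \<Rightarrow> 'g"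
    and sv :: "'k \<Rightarrow> 'v::ab_group_add \<Rightarrow> 'v" +
  fixes act :: "'g \<Rightarrow> 'v \<Rightarrow> 'v"
  assumes linear_act_right: "Vector_Spaces.linear sv sv (\<lambda>v. act x v)"
    and linear_act_left: "Vector_Spaces.linear sg sv (\<lambda>x. act x v)"
    and act_br: "act (br x y) v = act x (act y v) - act y (act x v)"

locale simple_lie_module = lie_module sg br sv act
  for sg :: "'k::field \<Rightarrow> 'g::ab_group_add \<Rightarrow> 'g" and br :: "'g \<Rightarrow> 'g \<Rightarrow> 'g"
    and sv :: "'k \<Rightarrow> 'v::ab_group_add \<Rightarrow> 'v" and act :: "'g \<Rightarrow> 'v \<Rightarrow> 'v" +
  assumes module_finite_dim: "\<exists>B. finite B \<and> V.span B = UNIV"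
    and module_nonzero: "\<exists>v::'v. v \<noteq> 0"
    and submodules:
      "V.subspace W \<Longrightarrow> (\<forall>x. \<forall>w\<in>W. act x w \<in> W) \<Longrightarrow> W = {0} \<or> W = UNIV"

text \<open>
  For semisimple algebras over an algebraically closed field of characteristic zero, the Cartan
  subalgebras are the self-centralizing abelian subspaces all of whose elements are
  ad-diagonalizable.
\<close>

locale cartan_subalgebra = lie_algebra sg br
  for sg :: "'k::field \<Rightarrow> 'g::ab_group_add \<Rightarrow> 'g" and br :: "'g \<Rightarrow> 'g \<Rightarrow> 'g" +
  fixes H :: "'g set"
  assumes cartan_subspace: "subspace H"
    and cartan_abelian: "\<lbrakk>x \<in> H; y \<in> H\<rbrakk> \<Longrightarrow> br x y = 0"
    and cartan_self_centralizing: "(\<forall>h\<in>H. br h x = 0) \<Longrightarrow> x \<in> H"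
    and cartan_diagonalizable: "h \<in> H \<Longrightarrow> span {x. \<exists>c. br h x = sg c x} = UNIV"

section \<open>Weights and roots\<close>

text \<open>
  A functional on H is represented by its extension by zero to all of the Lie algebra (which is
  not the extension to a linear map), so that equality of weights is equality on H.
\<close>

definition cartan_dual :: "('k::field \<Rightarrow> 'g::ab_group_add \<Rightarrow> 'g) \<Rightarrow> 'g set \<Rightarrow> ('g \<Rightarrow> 'k) set" where
  "cartan_dual sg H =
     {\<mu>. (\<forall>x\<in>H. \<forall>y\<in>H. \<mu> (x + y) = \<mu> x + \<mu> y) \<and>
         (\<forall>c. \<forall>x\<in>H. \<mu> (sg c x) = c * \<mu> x) \<and>
         (\<forall>x. x \<notin> H \<longrightarrow> \<mu> x = 0)}"

definition weight_space ::
  "('k \<Rightarrow> 'v \<Rightarrow> 'v) \<Rightarrow> ('g \<Rightarrow> 'v \<Rightarrow> 'v) \<Rightarrow> 'g set \<Rightarrow> ('g \<Rightarrow> 'k) \<Rightarrow> 'v set" where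
  "weight_space sv act H \<mu> = {v. \<forall>h\<in>H. act h v = sv (\<mu> h) v}"

definition weights ::
  "('k::field \<Rightarrow> 'g::ab_group_add \<Rightarrow> 'g) \<Rightarrow> ('k \<Rightarrow> 'v::ab_group_add \<Rightarrow> 'v) \<Rightarrow>
   ('g \<Rightarrow> 'v \<Rightarrow> 'v) \<Rightarrow> 'g set \<Rightarrow> ('g \<Rightarrow> 'k) set" where
  "weights sg sv act H = {\<mu> \<in> cartan_dual sg H. \<exists>v\<in>weight_space sv act H \<mu>. v \<noteq> 0}"

text \<open>The roots are the nonzero weights of the adjoint module, where \<open>act = br\<close>.\<close>

definition roots ::
  "('k::field \<Rightarrow> 'g::ab_group_add \<Rightarrow> 'g) \<Rightarrow> ('g \<Rightarrow> 'g \<Rightarrow> 'g) \<Rightarrow> 'g set \<Rightarrow> ('g \<Rightarrow> 'k) set" where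
  "roots sg br H = weights sg sg br H - {\<lambda>_. 0}"

text \<open>Families of simple roots and coroots are indexed by \<open>{1..n}\<close>.\<close>

definition nonneg_combinations :: "nat \<Rightarrow> (nat \<Rightarrow> 'g \<Rightarrow> 'k::field) \<Rightarrow> ('g \<Rightarrow> 'k) set" where
  "nonneg_combinations n \<alpha> = {\<lambda>x. \<Sum>i=1..n. of_nat (c i) * \<alpha> i x |c. True}"

definition simple_roots ::
  "('k::field \<Rightarrow> 'g::ab_group_add \<Rightarrow> 'g) \<Rightarrow> ('g \<Rightarrow> 'g \<Rightarrow> 'g) \<Rightarrow> 'g set \<Rightarrow>
   nat \<Rightarrow> (nat \<Rightarrow> 'g \<Rightarrow> 'k) \<Rightarrow> bool" where
  "simple_roots sg br H n \<alpha> \<longleftrightarrow>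
     (\<forall>i\<in>{1..n}. \<alpha> i \<in> roots sg br H) \<and>
     (\<forall>c :: nat \<Rightarrow> 'k. (\<forall>h\<in>H. (\<Sum>i=1..n. c i * \<alpha> i h) = 0) \<longrightarrow> (\<forall>i\<in>{1..n}. c i = 0)) \<and>
     (\<forall>\<beta>\<in>roots sg br H.
        \<beta> \<in> nonneg_combinations n \<alpha> \<or> (\<lambda>x. - \<beta> x) \<in> nonneg_combinations n \<alpha>)"

definition positive_roots ::
  "('k::field \<Rightarrow> 'g::ab_group_add \<Rightarrow> 'g) \<Rightarrow> ('g \<Rightarrow> 'g \<Rightarrow> 'g) \<Rightarrow> 'g set \<Rightarrow>
   nat \<Rightarrow> (nat \<Rightarrow> 'g \<Rightarrow> 'k) \<Rightarrow> ('g \<Rightarrow> 'k) set" where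
  "positive_roots sg br H n \<alpha> = roots sg br H \<inter> nonneg_combinations n \<alpha>"

text \<open>
  The coroot of a root \<open>\<beta>\<close> is the element h of \<open>[g\<^sub>\<beta>, g\<^sub>-\<^sub>\<beta>]\<close> with \<open>\<beta>(h) = 2\<close>; as root spaces are
  one-dimensional, every element of \<open>[g\<^sub>\<beta>, g\<^sub>-\<^sub>\<beta>]\<close> is a single bracket.
\<close>

definition is_coroot ::
  "('k::field \<Rightarrow> 'g::ab_group_add \<Rightarrow> 'g) \<Rightarrow> ('g \<Rightarrow> 'g \<Rightarrow> 'g) \<Rightarrow> 'g set \<Rightarrow> ('g \<Rightarrow> 'k) \<Rightarrow> 'g \<Rightarrow> bool"
  where
  "is_coroot sg br H \<beta> h \<longleftrightarrow>
     \<beta> h = 2 \<and>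
     (\<exists>x \<in> weight_space sg br H \<beta>. \<exists>y \<in> weight_space sg br H (\<lambda>z. - \<beta> z). h = br x y)"

definition highest_weight ::
  "('k::field \<Rightarrow> 'g::ab_group_add \<Rightarrow> 'g) \<Rightarrow> ('g \<Rightarrow> 'g \<Rightarrow> 'g) \<Rightarrow> 'g set \<Rightarrow>
   nat \<Rightarrow> (nat \<Rightarrow> 'g \<Rightarrow> 'k) \<Rightarrow>
   ('k \<Rightarrow> 'v::ab_group_add \<Rightarrow> 'v) \<Rightarrow> ('g \<Rightarrow> 'v \<Rightarrow> 'v) \<Rightarrow> ('g \<Rightarrow> 'k) \<Rightarrow> bool" where
  "highest_weight sg br H n \<alpha> sv act \<mu> \<longleftrightarrow>
     \<mu> \<in> cartan_dual sg H \<and>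
     (\<exists>v \<in> weight_space sv act H \<mu>. v \<noteq> 0 \<and>
        (\<forall>\<beta> \<in> positive_roots sg br H n \<alpha>. \<forall>x \<in> weight_space sg br H \<beta>. act x v = 0))"

definition fundamental_weight ::
  "('k::field \<Rightarrow> 'g::ab_group_add \<Rightarrow> 'g) \<Rightarrow> 'g set \<Rightarrow> nat \<Rightarrow> (nat \<Rightarrow> 'g) \<Rightarrow>
   nat \<Rightarrow> ('g \<Rightarrow> 'k) \<Rightarrow> bool" where
  "fundamental_weight sg H n hc m \<mu> \<longleftrightarrow>
     \<mu> \<in> cartan_dual sg H \<and> (\<forall>i\<in>{1..n}. \<mu> (hc i) = (if i = m then 1 else 0))"

section \<open>The weight poset\<close>

text \<open>
  The root order is the partial order generated by the pairs of weights that differ by a simple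
  root.
\<close>

definition root_order :: "('g \<Rightarrow> 'k::field) set \<Rightarrow> nat \<Rightarrow> (nat \<Rightarrow> 'g \<Rightarrow> 'k) \<Rightarrow>
    ('g \<Rightarrow> 'k) \<Rightarrow> ('g \<Rightarrow> 'k) \<Rightarrow> bool" where
  "root_order P n \<alpha> =
     (\<lambda>\<gamma> \<mu>. \<gamma> \<in> P \<and> \<mu> \<in> P \<and> (\<exists>i\<in>{1..n}. (\<lambda>x. \<mu> x - \<gamma> x) = \<alpha> i))\<^sup>*\<^sup>*"

definition weight_covering_poly ::
  "('k::field \<Rightarrow> 'g::ab_group_add \<Rightarrow> 'g) \<Rightarrow> 'g set \<Rightarrow> nat \<Rightarrow> (nat \<Rightarrow> 'g \<Rightarrow> 'k) \<Rightarrow>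
   ('k \<Rightarrow> 'v::ab_group_add \<Rightarrow> 'v) \<Rightarrow> ('g \<Rightarrow> 'v \<Rightarrow> 'v) \<Rightarrow> int poly" where
  "weight_covering_poly sg H n \<alpha> sv act =
     upper_covering_poly (weights sg sv act H) (root_order (weights sg sv act H) n \<alpha>)"

section \<open>Cartan types\<close>

datatype dynkin_type = TypeA nat | TypeC nat | TypeD nat | TypeE nat

fun rank :: "dynkin_type \<Rightarrow> nat" where
  "rank (TypeA n) = n"
| "rank (TypeC n) = n"
| "rank (TypeD n) = n"
| "rank (TypeE n) = n"

text \<open>
  Types A, C and D are numbered as usual. For type E the nodes \<open>1, \<dots>, n - 1\<close> form a chain and
  node n is attached to node \<open>n - 3\<close> (not the Bourbaki numbering): node 1 is an end of a longest
  arm, so that the first fundamental module has dimension 27 for n = 6 and 56 for n = 7.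
\<close>

fun dynkin_edges :: "dynkin_type \<Rightarrow> nat set set" where
  "dynkin_edges (TypeA n) = {{i, i + 1} |i. 1 \<le> i \<and> i < n}"
| "dynkin_edges (TypeC n) = {{i, i + 1} |i. 1 \<le> i \<and> i < n}"
| "dynkin_edges (TypeD n) = {{i, i + 1} |i. 1 \<le> i \<and> i < n - 1} \<union> {{n - 2, n}}"
| "dynkin_edges (TypeE n) = {{i, i + 1} |i. 1 \<le> i \<and> i < n - 1} \<union> {{n - 3, n}}"

text \<open>
  The entry \<open>(i, j)\<close> is the value of the simple root \<open>\<alpha>\<^sub>j\<close> at the simple coroot of \<open>\<alpha>\<^sub>i\<close>. In type C
  the last simple root is the long one.
\<close>

definition cartan_matrix :: "dynkin_type \<Rightarrow> nat \<Rightarrow> nat \<Rightarrow> int" where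
  "cartan_matrix X i j =
     (if i = j then 2
      else if {i, j} \<in> dynkin_edges X
        then (if (\<exists>n. X = TypeC n \<and> i = n - 1 \<and> j = n) then - 2 else - 1)
      else 0)"

text \<open>\<open>hc\<close> is the family of simple coroots.\<close>

definition root_datum_of_type ::
  "dynkin_type \<Rightarrow> ('k::field \<Rightarrow> 'g::ab_group_add \<Rightarrow> 'g) \<Rightarrow> ('g \<Rightarrow> 'g \<Rightarrow> 'g) \<Rightarrow> 'g set \<Rightarrow>
   (nat \<Rightarrow> 'g \<Rightarrow> 'k) \<Rightarrow> (nat \<Rightarrow> 'g) \<Rightarrow> bool" where
  "root_datum_of_type X sg br H \<alpha> hc \<longleftrightarrow>
     simple_roots sg br H (rank X) \<alpha> \<and>
     (\<forall>i\<in>{1..rank X}. is_coroot sg br H (\<alpha> i) (hc i)) \<and>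
     (\<forall>i\<in>{1..rank X}. \<forall>j\<in>{1..rank X}. \<alpha> j (hc i) = of_int (cartan_matrix X i j))"

end

theory Submission
  imports Defs
begin

text \<open>
  Let \<open>V\<close> be the simple module with highest weight \<open>\<mu>\<close>. Its weights have the form
  \<open>\<mu> - (c\<^sub>1 \<alpha>\<^sub>1 + \<dots> + c\<^sub>n \<alpha>\<^sub>n)\<close> with unique natural numbers \<open>c\<^sub>i\<close>, so the weight poset becomes a finite
  set \<open>Q\<close> of vectors \<open>c\<close>. A step down in the root order raises one coordinate by one; hence the weight
  at \<open>c\<close> covers as many weights as there are \<open>i\<close> with \<open>c + e\<^sub>i \<in> Q\<close>, and the covering polynomial is the
  sum of \<open>t\<close> to this number over \<open>c \<in> Q\<close> (\<open>weight_covering_poly_eq\<close>). The \<open>c\<^sub>i\<close> exist because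
  the vectors obtained from a highest weight vector by repeatedly applying elements of negative root
  spaces span a submodule, which is all of \<open>V\<close> (\<open>lowered_span\<close>).

  The set \<open>Q\<close> is then found from two properties. Representation theory of \<open>sl\<^sub>2\<close> shows that \<open>Q\<close> is
  stable under the simple reflections, which act on root coordinates by adding the value at the
  i-th simple coroot to \<open>c\<^sub>i\<close> (\<open>root_coords_string\<close>). A reflection at a negative coroot value lowers
  \<open>c\<^sub>1 + \<dots> + c\<^sub>n\<close>, so every reflection-stable set of nonnegative vectors is determined by its dominant
  members (\<open>reflection_closed_subset\<close>). For all modules in question except the one of type \<open>C\<^sub>3\<close> the
  only dominant candidate is \<open>c = 0\<close>, as the highest weight is minuscule; in type \<open>C\<^sub>3\<close> there is one
  more, and it lies in \<open>Q\<close> by two explicit steps down from the highest weight. It therefore suffices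
  to exhibit in each case a reflection-stable set of nonnegative vectors with these dominant members.

  The models are orbits of the Weyl group (two of them for \<open>C\<^sub>3\<close>) in their usual coordinates: words
  with \<open>m\<close> letters True and \<open>n + 1 - m\<close> letters False in type A, words of length \<open>n\<close> with an even
  number of letters False for the half-spin module, the vectors \<open>\<plusminus>\<epsilon>\<^sub>k\<close> for the vector module of type D, and explicit lists for
  \<open>C\<^sub>3\<close>, \<open>E\<^sub>6\<close>, \<open>E\<^sub>7\<close>. For a minuscule weight the covered elements correspond to the simple coroots
  with value 1. In type A these are the descents of the word, and words with \<open>r\<close> descents are counted
  by \<open>(m choose r) * (n - m + 1 choose r)\<close> (\<open>coeff_descent_poly_words\<close>). For the half-spin module the
  last letter of a word is fixed by parity; replacing it by False turns the number of covered elements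
  into a number of descents, and the count is \<open>n choose (2 * r)\<close>
  (\<open>coeff_descent_poly_append_False\<close>).
\<close>

section \<open>Joint eigenvectors of commuting operators\<close>

lemma (in vector_space) linear_endo:
  assumes "Vector_Spaces.linear scale scale f"
  shows "f (x + y) = f x + f y" "f (scale c x) = scale c (f x)" "f 0 = 0"
    "f (x - y) = f x - f y" "f (sum g A) = (\<Sum>a\<in>A. f (g a))" "f (- x) = - f x"
proof -
  interpret module_hom scale scale f using assms by (simp add: module_hom_iff_linear)
  show "f (x + y) = f x + f y" "f (scale c x) = scale c (f x)" "f 0 = 0"
    "f (x - y) = f x - f y" "f (sum g A) = (\<Sum>a\<in>A. f (g a))" "f (- x) = - f x"
    by (fact add scale zero diff sum neg)+
qed

text \<open>
  Applying \<open>T h - w k h\<close> to a vanishing sum of weight vectors kills the k-th term and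
  rescales the others, so the induction hypothesis applies to the remaining terms. The
  weights are indexed by an arbitrary type and pairwise distinct on \<open>H\<close>, so that the
  eigenspaces of a single operator are the case in which \<open>H\<close> is a singleton and the index is
  the eigenvalue.
\<close>

lemma (in vector_space) weight_vectors_independent:
  assumes lin: "\<And>h. h \<in> H \<Longrightarrow> Vector_Spaces.linear scale scale (T h)"
    and distinct: "\<And>i j. i \<in> I \<Longrightarrow> j \<in> I \<Longrightarrow> i \<noteq> j \<Longrightarrow> \<exists>h\<in>H. w i h \<noteq> w j h"
    and "finite I"
    and "\<And>i. i \<in> I \<Longrightarrow> v i \<in> weight_space scale T H (w i)"
    and "(\<Sum>i\<in>I. v i) = 0"
  shows "\<forall>i\<in>I. v i = 0"
  using assms(3,2,4,5)
proof (induction I arbitrary: v rule: finite_induct)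
  case empty
  then show ?case by simp
next
  case (insert k J)
  have zero: "scale (w i h - w k h) (v i) = 0" if "h \<in> H" "i \<in> J" for h i
  proof -
    note L = linear_endo[OF lin[OF \<open>h \<in> H\<close>]]
    have v: "T h (v i) = scale (w i h) (v i)" if "i \<in> insert k J" for i
      using insert.prems(2)[OF that] \<open>h \<in> H\<close> by (simp add: weight_space_def)
    have "(\<Sum>i\<in>insert k J. T h (v i)) = 0"
      using insert.prems(3) L(5)[of v "insert k J"] L(3) by simp
    moreover have "(\<Sum>i\<in>insert k J. scale (w k h) (v i)) = 0"
      by (metis insert.prems(3) scale_sum_right scale_zero_right)
    ultimately have "(\<Sum>i\<in>insert k J. T h (v i) - scale (w k h) (v i)) = 0"
      by (simp add: sum_subtractf)
    moreover have "(\<Sum>i\<in>insert k J. T h (v i) - scale (w k h) (v i)) =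
        (\<Sum>i\<in>insert k J. scale (w i h - w k h) (v i))"
      by (rule sum.cong) (auto simp: v scale_left_diff_distrib)
    ultimately have "(\<Sum>i\<in>J. scale (w i h - w k h) (v i)) = 0"
      using insert.hyps by simp
    moreover have "scale (w i h - w k h) (v i) \<in> weight_space scale T H (w i)" if "i \<in> J" for i
      using insert.prems(2)[of i] that by (auto simp: weight_space_def linear_endo[OF lin] mult.commute)
    ultimately have "\<forall>i\<in>J. scale (w i h - w k h) (v i) = 0"
      by (intro insert.IH) (use insert.prems(1) in auto)
    then show ?thesis using that by blast
  qed
  have J: "v i = 0" if "i \<in> J" for i
  proof -
    have "i \<noteq> k" using that insert.hyps by auto
    then obtain h where "h \<in> H" "w i h \<noteq> w k h"
      using insert.prems(1)[of i k] \<open>i \<in> J\<close> by blast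
    then show ?thesis using zero[of h i] that by simp
  qed
  moreover have "v k = 0" using insert.prems(3) insert.hyps J by simp
  ultimately show ?case by auto
qed

lemma (in vector_space) span_weight_vectors_decompose:
  assumes lin: "\<And>h. h \<in> H \<Longrightarrow> Vector_Spaces.linear scale scale (T h)"
    and "x \<in> span (\<Union>i\<in>A. weight_space scale T H (w i))"
  obtains I v where "finite I" "I \<subseteq> A" "\<And>i. i \<in> I \<Longrightarrow> v i \<in> weight_space scale T H (w i)"
    "x = (\<Sum>i\<in>I. v i)"
proof -
  have "\<exists>I v. finite I \<and> I \<subseteq> A \<and> (\<forall>i\<in>I. v i \<in> weight_space scale T H (w i)) \<and> x = (\<Sum>i\<in>I. v i)"
    using assms(2)
  proof (induction rule: span_induct_alt)
    case base
    show ?case by (intro exI[of _ "{}"]) auto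
  next
    case (step c y z)
    obtain I v where I: "finite I" "I \<subseteq> A" "\<forall>i\<in>I. v i \<in> weight_space scale T H (w i)"
      "z = (\<Sum>i\<in>I. v i)" using step.IH by blast
    obtain k where k: "k \<in> A" "y \<in> weight_space scale T H (w k)" using step.hyps by blast
    define v' where "v' = v(k := scale c y + (if k \<in> I then v k else 0))"
    have "(\<Sum>i\<in>insert k I. v' i) = v' k + (\<Sum>i\<in>I - {k}. v' i)"
      using I(1) by (metis finite_insert insertI1 insert_Diff_single sum.insert_remove)
    also have "(\<Sum>i\<in>I - {k}. v' i) = (\<Sum>i\<in>I - {k}. v i)"
      by (rule sum.cong) (auto simp: v'_def)
    also have "v' k + \<dots> = scale c y + z"
      using I(1,4) by (cases "k \<in> I") (auto simp: v'_def sum.remove add.assoc)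
    finally have "scale c y + z = (\<Sum>i\<in>insert k I. v' i)" ..
    moreover have "\<forall>i\<in>insert k I. v' i \<in> weight_space scale T H (w i)"
      using I(3) k(2)
      by (auto simp: v'_def weight_space_def linear_endo[OF lin] scale_right_distrib mult.commute)
    ultimately show ?case using I(1,2) k(1) by (intro exI[of _ "insert k I"] exI[of _ v']) auto
  qed
  then show ?thesis using that by blast
qed

text \<open>
  Each new operator \<open>T h\<close> preserves the joint eigenspaces of the previous ones, so the
  components of a joint eigenvector with respect to the eigenspaces of \<open>T h\<close> are again joint
  eigenvectors.
\<close>

lemma (in vector_space) commuting_diagonalizable_span:
  assumes "finite B"
    and "\<And>h. h \<in> B \<Longrightarrow> Vector_Spaces.linear scale scale (T h)"
    and "\<And>h k x. h \<in> B \<Longrightarrow> k \<in> B \<Longrightarrow> T h (T k x) = T k (T h x)"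
    and "\<And>h. h \<in> B \<Longrightarrow> span {x. \<exists>c. T h x = scale c x} = UNIV"
  shows "span (\<Union>w. weight_space scale T B w) = UNIV"
  using assms
proof (induction B rule: finite_induct)
  case empty
  then show ?case by (simp add: weight_space_def span_UNIV)
next
  case (insert h B)
  have "(\<Union>w. weight_space scale T B w) \<subseteq> span (\<Union>w. weight_space scale T (insert h B) w)"
  proof clarify
    fix x w assume x: "x \<in> weight_space scale T B w"
    have lin: "Vector_Spaces.linear scale scale (T h)" using insert.prems(1) by simp
    have "{x. \<exists>c. T h x = scale c x} = (\<Union>c\<in>UNIV. weight_space scale T {h} (\<lambda>_. c))"
      by (auto simp: weight_space_def)
    then have "x \<in> span (\<Union>c\<in>UNIV. weight_space scale T {h} (\<lambda>_. c))"
      using insert.prems(3)[of h] by auto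
    then obtain I v where I: "finite I" "x = (\<Sum>c\<in>I. v c)"
      and "\<And>c. c \<in> I \<Longrightarrow> v c \<in> weight_space scale T {h} (\<lambda>_. c)"
      by (rule span_weight_vectors_decompose[rotated]) (use lin in auto)
    then have v: "\<And>c. c \<in> I \<Longrightarrow> T h (v c) = scale c (v c)" by (simp add: weight_space_def)
    have joint: "T b (v c) = scale (w b) (v c)" if b: "b \<in> B" and c: "c \<in> I" for b c
    proof -
      have linb: "Vector_Spaces.linear scale scale (T b)" using insert.prems(1) b by simp
      \<comment> \<open>The components of \<open>T b x - w b x = 0\<close> are again eigenvectors of \<open>T h\<close>,
         since \<open>T b\<close> commutes with \<open>T h\<close>.\<close>
      have "\<forall>c\<in>I. T b (v c) - scale (w b) (v c) = 0"
      proof (rule weight_vectors_independent[where H = "{h}" and T = T and w = "\<lambda>c _. c"])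
        have "T b x = scale (w b) x" using x b by (simp add: weight_space_def)
        then show "(\<Sum>c\<in>I. T b (v c) - scale (w b) (v c)) = 0"
          by (simp add: sum_subtractf I(2) linear_endo[OF linb] scale_sum_right)
        show "T b (v c) - scale (w b) (v c) \<in> weight_space scale T {h} (\<lambda>_. c)" if "c \<in> I" for c
          using insert.prems(2)[of h b "v c"] b v[OF that]
          by (simp add: weight_space_def linear_endo[OF lin] linear_endo[OF linb]
              scale_right_diff_distrib mult.commute)
      qed (use I(1) lin in auto)
      then show ?thesis using c by simp
    qed
    have "v c \<in> span (\<Union>w. weight_space scale T (insert h B) w)" if "c \<in> I" for c
    proof (rule span_base)
      have "v c \<in> weight_space scale T (insert h B) (w(h := c))"
        using joint[OF _ that] v[OF that] insert.hyps by (auto simp: weight_space_def)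
      then show "v c \<in> (\<Union>w. weight_space scale T (insert h B) w)" by blast
    qed
    then show "x \<in> span (\<Union>w. weight_space scale T (insert h B) w)"
      unfolding I(2) by (rule span_sum)
  qed
  then have "span (\<Union>w. weight_space scale T B w) \<subseteq> span (\<Union>w. weight_space scale T (insert h B) w)"
    by (simp add: span_minimal)
  then show ?case using insert.IH insert.prems by auto
qed

lemma (in vector_space) finite_weights:
  assumes lin: "\<And>h. h \<in> H \<Longrightarrow> Vector_Spaces.linear scale scale (T h)"
    and distinct: "\<And>i j. i \<in> A \<Longrightarrow> j \<in> A \<Longrightarrow> i \<noteq> j \<Longrightarrow> \<exists>h\<in>H. w i h \<noteq> w j h"
    and fin: "finite B" "span B = UNIV"
    and ex: "\<And>i. i \<in> A \<Longrightarrow> \<exists>v\<in>weight_space scale T H (w i). v \<noteq> 0"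
  shows "finite A"
proof -
  obtain v where v: "\<And>i. i \<in> A \<Longrightarrow> v i \<in> weight_space scale T H (w i)" "\<And>i. i \<in> A \<Longrightarrow> v i \<noteq> 0"
    using ex by metis
  have inj: "inj_on v A"
  proof (rule inj_onI, rule ccontr)
    fix i j assume ij: "i \<in> A" "j \<in> A" "v i = v j" "i \<noteq> j"
    then obtain h where h: "h \<in> H" "w i h \<noteq> w j h" using distinct by blast
    have "scale (w i h) (v i) = scale (w j h) (v i)"
      using v(1)[OF ij(1)] v(1)[OF ij(2)] h(1) ij(3) by (auto simp: weight_space_def)
    then show False using h v(2)[OF ij(1)] by simp
  qed
  have "independent (v ` A)"
    unfolding independent_explicit_finite_subsets
  proof (intro allI impI)
    fix S u assume S: "S \<subseteq> v ` A" "finite S" "(\<Sum>x\<in>S. scale (u x) x) = 0"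
    then obtain I where I: "I \<subseteq> A" "S = v ` I" using subset_imageE by metis
    have injI: "inj_on v I" using inj I(1) inj_on_subset by blast
    have finI: "finite I" using S(2) I(2) injI finite_imageD by blast
    have "\<forall>i\<in>I. scale (u (v i)) (v i) = 0"
    proof (rule weight_vectors_independent[OF lin])
      show "(\<Sum>i\<in>I. scale (u (v i)) (v i)) = 0"
        using S(3) I(2) injI by (simp add: sum.reindex)
      show "scale (u (v i)) (v i) \<in> weight_space scale T H (w i)" if "i \<in> I" for i
        using v(1)[of i] I(1) that by (auto simp: weight_space_def linear_endo[OF lin] mult.commute)
    qed (use distinct finI I(1) in auto)
    then show "\<forall>x\<in>S. u x = 0" using I v(2) by auto
  qed
  then have "finite (v ` A)" using independent_span_bound[OF fin(1), of "v ` A"] fin(2) by simp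
  then show ?thesis using inj finite_imageD by blast
qed

section \<open>Strings of weights under sl2\<close>

text \<open>
  The triple \<open>E, F, K\<close> is a representation of \<open>sl\<^sub>2\<close> on a finite-dimensional space. Raising \<open>v\<close>
  as far as possible gives a highest weight vector of weight \<open>p = k + 2 * j\<close>, and
  \<open>E F\<^bsup>q+1\<^esup> u = (q + 1) (p - q) F\<^bsup>q\<^esup> u\<close> shows that \<open>F\<^bsup>q\<^esup> u \<noteq> 0\<close> for \<open>q \<le> p\<close>. The lowering by \<open>q = j + t\<close>
  steps has the weight of \<open>v\<close> shifted down by \<open>t\<close> steps.
\<close>

lemma sl2_string:
  fixes sc :: "'k::field_char_0 \<Rightarrow> 'v::ab_group_add \<Rightarrow> 'v"
  assumes vs: "vector_space sc"
    and lin: "Vector_Spaces.linear sc sc E" "Vector_Spaces.linear sc sc F" "Vector_Spaces.linear sc sc K"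
    and EF: "\<And>u. E (F u) - F (E u) = K u"
    and KE: "\<And>u. K (E u) - E (K u) = sc 2 (E u)"
    and KF: "\<And>u. K (F u) - F (K u) = sc (- 2) (F u)"
    and fin: "finite B" "module.span sc B = UNIV"
    and v: "K v = sc (of_nat k) v" "v \<noteq> 0"
    and t: "t \<le> k"
  shows "\<exists>j. (F ^^ (j + t)) ((E ^^ j) v) \<noteq> 0"
proof -
  interpret vector_space sc by (rule vs)
  note LE = linear_endo[OF lin(1)] and LF = linear_endo[OF lin(2)] and LK = linear_endo[OF lin(3)]
  have KE': "K (E u) = E (K u) + sc 2 (E u)" for u using KE[of u] by (simp add: algebra_simps)
  have KF': "K (F u) = F (K u) - sc 2 (F u)" for u using KF[of u] by (simp add: algebra_simps)
  have EF': "E (F u) = F (E u) + K u" for u using EF[of u] by (simp add: algebra_simps)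
  have powE: "K ((E ^^ j) u) = sc (c + 2 * of_nat j) ((E ^^ j) u)" if "K u = sc c u" for u c j
    by (induction j) (auto simp: that KE' LE algebra_simps)
  have powF: "K ((F ^^ j) u) = sc (c - 2 * of_nat j) ((F ^^ j) u)" if "K u = sc c u" for u c j
  proof (induction j)
    case (Suc j)
    have "K ((F ^^ Suc j) u) = sc (c - 2 * of_nat j) ((F ^^ Suc j) u) - sc 2 ((F ^^ Suc j) u)"
      by (simp add: KF' Suc LF)
    also have "\<dots> = sc (c - 2 * of_nat j - 2) ((F ^^ Suc j) u)"
      by (simp only: scale_left_diff_distrib)
    also have "c - 2 * of_nat j - 2 = c - 2 * of_nat (Suc j)" by (simp add: algebra_simps)
    finally show ?case .
  qed (simp add: that)
  have nilp: "\<exists>j. z j = 0" if z: "\<And>j. K (z j) = sc (c + s * of_nat j) (z j)" and s: "s \<noteq> 0" for z c s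
  proof (rule ccontr)
    assume nz: "\<nexists>j. z j = 0"
    have "finite (UNIV :: nat set)"
    proof (rule finite_weights[where H = "{K}" and T = "\<lambda>f. f" and w = "\<lambda>j _. c + s * of_nat j"])
      show "\<exists>v\<in>weight_space sc (\<lambda>f. f) {K} (\<lambda>_. c + s * of_nat i). v \<noteq> 0" for i :: nat
        by (rule bexI[of _ "z i"]) (use nz z in \<open>auto simp: weight_space_def\<close>)
    qed (use lin fin s in auto)
    then show False by simp
  qed
  obtain j1 where "(E ^^ j1) v = 0"
    using nilp[of "\<lambda>j. (E ^^ j) v" "of_nat k" 2] powE[OF v(1)] by auto
  moreover have "(E ^^ 0) v \<noteq> 0" using v(2) by simp
  ultimately obtain j where j: "(E ^^ j) v \<noteq> 0" "(E ^^ Suc j) v = 0"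
    using LeastI_ex[of "\<lambda>j. (E ^^ j) v = 0"] not_less_Least[of _ "\<lambda>j. (E ^^ j) v = 0"]
    by (metis less_Suc_eq not0_implies_Suc)
  define u where "u = (E ^^ j) v"
  define p where "p = (of_nat (k + 2 * j) :: 'k)"
  have u: "u \<noteq> 0" "E u = 0" "K u = sc p u"
    using j powE[OF v(1), of j] by (auto simp: u_def p_def)
  have EFq: "E ((F ^^ Suc q) u) = sc (of_nat (Suc q) * (p - of_nat q)) ((F ^^ q) u)" for q
  proof (induction q)
    case 0
    then show ?case using u by (simp add: EF' LF)
  next
    case (Suc q)
    have "E ((F ^^ Suc (Suc q)) u) = F (E ((F ^^ Suc q) u)) + K ((F ^^ Suc q) u)"
      by (simp add: EF')
    also have "F (E ((F ^^ Suc q) u)) = sc (of_nat (Suc q) * (p - of_nat q)) ((F ^^ Suc q) u)"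
      unfolding Suc.IH by (simp add: LF)
    also have "K ((F ^^ Suc q) u) = sc (p - 2 * of_nat (Suc q)) ((F ^^ Suc q) u)"
      by (rule powF[OF u(3)])
    also have "sc (of_nat (Suc q) * (p - of_nat q)) ((F ^^ Suc q) u) + \<dots> =
        sc (of_nat (Suc q) * (p - of_nat q) + (p - 2 * of_nat (Suc q))) ((F ^^ Suc q) u)"
      by (simp only: scale_left_distrib)
    also have "of_nat (Suc q) * (p - of_nat q) + (p - 2 * of_nat (Suc q)) =
        of_nat (Suc (Suc q)) * (p - of_nat (Suc q))"
      by (simp add: algebra_simps)
    finally show ?case .
  qed
  have "(F ^^ q) u \<noteq> 0" if "q \<le> k + 2 * j" for q
    using that
  proof (induction q)
    case 0
    then show ?case using u by simp
  next
    case (Suc q)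
    have "p - of_nat q \<noteq> 0" unfolding p_def using Suc.prems
      by (metis Suc_n_not_le_n of_nat_eq_iff right_minus_eq)
    then have "E ((F ^^ Suc q) u) \<noteq> 0"
      unfolding EFq using Suc by (simp del: of_nat_Suc)
    then show ?case using LE(3) by metis
  qed
  from this[of "j + t"] t have "(F ^^ (j + t)) ((E ^^ j) v) \<noteq> 0" by (simp add: u_def)
  then show ?thesis by blast
qed

section \<open>Root space decomposition\<close>

lemma cartan_dual_eqI:
  assumes "\<theta> \<in> cartan_dual sg H" "\<nu> \<in> cartan_dual sg H" "\<And>h. h \<in> H \<Longrightarrow> \<theta> h = \<nu> h"
  shows "\<theta> = \<nu>"
proof
  fix x show "\<theta> x = \<nu> x" using assms by (cases "x \<in> H") (auto simp: cartan_dual_def)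
qed

lemma (in cartan_subalgebra) cartan_dual_distinct:
  assumes "\<theta> \<in> cartan_dual sg H" "\<nu> \<in> cartan_dual sg H" "\<theta> \<noteq> \<nu>"
  shows "\<exists>h\<in>H. \<theta> h \<noteq> \<nu> h"
  using assms cartan_dual_eqI by metis

context lie_algebra begin

lemmas br_right = linear_endo[OF linear_br_right]
lemmas br_left = linear_endo[OF linear_br_left]

lemma br_antisym: "br x y = - br y x"
proof -
  have "br (x + y) (x + y) = br x x + br y y + (br x y + br y x)"
    by (simp add: br_right br_left)
  then show ?thesis by (simp add: br_self eq_neg_iff_add_eq_0)
qed

lemma br_derivation: "br h (br k x) = br (br h k) x + br k (br h x)"
proof -
  have "br h (br k x) + br k (br x h) + br x (br h k) = 0" by (rule jacobi)
  moreover have "br k (br x h) = - br k (br h x)" using br_antisym[of x h] br_right(6) by metis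
  moreover have "br x (br h k) = - br (br h k) x" by (rule br_antisym)
  ultimately show ?thesis by (simp add: algebra_simps)
qed

end

locale finite_dim_cartan = cartan_subalgebra sg br H
  for sg :: "'k::field \<Rightarrow> 'g::ab_group_add \<Rightarrow> 'g" and br H +
  assumes finite_dim: "\<exists>B. finite B \<and> span B = UNIV"
begin

text \<open>
  The operators \<open>br h\<close> for \<open>h\<close> in a basis of \<open>H\<close> commute and are diagonalizable; their
  eigenvalues at a joint eigenvector are the values of a linear functional on \<open>H\<close>.
\<close>

lemma root_space_decomposition:
  "span (\<Union>\<theta>\<in>cartan_dual sg H. weight_space sg br H \<theta>) = UNIV"
proof -
  obtain B where B: "B \<subseteq> H" "independent B" "H \<subseteq> span B" by (rule maximal_independent_subset)
  have "finite B" using finite_dim independent_span_bound[OF _ B(2)] by auto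
  have "weight_space sg br B w \<subseteq> (\<Union>\<theta>\<in>cartan_dual sg H. weight_space sg br H \<theta>)" for w
  proof
    fix x assume x: "x \<in> weight_space sg br B w"
    show "x \<in> (\<Union>\<theta>\<in>cartan_dual sg H. weight_space sg br H \<theta>)"
    proof (cases "x = 0")
      case True
      have "(\<lambda>_. 0) \<in> cartan_dual sg H" by (simp add: cartan_dual_def)
      moreover have "x \<in> weight_space sg br H (\<lambda>_. 0)" by (simp add: True weight_space_def br_right)
      ultimately show ?thesis by blast
    next
      case False
      have eig: "\<exists>c. br h x = sg c x" if "h \<in> span B" for h
        using that
      proof (induction rule: span_induct_alt)
        case base
        then show ?case by (intro exI[of _ 0]) (simp add: br_left)
      next
        case (step c h k)
        then obtain d where "br k x = sg d x" by blast
        moreover have "br h x = sg (w h) x" using x step.hyps by (simp add: weight_space_def)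
        ultimately have "br (sg c h + k) x = sg (c * w h + d) x"
          by (simp add: br_left scale_left_distrib)
        then show ?case by blast
      qed
      define \<theta> where "\<theta> h = (if h \<in> H then SOME c. br h x = sg c x else 0)" for h
      have \<theta>: "br h x = sg (\<theta> h) x" if "h \<in> H" for h
        using someI_ex[OF eig[of h]] B(3) that by (auto simp: \<theta>_def)
      have "\<theta> \<in> cartan_dual sg H"
        unfolding cartan_dual_def
      proof (intro CollectI conjI ballI allI impI)
        fix h k assume hk: "h \<in> H" "k \<in> H"
        have "sg (\<theta> (h + k)) x = sg (\<theta> h + \<theta> k) x"
          using \<theta>[OF hk(1)] \<theta>[OF hk(2)] \<theta>[OF subspace_add[OF cartan_subspace hk]]
          by (simp add: br_left scale_left_distrib)
        then show "\<theta> (h + k) = \<theta> h + \<theta> k" using False by simp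
      next
        fix c h assume h: "h \<in> H"
        have "br (sg c h) x = sg (\<theta> (sg c h)) x"
          by (rule \<theta>[OF subspace_scale[OF cartan_subspace h]])
        moreover have "br (sg c h) x = sg (c * \<theta> h) x" using \<theta>[OF h] by (simp add: br_left)
        ultimately have "sg (\<theta> (sg c h)) x = sg (c * \<theta> h) x" by (rule subst)
        then show "\<theta> (sg c h) = c * \<theta> h" using False by simp
      qed (simp add: \<theta>_def)
      moreover have "x \<in> weight_space sg br H \<theta>" using \<theta> by (simp add: weight_space_def)
      ultimately show ?thesis by blast
    qed
  qed
  then have "(\<Union>w. weight_space sg br B w) \<subseteq> (\<Union>\<theta>\<in>cartan_dual sg H. weight_space sg br H \<theta>)"
    by blast
  moreover have "span (\<Union>w. weight_space sg br B w) = UNIV"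
  proof (rule commuting_diagonalizable_span)
    show "br h (br k x) = br k (br h x)" if "h \<in> B" "k \<in> B" for h k x
    proof -
      have "br h k = 0" using cartan_abelian that B(1) by blast
      then show ?thesis using br_derivation[of h k x] by (simp add: br_left)
    qed
    show "span {x. \<exists>c. br h x = sg c x} = UNIV" if "h \<in> B" for h
      using that B(1) cartan_diagonalizable by blast
  qed (use \<open>finite B\<close> linear_br_right in auto)
  ultimately show ?thesis using span_mono by blast
qed

end

section \<open>Root coordinates of the weights of a simple module\<close>

lemma sum_fun_upd:
  fixes y :: "nat \<Rightarrow> int"
  shows "(\<Sum>j=1..k. (y(i := a)) j) = (\<Sum>j=1..k. y j) + (if i \<in> {1..k} then a - y i else 0)"
proof -
  have "(\<Sum>j=1..k. (y(i := a)) j) = (\<Sum>j=1..k. y j + (if j = i then a - y i else 0))"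
    by (rule sum.cong) auto
  then show ?thesis by (simp add: sum.distrib)
qed

text \<open>
  This is the value at the i-th simple coroot of the weight that lies \<open>c\<^sub>1 \<alpha>\<^sub>1 + \<dots> + c\<^sub>n \<alpha>\<^sub>n\<close>
  below the m-th fundamental weight, when \<open>C\<close> is the Cartan matrix.
\<close>

definition coroot_value :: "(nat \<Rightarrow> nat \<Rightarrow> int) \<Rightarrow> nat \<Rightarrow> nat \<Rightarrow> (nat \<Rightarrow> int) \<Rightarrow> nat \<Rightarrow> int" where
  "coroot_value C n m c i = (if i = m then 1 else 0) - (\<Sum>j=1..n. C i j * c j)"

locale fundamental_module =
  simple_lie_algebra sg br + cartan_subalgebra sg br H + simple_lie_module sg br sv act
  for sg :: "'k::field_char_0 \<Rightarrow> 'g::ab_group_add \<Rightarrow> 'g" and br H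
    and sv :: "'k \<Rightarrow> 'v::ab_group_add \<Rightarrow> 'v" and act +
  fixes n :: nat and \<alpha> :: "nat \<Rightarrow> 'g \<Rightarrow> 'k" and hc :: "nat \<Rightarrow> 'g"
    and C :: "nat \<Rightarrow> nat \<Rightarrow> int" and m :: nat and \<mu> :: "'g \<Rightarrow> 'k"
  assumes simple_roots: "simple_roots sg br H n \<alpha>"
    and coroots: "i \<in> {1..n} \<Longrightarrow> is_coroot sg br H (\<alpha> i) (hc i)"
    and cartan: "i \<in> {1..n} \<Longrightarrow> j \<in> {1..n} \<Longrightarrow> \<alpha> j (hc i) = of_int (C i j)"
    and highest: "highest_weight sg br H n \<alpha> sv act \<mu>"
    and fundamental: "fundamental_weight sg H n hc m \<mu>"
begin

sublocale finite_dim_cartan sg br H by unfold_locales (rule finite_dim)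

lemmas act_right = V.linear_endo[OF linear_act_right]

lemma act_left: "act (x + y) v = act x v + act y v" "act (sg c x) v = sv c (act x v)"
  "act (- x) v = - act x v" "act 0 v = 0"
proof -
  interpret L: Vector_Spaces.linear sg sv "\<lambda>x. act x v" by (rule linear_act_left)
  show "act (x + y) v = act x v + act y v" "act (sg c x) v = sv c (act x v)"
    "act (- x) v = - act x v" "act 0 v = 0"
    by (simp_all add: L.add L.scale L.neg L.zero)
qed

abbreviation P :: "('g \<Rightarrow> 'k) set" where "P \<equiv> weights sg sv act H"

definition wt :: "(nat \<Rightarrow> int) \<Rightarrow> 'g \<Rightarrow> 'k" where
  "wt c = (\<lambda>x. \<mu> x - (\<Sum>i=1..n. of_int (c i) * \<alpha> i x))"

text \<open>
  Only the entries at \<open>1, \<dots>, n\<close> influence \<open>wt\<close>; normalizing the others to 0 makes \<open>wt\<close>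
  injective.
\<close>

definition root_coords :: "(nat \<Rightarrow> int) set" where
  "root_coords = {c. (\<forall>i. i \<notin> {1..n} \<longrightarrow> c i = 0) \<and> wt c \<in> P}"

lemma root_in_dual: "i \<in> {1..n} \<Longrightarrow> \<alpha> i \<in> cartan_dual sg H"
  using simple_roots by (auto simp: simple_roots_def roots_def weights_def)

lemma wt_in_dual: "wt c \<in> cartan_dual sg H"
proof -
  have mu: "\<mu> \<in> cartan_dual sg H" using highest by (simp add: highest_weight_def)
  have add: "(\<Sum>i=1..n. of_int (c i) * \<alpha> i (x + y)) =
      (\<Sum>i=1..n. of_int (c i) * \<alpha> i x) + (\<Sum>i=1..n. of_int (c i) * \<alpha> i y)" if "x \<in> H" "y \<in> H" for x y
    unfolding sum.distrib[symmetric]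
    by (rule sum.cong) (use root_in_dual that in \<open>auto simp: cartan_dual_def algebra_simps\<close>)
  have scale: "(\<Sum>i=1..n. of_int (c i) * \<alpha> i (sg a x)) = a * (\<Sum>i=1..n. of_int (c i) * \<alpha> i x)"
    if "x \<in> H" for a x
    unfolding sum_distrib_left
    by (rule sum.cong) (use root_in_dual that in \<open>auto simp: cartan_dual_def algebra_simps\<close>)
  have out: "(\<Sum>i=1..n. of_int (c i) * \<alpha> i x) = 0" if "x \<notin> H" for x
    by (rule sum.neutral) (use root_in_dual that in \<open>auto simp: cartan_dual_def\<close>)
  show ?thesis unfolding cartan_dual_def wt_def mem_Collect_eq using mu
    by (auto simp: add scale out cartan_dual_def algebra_simps simp del: One_nat_def)
qed

lemma wt_inject:
  assumes "wt c = wt d" "\<forall>i. i \<notin> {1..n} \<longrightarrow> c i = 0" "\<forall>i. i \<notin> {1..n} \<longrightarrow> d i = 0"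
  shows "c = d"
proof
  fix i
  have s0: "(\<Sum>i=1..n. (of_int (c i) - of_int (d i)) * \<alpha> i h) = 0" for h
    using fun_cong[OF assms(1), of h] by (simp add: wt_def left_diff_distrib sum_subtractf)
  have "(\<forall>h\<in>H. (\<Sum>i=1..n. b i * \<alpha> i h) = 0) \<longrightarrow> (\<forall>i\<in>{1..n}. b i = 0)"
    for b :: "nat \<Rightarrow> 'k"
    using simple_roots unfolding simple_roots_def by blast
  from this[of "\<lambda>i. of_int (c i) - of_int (d i)"]
  have "\<forall>i\<in>{1..n}. (of_int (c i) - of_int (d i) :: 'k) = 0" using s0 by blast
  then show "c i = d i" using assms(2,3) by (cases "i \<in> {1..n}") auto
qed

lemma wt_upd:
  assumes "i \<in> {1..n}"
  shows "wt (c(i := c i + t)) = (\<lambda>x. wt c x - of_int t * \<alpha> i x)"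
proof
  fix x
  have "(\<Sum>j=1..n. of_int ((c(i := c i + t)) j) * \<alpha> j x) =
      (\<Sum>j=1..n. of_int (c j) * \<alpha> j x + (if j = i then of_int t * \<alpha> i x else 0))"
    by (rule sum.cong) (auto simp: algebra_simps)
  also have "\<dots> = (\<Sum>j=1..n. of_int (c j) * \<alpha> j x) + of_int t * \<alpha> i x"
    using assms by (simp add: sum.distrib)
  finally show "wt (c(i := c i + t)) x = wt c x - of_int t * \<alpha> i x"
    by (simp add: wt_def)
qed

lemma wt_coroot:
  assumes "i \<in> {1..n}"
  shows "wt c (hc i) = of_int (coroot_value C n m c i)"
proof -
  have "(\<Sum>j=1..n. of_int (c j) * \<alpha> j (hc i)) = of_int (\<Sum>j=1..n. C i j * c j)"
    unfolding of_int_sum by (rule sum.cong) (use assms cartan in auto)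
  then show ?thesis using assms fundamental
    by (auto simp: wt_def coroot_value_def fundamental_weight_def)
qed

lemma act_weight_space:
  assumes "y \<in> weight_space sg br H \<beta>" "u \<in> weight_space sv act H \<theta>"
  shows "act y u \<in> weight_space sv act H (\<lambda>x. \<theta> x + \<beta> x)"
  unfolding weight_space_def
proof (intro CollectI ballI)
  fix h assume "h \<in> H"
  then have "br h y = sg (\<beta> h) y" "act h u = sv (\<theta> h) u" using assms by (auto simp: weight_space_def)
  moreover have "act h (act y u) = act (br h y) u + act y (act h u)" by (simp add: act_br)
  ultimately show "act h (act y u) = sv (\<theta> h + \<beta> h) (act y u)"
    by (simp add: act_left act_right V.scale_left_distrib add.commute)
qed

lemma act_pow_weight_space:
  assumes "y \<in> weight_space sg br H \<beta>" "u \<in> weight_space sv act H \<theta>"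
  shows "(act y ^^ j) u \<in> weight_space sv act H (\<lambda>x. \<theta> x + of_nat j * \<beta> x)"
proof (induction j)
  case 0
  then show ?case using assms(2) by simp
next
  case (Suc j)
  from act_weight_space[OF assms(1) Suc] show ?case by (simp add: algebra_simps)
qed

text \<open>
  The functional \<open>\<beta>\<close> may be any nonnegative combination of simple roots; besides the
  negative root spaces this only admits \<open>H\<close> and zero spaces.
\<close>

inductive_set lowered :: "'v \<Rightarrow> 'v set" for v where
  base: "v \<in> lowered v"
| step: "u \<in> lowered v \<Longrightarrow> \<beta> \<in> nonneg_combinations n \<alpha> \<Longrightarrow>
    y \<in> weight_space sg br H (\<lambda>x. - \<beta> x) \<Longrightarrow> act y u \<in> lowered v"

lemma lowered_weight:
  assumes "v \<in> weight_space sv act H \<mu>" "u \<in> lowered v"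
  shows "\<exists>c. u \<in> weight_space sv act H (wt (\<lambda>i. int (c i)))"
  using assms(2)
proof (induction rule: lowered.induct)
  case base
  show ?case by (rule exI[of _ "\<lambda>_. 0"]) (use assms(1) in \<open>simp add: wt_def\<close>)
next
  case (step u \<beta> y)
  then obtain c where c: "u \<in> weight_space sv act H (wt (\<lambda>i. int (c i)))" by blast
  obtain d :: "nat \<Rightarrow> nat" where d: "\<beta> = (\<lambda>x. \<Sum>i=1..n. of_nat (d i) * \<alpha> i x)"
    using step.hyps by (auto simp: nonneg_combinations_def)
  have "act y u \<in> weight_space sv act H (\<lambda>x. wt (\<lambda>i. int (c i)) x + - \<beta> x)"
    by (rule act_weight_space[OF step.hyps(3) c])
  also have "(\<lambda>x. wt (\<lambda>i. int (c i)) x + - \<beta> x) = wt (\<lambda>i. int (c i + d i))"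
    by (simp add: wt_def d fun_eq_iff sum.distrib algebra_simps)
  finally show ?case by (rule exI[of _ "\<lambda>i. c i + d i"])
qed

text \<open>
  The span is a submodule by induction on the number of lowering operators: an arbitrary \<open>x\<close>
  is moved past the outermost \<open>y\<close> by \<open>x y u = [x, y] u + y x u\<close>, where the induction
  hypothesis is available for all elements of the Lie algebra, in particular for \<open>[x, y]\<close>.
  Only at the highest weight vector itself is \<open>x\<close> decomposed into root vectors.
\<close>

lemma lowered_span:
  assumes v: "v \<in> weight_space sv act H \<mu>" "v \<noteq> 0"
    and killed: "\<And>\<beta> x. \<beta> \<in> positive_roots sg br H n \<alpha> \<Longrightarrow> x \<in> weight_space sg br H \<beta> \<Longrightarrow> act x v = 0"
  shows "V.span (lowered v) = UNIV"
proof -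
  have gen: "act x u \<in> V.span (lowered v)"
    if "\<And>\<theta> x. \<theta> \<in> cartan_dual sg H \<Longrightarrow> x \<in> weight_space sg br H \<theta> \<Longrightarrow> act x u \<in> V.span (lowered v)"
    for x u
  proof -
    have "x \<in> span (\<Union>\<theta>\<in>cartan_dual sg H. weight_space sg br H \<theta>)"
      using root_space_decomposition by simp
    then show ?thesis
      by (induction rule: span_induct_alt)
        (auto simp: act_left V.span_zero intro!: V.span_add V.span_scale that)
  qed
  have lower: "act y w \<in> V.span (lowered v)"
    if "w \<in> V.span (lowered v)" "\<beta> \<in> nonneg_combinations n \<alpha>" "y \<in> weight_space sg br H (\<lambda>x. - \<beta> x)"
    for w \<beta> y
    using that(1)
  proof (induction rule: V.span_induct_alt)
    case base
    then show ?case by (simp add: act_right V.span_zero)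
  next
    case (step c u w)
    have "act y u \<in> lowered v" by (rule lowered.step[OF step.hyps that(2,3)])
    then show ?case using step.IH by (simp add: act_right V.span_add V.span_scale V.span_base)
  qed
  have stable: "act x u \<in> V.span (lowered v)" if "u \<in> lowered v" for x u
    using that
  proof (induction arbitrary: x rule: lowered.induct)
    case base
    show ?case
    proof (rule gen)
      fix \<theta> x assume \<theta>: "\<theta> \<in> cartan_dual sg H" and x: "x \<in> weight_space sg br H \<theta>"
      consider "x = 0" | "\<theta> = (\<lambda>_. 0)" | "\<theta> \<in> roots sg br H"
        using \<theta> x by (auto simp: roots_def weights_def)
      then show "act x v \<in> V.span (lowered v)"
      proof cases
        case 1
        then show ?thesis by (simp add: act_left V.span_zero)
      next
        case 2
        then have "x \<in> H" using x by (intro cartan_self_centralizing) (simp add: weight_space_def)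
        then have "act x v = sv (\<mu> x) v" using v(1) by (simp add: weight_space_def)
        then show ?thesis by (simp add: V.span_scale V.span_base lowered.base)
      next
        case 3
        then consider "\<theta> \<in> nonneg_combinations n \<alpha>" | "(\<lambda>x. - \<theta> x) \<in> nonneg_combinations n \<alpha>"
          using simple_roots unfolding simple_roots_def by blast
        then show ?thesis
        proof cases
          case 1
          then have "act x v = 0" using killed[OF _ x] 3 by (simp add: positive_roots_def)
          then show ?thesis by (simp add: V.span_zero)
        next
          case 2
          show ?thesis
            by (rule V.span_base, rule lowered.step[OF lowered.base 2]) (use x in simp)
        qed
      qed
    qed
  next
    case (step u \<beta> y)
    have "act x (act y u) = act (br x y) u + act y (act x u)" by (simp add: act_br)
    then show ?case using step.IH lower[OF step.IH step.hyps(2,3)] by (simp add: V.span_add)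
  qed
  have "V.span (lowered v) = {0} \<or> V.span (lowered v) = UNIV"
  proof (rule submodules)
    show "\<forall>x. \<forall>w\<in>V.span (lowered v). act x w \<in> V.span (lowered v)"
    proof (intro allI ballI)
      fix x w assume "w \<in> V.span (lowered v)"
      then show "act x w \<in> V.span (lowered v)"
        by (induction rule: V.span_induct_alt)
          (auto simp: act_right V.span_zero intro!: V.span_add V.span_scale stable)
    qed
  qed simp
  moreover have "v \<in> V.span (lowered v)" by (simp add: V.span_base lowered.base)
  ultimately show ?thesis using v(2) by auto
qed

text \<open>
  The module is spanned by weight vectors of such weights, and weight vectors of different
  weights are independent.
\<close>

lemma weights_below_highest:
  assumes "\<theta> \<in> P"
  shows "\<exists>c. \<theta> = wt (\<lambda>i. int (c i))"
proof (rule ccontr)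
  assume no: "\<nexists>c. \<theta> = wt (\<lambda>i. int (c i))"
  define A where "A = range (\<lambda>c. wt (\<lambda>i. int (c i)))"
  have dual: "\<nu> \<in> cartan_dual sg H" if "\<nu> \<in> insert \<theta> A" for \<nu>
    using that assms wt_in_dual by (auto simp: A_def weights_def)
  obtain u where u: "u \<in> weight_space sv act H \<theta>" "u \<noteq> 0"
    using assms by (auto simp: weights_def)
  obtain v where v: "v \<in> weight_space sv act H \<mu>" "v \<noteq> 0"
    "\<forall>\<beta>\<in>positive_roots sg br H n \<alpha>. \<forall>x\<in>weight_space sg br H \<beta>. act x v = 0"
    using highest by (auto simp: highest_weight_def)
  have "lowered v \<subseteq> (\<Union>\<nu>\<in>A. weight_space sv act H \<nu>)"
    using lowered_weight[OF v(1)] by (auto simp: A_def)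
  then have "V.span (\<Union>\<nu>\<in>A. weight_space sv act H \<nu>) = UNIV"
    using lowered_span[OF v(1,2)] v(3) V.span_mono by blast
  then have "u \<in> V.span (\<Union>\<nu>\<in>A. weight_space sv act H \<nu>)" by simp
  then obtain I w where I: "finite I" "I \<subseteq> A" "u = (\<Sum>\<nu>\<in>I. w \<nu>)"
    "\<And>\<nu>. \<nu> \<in> I \<Longrightarrow> w \<nu> \<in> weight_space sv act H \<nu>"
    by (rule V.span_weight_vectors_decompose[rotated]) (use linear_act_right in auto)
  have nin: "\<theta> \<notin> I" using no I(2) by (auto simp: A_def)
  have "\<forall>\<nu>\<in>insert \<theta> I. (w(\<theta> := - u)) \<nu> = 0"
  proof (rule V.weight_vectors_independent[where H = H and T = act and w = "\<lambda>\<nu>. \<nu>"])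
    show "\<exists>h\<in>H. \<nu> h \<noteq> \<kappa> h" if "\<nu> \<in> insert \<theta> I" "\<kappa> \<in> insert \<theta> I" "\<nu> \<noteq> \<kappa>" for \<nu> \<kappa>
      using cartan_dual_distinct[OF dual dual that(3)] that I(2) by blast
    show "(w(\<theta> := - u)) \<nu> \<in> weight_space sv act H \<nu>" if "\<nu> \<in> insert \<theta> I" for \<nu>
      using that I(4) u(1) by (auto simp: weight_space_def act_right)
    have "(\<Sum>\<nu>\<in>I. (w(\<theta> := - u)) \<nu>) = u"
      unfolding I(3) by (rule sum.cong) (use nin in auto)
    then show "(\<Sum>\<nu>\<in>insert \<theta> I. (w(\<theta> := - u)) \<nu>) = 0" using I(1) nin by simp
  qed (use I(1) linear_act_right in auto)
  then show False using u(2) by simp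
qed

lemma finite_P: "finite P"
proof -
  obtain B where B: "finite B" "V.span B = UNIV" using module_finite_dim by blast
  show ?thesis
  proof (rule V.finite_weights[OF _ _ B, where H = H and T = act and w = "\<lambda>\<nu>. \<nu>"])
    show "\<exists>h\<in>H. \<nu> h \<noteq> \<kappa> h" if "\<nu> \<in> P" "\<kappa> \<in> P" "\<nu> \<noteq> \<kappa>" for \<nu> \<kappa>
      using that cartan_dual_distinct by (auto simp: weights_def)
  qed (auto simp: weights_def linear_act_right)
qed

lemma wt_image_root_coords: "P = wt ` root_coords"
proof
  show "P \<subseteq> wt ` root_coords"
  proof
    fix \<theta> assume l: "\<theta> \<in> P"
    then obtain c where c: "\<theta> = wt (\<lambda>i. int (c i))" using weights_below_highest by blast
    have "\<theta> = wt (\<lambda>i. if i \<in> {1..n} then int (c i) else 0)"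
      unfolding c wt_def by auto
    then show "\<theta> \<in> wt ` root_coords" using l by (auto simp: root_coords_def)
  qed
qed (auto simp: root_coords_def)

lemma inj_on_wt: "inj_on wt root_coords"
  by (rule inj_onI) (auto simp: root_coords_def intro: wt_inject)

lemma root_coords_outside: "c \<in> root_coords \<Longrightarrow> i \<notin> {1..n} \<Longrightarrow> c i = 0"
  by (simp add: root_coords_def)

lemma root_coords_nonneg:
  assumes "c \<in> root_coords"
  shows "0 \<le> c i"
proof (cases "i \<in> {1..n}")
  case True
  obtain d where d: "wt c = wt (\<lambda>i. int (d i))"
    using assms weights_below_highest by (auto simp: root_coords_def)
  also have "\<dots> = wt (\<lambda>i. if i \<in> {1..n} then int (d i) else 0)"
    unfolding wt_def by auto
  finally have "c = (\<lambda>i. if i \<in> {1..n} then int (d i) else 0)"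
    using assms by (intro wt_inject) (auto simp: root_coords_def)
  then show ?thesis by simp
next
  case False
  then show ?thesis using root_coords_outside[OF assms False] by simp
qed

lemma zero_root_coords: "(\<lambda>_. 0) \<in> root_coords"
  using highest by (auto simp: root_coords_def wt_def highest_weight_def weights_def)

text \<open>
  The functional \<open>\<beta>\<close> will be a simple root or, when the coroot value is negative, the
  negative of a simple root with the roles of \<open>e\<close> and \<open>f\<close> exchanged.
\<close>

lemma sl2_weight_string:
  assumes \<theta>: "\<theta> \<in> P" and e: "e \<in> weight_space sg br H \<beta>"
    and f: "f \<in> weight_space sg br H (\<lambda>x. - \<beta> x)"
    and h: "br e f \<in> H" "\<beta> (br e f) = 2"
    and k: "\<theta> (br e f) = of_nat k" "t \<le> k"
  shows "\<exists>u\<in>weight_space sv act H (\<lambda>x. \<theta> x - of_nat t * \<beta> x). u \<noteq> 0"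
proof -
  obtain v where v: "v \<in> weight_space sv act H \<theta>" "v \<noteq> 0" using \<theta> by (auto simp: weights_def)
  obtain B where B: "finite B" "V.span B = UNIV" using module_finite_dim by blast
  have "\<exists>j. (act f ^^ (j + t)) ((act e ^^ j) v) \<noteq> 0"
  proof (rule sl2_string[where K = "act (br e f)" and sc = sv])
    show "vector_space sv" by (rule V.vector_space_axioms)
    show "act (br e f) (act e u) - act e (act (br e f) u) = sv 2 (act e u)" for u
      using e h by (simp add: act_br[symmetric] weight_space_def act_left)
    show "act (br e f) (act f u) - act f (act (br e f) u) = sv (- 2) (act f u)" for u
    proof -
      have "br (br e f) f = sg (- 2) f" using f h by (auto simp: weight_space_def)
      then show ?thesis by (simp only: act_br[symmetric] act_left)
    qed
    show "act (br e f) v = sv (of_nat k) v" using v(1) h(1) k(1) by (simp add: weight_space_def)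
  qed (use linear_act_right B v k(2) in \<open>auto simp: act_br\<close>)
  then obtain j where "(act f ^^ (j + t)) ((act e ^^ j) v) \<noteq> 0" by blast
  moreover have "(act f ^^ (j + t)) ((act e ^^ j) v) \<in>
      weight_space sv act H (\<lambda>x. \<theta> x + of_nat j * \<beta> x + of_nat (j + t) * (- \<beta> x))"
    by (intro act_pow_weight_space e f v(1))
  moreover have "(\<lambda>x. \<theta> x + of_nat j * \<beta> x + of_nat (j + t) * (- \<beta> x)) =
      (\<lambda>x. \<theta> x - of_nat t * \<beta> x)"
    by (simp add: fun_eq_iff algebra_simps)
  ultimately show ?thesis by auto
qed

text \<open>
  For \<open>t\<close> equal to the coroot value this is the stability under the i-th simple reflection.
\<close>

lemma root_coords_string:
  assumes c: "c \<in> root_coords" and i: "i \<in> {1..n}"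
    and t: "0 \<le> t \<and> t \<le> coroot_value C n m c i \<or> coroot_value C n m c i \<le> t \<and> t \<le> 0"
  shows "c(i := c i + t) \<in> root_coords"
proof -
  obtain x y where xy: "\<alpha> i (hc i) = 2" "x \<in> weight_space sg br H (\<alpha> i)"
    "y \<in> weight_space sg br H (\<lambda>z. - \<alpha> i z)" "hc i = br x y"
    using coroots[OF i] by (auto simp: is_coroot_def)
  have hH: "hc i \<in> H"
    using xy(1) root_in_dual[OF i] by (fastforce simp: cartan_dual_def)
  have P: "wt c \<in> P" using c by (simp add: root_coords_def)
  have "\<exists>u\<in>weight_space sv act H (\<lambda>x. wt c x - of_int t * \<alpha> i x). u \<noteq> 0"
    using t
  proof (elim disjE conjE)
    assume "0 \<le> t" "t \<le> coroot_value C n m c i"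
    then show ?thesis
      using sl2_weight_string[OF P xy(2,3), of "nat (coroot_value C n m c i)" "nat t"]
        wt_coroot[OF i, of c] hH xy(1,4) by (auto simp: of_nat_nat)
  next
    assume t': "coroot_value C n m c i \<le> t" "t \<le> 0"
    have anti: "br y x = - hc i" using br_antisym[of y x] xy(4) by simp
    have mem: "br y x \<in> H" using anti hH cartan_subspace subspace_neg by auto
    have lin: "\<theta> (- hc i) = - \<theta> (hc i)" if "\<theta> \<in> cartan_dual sg H" for \<theta>
    proof -
      have "\<theta> (sg (- 1) (hc i)) = (- 1) * \<theta> (hc i)" using that hH unfolding cartan_dual_def by blast
      then show ?thesis by simp
    qed
    have "\<exists>u\<in>weight_space sv act H (\<lambda>x. wt c x - of_nat (nat (- t)) * (- \<alpha> i x)). u \<noteq> 0"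
    proof (rule sl2_weight_string[OF P xy(3)])
      show "x \<in> weight_space sg br H (\<lambda>z. - (- \<alpha> i z))" using xy(2) by simp
      show "- \<alpha> i (br y x) = 2" unfolding anti lin[OF root_in_dual[OF i]] using xy(1) by simp
      show "wt c (br y x) = of_nat (nat (- coroot_value C n m c i))"
        unfolding anti lin[OF wt_in_dual] wt_coroot[OF i] using t' by (simp add: of_nat_nat)
    qed (use t' mem in auto)
    then show ?thesis using t' by (simp add: of_nat_nat)
  qed
  then have "wt (c(i := c i + t)) \<in> P"
    using wt_in_dual[of "c(i := c i + t)"] unfolding wt_upd[OF i] by (auto simp: weights_def)
  then show ?thesis using c i by (auto simp: root_coords_def)
qed

section \<open>The weight poset in root coordinates\<close>

lemma root_step_iff:
  assumes "c \<in> root_coords" "d \<in> root_coords" "i \<in> {1..n}"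
  shows "(\<lambda>x. wt c x - wt d x) = \<alpha> i \<longleftrightarrow> d = c(i := c i + 1)"
proof -
  have "(\<lambda>x. wt c x - wt d x) = \<alpha> i \<longleftrightarrow> wt d = wt (c(i := c i + 1))"
    unfolding wt_upd[OF assms(3)] by (auto simp: fun_eq_iff algebra_simps)
  also have "\<dots> \<longleftrightarrow> d = c(i := c i + 1)"
    using assms wt_inject[of d "c(i := c i + 1)"] by (auto simp: root_coords_def)
  finally show ?thesis .
qed

text \<open>
  The root order is graded by the sum of the root coordinates; this excludes elements
  strictly between two weights that differ by a simple root.
\<close>

lemma root_order_height:
  assumes "root_order P n \<alpha> (wt d) (wt c)" "c \<in> root_coords" "d \<in> root_coords"
  shows "d = c \<or> (\<Sum>i=1..n. d i) > (\<Sum>i=1..n. c i)"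
proof -
  have "\<forall>d\<in>root_coords. \<gamma> = wt d \<longrightarrow> (\<forall>c\<in>root_coords. \<nu> = wt c \<longrightarrow> 
      d = c \<or> (\<Sum>i=1..n. d i) > (\<Sum>i=1..n. c i))" if "root_order P n \<alpha> \<gamma> \<nu>" for \<gamma> \<nu>
    using that unfolding root_order_def
  proof (induction rule: rtranclp_induct)
    case base
    then show ?case using inj_on_wt by (auto dest: inj_onD)
  next
    case (step \<kappa> \<nu>)
    show ?case
    proof (intro ballI impI)
      fix d c assume d: "d \<in> root_coords" "\<gamma> = wt d" and c: "c \<in> root_coords" "\<nu> = wt c"
      obtain b where b: "b \<in> root_coords" "\<kappa> = wt b"
        using step.hyps(2) wt_image_root_coords by blast
      obtain i where i: "i \<in> {1..n}" "b = c(i := c i + 1)"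
        using step.hyps(2) root_step_iff[OF c(1) b(1)] c(2) b(2) by blast
      have "(\<Sum>j=1..n. b j) = (\<Sum>j=1..n. c j) + 1"
        unfolding i(2) sum_fun_upd using i(1) by simp
      then show "d = c \<or> (\<Sum>i=1..n. d i) > (\<Sum>i=1..n. c i)"
        using step.IH d b by force
    qed
  qed
  then show ?thesis using assms by blast
qed

lemma poset_covers_iff:
  assumes c: "c \<in> root_coords"
  shows "poset_covers P (root_order P n \<alpha>) (wt c) \<gamma> \<longleftrightarrow>
    (\<exists>i\<in>{1..n}. c(i := c i + 1) \<in> root_coords \<and> \<gamma> = wt (c(i := c i + 1)))"
proof
  assume cov: "poset_covers P (root_order P n \<alpha>) (wt c) \<gamma>"
  then have g: "\<gamma> \<in> P" "\<gamma> \<noteq> wt c" "root_order P n \<alpha> \<gamma> (wt c)" by (auto simp: poset_covers_def)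
  from g(3)[unfolded root_order_def] g(2) obtain \<kappa> where k: "root_order P n \<alpha> \<gamma> \<kappa>" "\<kappa> \<in> P"
    "\<exists>i\<in>{1..n}. (\<lambda>x. wt c x - \<kappa> x) = \<alpha> i"
    unfolding root_order_def by cases auto
  obtain b where b: "b \<in> root_coords" "\<kappa> = wt b" using k(2) wt_image_root_coords by blast
  obtain i where i: "i \<in> {1..n}" "b = c(i := c i + 1)"
    using k(3) root_step_iff[OF c b(1)] b(2) by blast
  have "root_order P n \<alpha> \<kappa> (wt c)"
    unfolding root_order_def using k(2,3) c by (auto simp: root_coords_def)
  then have "\<kappa> = \<gamma> \<or> \<kappa> = wt c" using cov k by (auto simp: poset_covers_def)
  moreover have "\<kappa> \<noteq> wt c"
    using b c i inj_on_wt by (metis add_cancel_left_right fun_upd_idem_iff inj_onD one_neq_zero)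
  ultimately show "\<exists>i\<in>{1..n}. c(i := c i + 1) \<in> root_coords \<and> \<gamma> = wt (c(i := c i + 1))"
    using b i by auto
next
  assume "\<exists>i\<in>{1..n}. c(i := c i + 1) \<in> root_coords \<and> \<gamma> = wt (c(i := c i + 1))"
  then obtain i where i: "i \<in> {1..n}" "c(i := c i + 1) \<in> root_coords" "\<gamma> = wt (c(i := c i + 1))"
    by blast
  have PP: "wt c \<in> P" "\<gamma> \<in> P" using c i by (auto simp: root_coords_def)
  have "(\<lambda>x. wt c x - \<gamma> x) = \<alpha> i" using root_step_iff[OF c i(2,1)] i(3) by simp
  then have le: "root_order P n \<alpha> \<gamma> (wt c)" unfolding root_order_def using PP i(1) by blast
  have between: "z = \<gamma> \<or> z = wt c"
    if z: "z \<in> P" "root_order P n \<alpha> \<gamma> z" "root_order P n \<alpha> z (wt c)" for z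
  proof -
    obtain b where b: "b \<in> root_coords" "z = wt b" using z(1) wt_image_root_coords by blast
    have height: "(\<Sum>j=1..n. (c(i := c i + 1)) j) = (\<Sum>j=1..n. c j) + 1"
      unfolding sum_fun_upd using i(1) by simp
    have "c(i := c i + 1) = b \<or> (\<Sum>j=1..n. b j) < (\<Sum>j=1..n. (c(i := c i + 1)) j)"
      by (rule root_order_height[OF z(2)[unfolded i(3) b(2)] b(1) i(2)])
    moreover have "b = c \<or> (\<Sum>j=1..n. c j) < (\<Sum>j=1..n. b j)"
      by (rule root_order_height[OF z(3)[unfolded b(2)] c b(1)])
    ultimately have "c(i := c i + 1) = b \<or> b = c"
      unfolding height by linarith
    then show ?thesis using b(2) i(3) by blast
  qed
  have "\<gamma> \<noteq> wt c"
    using i(2,3) c inj_on_wt by (metis add_cancel_left_right fun_upd_idem_iff inj_onD one_neq_zero)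
  then show "poset_covers P (root_order P n \<alpha>) (wt c) \<gamma>"
    using PP le between by (auto simp: poset_covers_def)
qed

lemma card_covered:
  assumes c: "c \<in> root_coords"
  shows "card {\<gamma>. poset_covers P (root_order P n \<alpha>) (wt c) \<gamma>} =
    card {i\<in>{1..n}. c(i := c i + 1) \<in> root_coords}"
proof -
  have "{\<gamma>. poset_covers P (root_order P n \<alpha>) (wt c) \<gamma>} =
      (\<lambda>i. wt (c(i := c i + 1))) ` {i\<in>{1..n}. c(i := c i + 1) \<in> root_coords}"
    using poset_covers_iff[OF c] by auto
  moreover have "inj_on (\<lambda>i. wt (c(i := c i + 1))) {i\<in>{1..n}. c(i := c i + 1) \<in> root_coords}"
  proof (rule inj_onI)
    fix i j assume "i \<in> {i\<in>{1..n}. c(i := c i + 1) \<in> root_coords}"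
      "j \<in> {i\<in>{1..n}. c(i := c i + 1) \<in> root_coords}" "wt (c(i := c i + 1)) = wt (c(j := c j + 1))"
    then have "c(i := c i + 1) = c(j := c j + 1)" using inj_on_wt by (auto dest: inj_onD)
    from fun_cong[OF this, of i] show "i = j" by (auto split: if_splits)
  qed
  ultimately show ?thesis by (simp add: card_image)
qed

end

lemma upper_covering_poly_sum:
  assumes "finite P"
  shows "upper_covering_poly P le = (\<Sum>x\<in>P. monom 1 (card {y. poset_covers P le x y}))"
proof -
  let ?k = "\<lambda>x. card {y. poset_covers P le x y}"
  have le: "?k x \<le> card P" for x
    by (rule card_mono[OF assms]) (auto simp: poset_covers_def)
  have "(\<Sum>x\<in>P. monom 1 (?k x)) = (\<Sum>x\<in>P. \<Sum>j\<le>card P. if ?k x = j then monom 1 j else (0 :: int poly))"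
    by (rule sum.cong) (auto simp: le)
  also have "\<dots> = (\<Sum>j\<le>card P. \<Sum>x\<in>P. if ?k x = j then monom 1 j else 0)"
    by (rule sum.swap)
  also have "\<dots> = (\<Sum>j\<le>card P. monom (int (card {x\<in>P. ?k x = j})) j)"
  proof (rule sum.cong[OF refl])
    fix j
    have "(\<Sum>x\<in>P. if ?k x = j then monom 1 j else (0 :: int poly)) = (\<Sum>x\<in>{x\<in>P. ?k x = j}. monom 1 j)"
      using assms by (simp only: sum.inter_filter)
    also have "\<dots> = monom (int (card {x\<in>P. ?k x = j})) j"
      by (simp add: of_nat_monom mult_monom)
    finally show "(\<Sum>x\<in>P. if ?k x = j then monom 1 j else (0 :: int poly)) = \<dots>" .
  qed
  finally show ?thesis by (simp add: upper_covering_poly_def)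
qed

lemma (in fundamental_module) weight_covering_poly_eq:
  "weight_covering_poly sg H n \<alpha> sv act =
    (\<Sum>c\<in>root_coords. monom 1 (card {i\<in>{1..n}. c(i := c i + 1) \<in> root_coords}))"
proof -
  have "weight_covering_poly sg H n \<alpha> sv act =
      (\<Sum>\<theta>\<in>wt ` root_coords. monom 1 (card {\<gamma>. poset_covers P (root_order P n \<alpha>) \<theta> \<gamma>}))"
    unfolding weight_covering_poly_def upper_covering_poly_sum[OF finite_P]
    using wt_image_root_coords by simp
  then show ?thesis by (simp add: sum.reindex[OF inj_on_wt] card_covered)
qed

section \<open>Sets that are stable under the simple reflections\<close>

lemma coroot_value_upd:
  assumes "i \<in> {1..n}"
  shows "coroot_value C n m (c(i := c i + t)) j = coroot_value C n m c j - C j i * t"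
proof -
  have "(\<Sum>k=1..n. C j k * (c(i := c i + t)) k) = (\<Sum>k=1..n. C j k * c k + (if k = i then C j i * t else 0))"
    by (rule sum.cong) (auto simp: algebra_simps)
  also have "\<dots> = (\<Sum>k=1..n. C j k * c k) + C j i * t" using assms by (simp add: sum.distrib)
  finally show ?thesis by (simp add: coroot_value_def)
qed

definition root_cone :: "nat \<Rightarrow> (nat \<Rightarrow> int) set" where
  "root_cone n = {c. (\<forall>i. 0 \<le> c i) \<and> (\<forall>i. i \<notin> {1..n} \<longrightarrow> c i = 0)}"

definition reflection_closed :: "(nat \<Rightarrow> nat \<Rightarrow> int) \<Rightarrow> nat \<Rightarrow> nat \<Rightarrow> (nat \<Rightarrow> int) set \<Rightarrow> bool" where
  "reflection_closed C n m S \<longleftrightarrow> S \<subseteq> root_cone n \<and>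
     (\<forall>c\<in>S. \<forall>i\<in>{1..n}. c(i := c i + coroot_value C n m c i) \<in> S)"

definition dominant :: "(nat \<Rightarrow> nat \<Rightarrow> int) \<Rightarrow> nat \<Rightarrow> nat \<Rightarrow> (nat \<Rightarrow> int) \<Rightarrow> bool" where
  "dominant C n m c \<longleftrightarrow> (\<forall>i\<in>{1..n}. 0 \<le> coroot_value C n m c i)"

text \<open>
  Induction on the sum of the coordinates. A vector that is not dominant has a negative
  value at some simple coroot; the corresponding reflection gives a member of \<open>Q\<close> with a
  smaller sum, which is in \<open>S\<close>, and reflecting back stays in \<open>S\<close>.
\<close>

lemma reflection_closed_subset:
  assumes Q: "reflection_closed C n m Q" and S: "reflection_closed C n m S"
    and diag: "\<And>i. i \<in> {1..n} \<Longrightarrow> C i i = 2"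
    and dom: "\<And>c. c \<in> Q \<Longrightarrow> dominant C n m c \<Longrightarrow> c \<in> S"
  shows "Q \<subseteq> S"
proof
  fix c assume "c \<in> Q"
  then show "c \<in> S"
  proof (induction "nat (\<Sum>i=1..n. c i)" arbitrary: c rule: less_induct)
    case less
    show ?case
    proof (cases "dominant C n m c")
      case True
      then show ?thesis using dom less.prems by simp
    next
      case False
      then obtain i where i: "i \<in> {1..n}" "coroot_value C n m c i < 0"
        by (auto simp: dominant_def not_le)
      define v where "v = coroot_value C n m c i"
      define d where "d = c(i := c i + v)"
      have d: "d \<in> Q" using Q less.prems i by (simp add: d_def v_def reflection_closed_def)
      have sum: "(\<Sum>j=1..n. d j) = (\<Sum>j=1..n. c j) + v"
        unfolding d_def sum_fun_upd using i by simp
      have "0 \<le> (\<Sum>j=1..n. d j)"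
        using d Q by (intro sum_nonneg) (auto simp: reflection_closed_def root_cone_def)
      then have "d \<in> S" using less.hyps[OF _ d] sum i(2) by (simp add: v_def)
      moreover have "coroot_value C n m d i = - v"
        using i diag by (simp add: d_def coroot_value_upd v_def)
      ultimately have "d(i := d i + - v) \<in> S" using S i(1) by (metis reflection_closed_def)
      then show ?thesis by (simp add: d_def)
    qed
  qed
qed

context fundamental_module begin

lemma cartan_diag: "i \<in> {1..n} \<Longrightarrow> C i i = 2"
  using coroots[of i] cartan[of i i] by (simp add: is_coroot_def)

lemma root_coords_reflection_closed: "reflection_closed C n m root_coords"
  unfolding reflection_closed_def
proof (intro conjI ballI)
  show "root_coords \<subseteq> root_cone n"
    using root_coords_nonneg root_coords_outside by (auto simp: root_cone_def)
  show "c(i := c i + coroot_value C n m c i) \<in> root_coords" if "c \<in> root_coords" "i \<in> {1..n}" for c i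
    using that by (intro root_coords_string) auto
qed

lemma root_coords_eqI:
  assumes S: "reflection_closed C n m S"
    and dom: "\<And>c. c \<in> root_cone n \<Longrightarrow> dominant C n m c \<Longrightarrow> c \<in> S \<and> c \<in> root_coords"
  shows "root_coords = S"
proof
  show "root_coords \<subseteq> S"
    by (rule reflection_closed_subset[OF root_coords_reflection_closed S cartan_diag])
      (use dom root_coords_reflection_closed in \<open>auto simp: reflection_closed_def\<close>)
  show "S \<subseteq> root_coords"
    by (rule reflection_closed_subset[OF S root_coords_reflection_closed cartan_diag])
      (use dom S in \<open>auto simp: reflection_closed_def\<close>)
qed

text \<open>
  If all coroot values are \<open>-1\<close>, 0 or 1, then a step down by \<open>\<alpha>\<^sub>i\<close> is possible exactly at the
  value 1: there it is a reflection, and at a smaller value it would lead to a value below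
  \<open>-1\<close>. The set \<open>X\<close> is a combinatorial model of the weights.
\<close>

lemma weight_covering_poly_minuscule:
  assumes inj: "inj_on enc X"
    and S: "reflection_closed C n m (enc ` X)"
    and zero: "(\<lambda>_. 0) \<in> enc ` X"
    and dom: "\<And>c. c \<in> root_cone n \<Longrightarrow> dominant C n m c \<Longrightarrow> c = (\<lambda>_. 0)"
    and small: "\<And>x i. x \<in> X \<Longrightarrow> i \<in> {1..n} \<Longrightarrow> \<bar>coroot_value C n m (enc x) i\<bar> \<le> 1"
  shows "weight_covering_poly sg H n \<alpha> sv act =
    (\<Sum>x\<in>X. monom 1 (card {i\<in>{1..n}. coroot_value C n m (enc x) i = 1}))"
proof -
  have eq: "root_coords = enc ` X"
    using S dom zero zero_root_coords by (intro root_coords_eqI) (metis, metis)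
  have iff: "(enc x)(i := enc x i + 1) \<in> enc ` X \<longleftrightarrow> coroot_value C n m (enc x) i = 1"
    if x: "x \<in> X" and i: "i \<in> {1..n}" for x i
  proof
    assume "(enc x)(i := enc x i + 1) \<in> enc ` X"
    then have "\<bar>coroot_value C n m ((enc x)(i := enc x i + 1)) i\<bar> \<le> 1" using small i by auto
    then show "coroot_value C n m (enc x) i = 1"
      using small[OF x i] cartan_diag[OF i] by (simp add: coroot_value_upd[OF i])
  next
    assume "coroot_value C n m (enc x) i = 1"
    then show "(enc x)(i := enc x i + 1) \<in> enc ` X"
      using S x i unfolding reflection_closed_def by (metis imageI)
  qed
  have "weight_covering_poly sg H n \<alpha> sv act =
      (\<Sum>x\<in>X. monom 1 (card {i\<in>{1..n}. (enc x)(i := enc x i + 1) \<in> enc ` X}))"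
    unfolding weight_covering_poly_eq eq by (simp add: sum.reindex[OF inj])
  also have "\<dots> = (\<Sum>x\<in>X. monom 1 (card {i\<in>{1..n}. coroot_value C n m (enc x) i = 1}))"
    by (intro sum.cong refl arg_cong2[where f = monom] arg_cong[where f = card]) (use iff in auto)
  finally show ?thesis .
qed

end

section \<open>Descents of binary words\<close>

lemma int_count_list_take:
  "i \<le> length xs \<Longrightarrow> int (count_list (take i xs) b) = (\<Sum>j=1..i. of_bool (xs ! (j - 1) = b))"
  by (induction i) (auto simp: take_Suc_conv_app_nth)

fun descents :: "bool list \<Rightarrow> nat" where
  "descents (x # y # zs) = (if x \<and> \<not> y then 1 else 0) + descents (y # zs)"
| "descents _ = 0"

lemma descents_False: "descents (False # xs) = descents xs"
  by (cases xs) auto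

lemma card_descents: "card {i\<in>{1..<length xs}. xs ! (i - 1) \<and> \<not> xs ! i} = descents xs"
proof (induction xs rule: descents.induct)
  case (1 x y zs)
  let ?D = "\<lambda>xs. {i\<in>{1..<length xs}. xs ! (i - 1) \<and> \<not> xs ! i}"
  have "?D (x # y # zs) = (if x \<and> \<not> y then {1} else {}) \<union> Suc ` ?D (y # zs)"
  proof (rule set_eqI)
    fix i show "i \<in> ?D (x # y # zs) \<longleftrightarrow> i \<in> (if x \<and> \<not> y then {1} else {}) \<union> Suc ` ?D (y # zs)"
    proof (cases i)
      case (Suc j)
      then show ?thesis by (cases j) (auto simp: image_iff)
    qed auto
  qed
  moreover have "card ((if x \<and> \<not> y then {1} else {}) \<union> Suc ` ?D (y # zs)) =
      (if x \<and> \<not> y then 1 else 0) + card (Suc ` ?D (y # zs))"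
    by (subst card_Un_disjoint) auto
  ultimately show ?case using 1 by (simp add: card_image)
qed auto

definition words :: "nat \<Rightarrow> nat \<Rightarrow> bool list set" where
  "words m k = {xs. count_list xs True = m \<and> count_list xs False = k}"

lemma length_count_bool: "length xs = count_list xs True + count_list xs False"
  by (induction xs) auto

lemma finite_words: "finite (words m k)"
  by (rule finite_subset[OF _ finite_lists_length_eq[of UNIV "m + k"]])
    (auto simp: words_def length_count_bool)

lemma words_0_Suc: "words 0 (Suc k) = (#) False ` words 0 k"
proof (rule set_eqI)
  fix xs show "xs \<in> words 0 (Suc k) \<longleftrightarrow> xs \<in> (#) False ` words 0 k"
    by (cases xs) (auto simp: words_def image_iff)
qed

lemma words_Suc_Suc:
  "words (Suc m) (Suc k) = (#) True ` words m (Suc k) \<union> (#) False ` words (Suc m) k"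
proof (rule set_eqI)
  fix xs
  show "xs \<in> words (Suc m) (Suc k) \<longleftrightarrow> xs \<in> (#) True ` words m (Suc k) \<union> (#) False ` words (Suc m) k"
    by (cases xs) (auto simp: words_def image_iff)
qed

lemma words_0_right: "words m 0 = {replicate m True}"
proof
  show "words m 0 \<subseteq> {replicate m True}"
  proof
    fix xs assume "xs \<in> words m 0"
    then have xs: "count_list xs True = m" "count_list xs False = 0" by (auto simp: words_def)
    have "xs = replicate m True"
    proof (rule replicate_eqI)
      show "length xs = m" using xs by (simp add: length_count_bool)
      have "False \<notin> set xs" using xs(2) by (simp only: count_list_0_iff not_False_eq_True)
      then show "x = True" if "x \<in> set xs" for x using that by (cases x) auto
    qed
    then show "xs \<in> {replicate m True}" by simp
  qed
  have "count_list (replicate m True) True = m" "count_list (replicate m True) False = 0"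
    by (induction m) auto
  then show "{replicate m True} \<subseteq> words m 0" by (simp add: words_def)
qed

definition descent_poly :: "bool list set \<Rightarrow> int poly" where
  "descent_poly X = (\<Sum>xs\<in>X. monom 1 (descents xs))"

lemma descent_poly_Un: "finite X \<Longrightarrow> finite Y \<Longrightarrow> X \<inter> Y = {} \<Longrightarrow>
    descent_poly (X \<union> Y) = descent_poly X + descent_poly Y"
  by (simp add: descent_poly_def sum.union_disjoint)

lemma descent_poly_image: "inj_on f X \<Longrightarrow> (\<And>xs. xs \<in> X \<Longrightarrow> descents (f xs) = descents xs) \<Longrightarrow>
    descent_poly (f ` X) = descent_poly X"
  by (simp add: descent_poly_def sum.reindex)

lemma descent_poly_image_Suc: "inj_on f X \<Longrightarrow> (\<And>xs. xs \<in> X \<Longrightarrow> descents (f xs) = Suc (descents xs)) \<Longrightarrow>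
    descent_poly (f ` X) = pCons 0 (descent_poly X)"
proof -
  have "(\<Sum>xs\<in>X. monom 1 (Suc (descents xs))) = pCons 0 (\<Sum>xs\<in>X. monom (1::int) (descents xs))"
    by (induction X rule: infinite_finite_induct) (auto simp: monom_Suc)
  then show "inj_on f X \<Longrightarrow> (\<And>xs. xs \<in> X \<Longrightarrow> descents (f xs) = Suc (descents xs)) \<Longrightarrow>
      descent_poly (f ` X) = pCons 0 (descent_poly X)"
    by (simp add: descent_poly_def sum.reindex)
qed

text \<open>
  Words that start with True, sorted by their second letter: a second True adds no
  descent, a second False adds one.
\<close>

lemma descent_poly_words_True:
  assumes "\<And>m r. coeff (descent_poly (words m k)) r = int ((m choose r) * (k choose r))"
  shows "coeff (descent_poly ((#) True ` words m (Suc k))) r =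
    (case r of 0 \<Rightarrow> 0 | Suc s \<Rightarrow> int ((Suc m choose r) * (k choose s)))"
proof (induction m arbitrary: r)
  case 0
  have "(#) True ` words 0 (Suc k) = ((#) True \<circ> (#) False) ` words 0 k"
    by (simp add: words_0_Suc image_comp)
  moreover have "descent_poly (((#) True \<circ> (#) False) ` words 0 k) = pCons 0 (descent_poly (words 0 k))"
    by (rule descent_poly_image_Suc) (auto simp: descents_False inj_on_def)
  ultimately show ?case
    by (simp add: assms coeff_pCons split: nat.split)
next
  case (Suc m)
  have "descent_poly ((#) True ` words (Suc m) (Suc k)) =
      descent_poly (((#) True \<circ> (#) True) ` words m (Suc k)) +
      descent_poly (((#) True \<circ> (#) False) ` words (Suc m) k)"
    unfolding words_Suc_Suc image_Un image_comp
    by (rule descent_poly_Un) (auto simp: finite_words)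
  also have "((#) True \<circ> (#) True) ` words m (Suc k) = (#) True ` ((#) True ` words m (Suc k))"
    by (simp add: image_comp)
  also have "descent_poly ((#) True ` ((#) True ` words m (Suc k))) = descent_poly ((#) True ` words m (Suc k))"
    by (rule descent_poly_image) auto
  also have "descent_poly (((#) True \<circ> (#) False) ` words (Suc m) k) = pCons 0 (descent_poly (words (Suc m) k))"
    by (rule descent_poly_image_Suc) (auto simp: descents_False inj_on_def)
  finally show ?case
    by (simp add: Suc assms coeff_pCons algebra_simps split: nat.split)
qed

lemma coeff_descent_poly_words:
  "coeff (descent_poly (words m k)) r = int ((m choose r) * (k choose r))"
proof (induction k arbitrary: m r)
  case 0
  have "descents (replicate m True) = 0"
  proof (induction m)
    case (Suc m) then show ?case by (cases m) auto
  qed simp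
  then show ?case by (cases r) (auto simp: descent_poly_def words_0_right)
next
  case (Suc k)
  have F: "descent_poly ((#) False ` words m k) = descent_poly (words m k)" for m
    by (rule descent_poly_image) (auto simp: descents_False)
  show ?case
  proof (cases m)
    case 0
    then show ?thesis using F[of 0] by (cases r) (simp_all add: words_0_Suc Suc)
  next
    case (Suc p)
    have "descent_poly (words (Suc p) (Suc k)) =
        descent_poly ((#) True ` words p (Suc k)) + descent_poly ((#) False ` words (Suc p) k)"
      unfolding words_Suc_Suc by (rule descent_poly_Un) (auto simp: finite_words)
    then show ?thesis
      using descent_poly_words_True[OF Suc.IH, of p r] unfolding F Suc
      by (cases r) (simp_all add: Suc.IH algebra_simps)
  qed
qed

lemma length_Suc_split:
  "{xs :: bool list. length xs = Suc k} = (#) True ` {xs. length xs = k} \<union> (#) False ` {xs. length xs = k}"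
proof (rule set_eqI)
  fix xs :: "bool list"
  show "xs \<in> {xs. length xs = Suc k} \<longleftrightarrow> xs \<in> (#) True ` {xs. length xs = k} \<union> (#) False ` {xs. length xs = k}"
    by (cases xs) auto
qed

lemma finite_bool_lists: "finite {xs :: bool list. length xs = k}"
  using finite_lists_length_eq[of "UNIV :: bool set" k] by simp

text \<open>
  Both counts are proved together, since the words that start with True satisfy their own
  recursion: the first letter True contributes a descent exactly if it is followed by
  False.
\<close>

lemma coeff_descent_poly_append_False:
  "coeff (descent_poly ((\<lambda>xs. xs @ [False]) ` {xs. length xs = k})) r = int (Suc k choose (2 * r)) \<and>
   coeff (descent_poly ((\<lambda>xs. True # xs @ [False]) ` {xs. length xs = k})) r =
     (case r of 0 \<Rightarrow> 0 | Suc s \<Rightarrow> int (Suc k choose (2 * s + 1)))"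
proof (induction k arbitrary: r)
  case 0
  show ?case by (cases r) (auto simp: descent_poly_def binomial_eq_0 split: nat.split)
next
  case (Suc k)
  let ?L = "{xs :: bool list. length xs = k}"
  have "(\<lambda>xs. xs @ [False]) ` {xs. length xs = Suc k} =
      (\<lambda>xs. True # xs @ [False]) ` ?L \<union> (#) False ` (\<lambda>xs. xs @ [False]) ` ?L"
    unfolding length_Suc_split image_Un image_image by simp
  moreover have "descent_poly ((\<lambda>xs. True # xs @ [False]) ` ?L \<union> (#) False ` (\<lambda>xs. xs @ [False]) ` ?L) =
      descent_poly ((\<lambda>xs. True # xs @ [False]) ` ?L) + descent_poly ((#) False ` (\<lambda>xs. xs @ [False]) ` ?L)"
    by (rule descent_poly_Un) (auto simp: finite_bool_lists)
  moreover have "descent_poly ((#) False ` (\<lambda>xs. xs @ [False]) ` ?L) = descent_poly ((\<lambda>xs. xs @ [False]) ` ?L)"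
    by (rule descent_poly_image) (auto simp: descents_False)
  ultimately have B: "coeff (descent_poly ((\<lambda>xs. xs @ [False]) ` {xs. length xs = Suc k})) r =
      int (Suc (Suc k) choose (2 * r))"
    by (cases r) (simp_all add: Suc)
  have "(\<lambda>xs. True # xs @ [False]) ` {xs. length xs = Suc k} =
      (#) True ` (\<lambda>xs. True # xs @ [False]) ` ?L \<union> (\<lambda>xs. True # False # xs) ` (\<lambda>xs. xs @ [False]) ` ?L"
    unfolding length_Suc_split image_Un image_image by simp
  moreover have "descent_poly ((#) True ` (\<lambda>xs. True # xs @ [False]) ` ?L \<union>
        (\<lambda>xs. True # False # xs) ` (\<lambda>xs. xs @ [False]) ` ?L) =
      descent_poly ((#) True ` (\<lambda>xs. True # xs @ [False]) ` ?L) +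
      descent_poly ((\<lambda>xs. True # False # xs) ` (\<lambda>xs. xs @ [False]) ` ?L)"
    by (rule descent_poly_Un) (auto simp: finite_bool_lists)
  moreover have "descent_poly ((#) True ` (\<lambda>xs. True # xs @ [False]) ` ?L) =
      descent_poly ((\<lambda>xs. True # xs @ [False]) ` ?L)"
    by (rule descent_poly_image) auto
  moreover have "descent_poly ((\<lambda>xs. True # False # xs) ` (\<lambda>xs. xs @ [False]) ` ?L) =
      pCons 0 (descent_poly ((\<lambda>xs. xs @ [False]) ` ?L))"
    by (rule descent_poly_image_Suc) (auto simp: descents_False inj_on_def)
  ultimately have "coeff (descent_poly ((\<lambda>xs. True # xs @ [False]) ` {xs. length xs = Suc k})) r =
      (case r of 0 \<Rightarrow> 0 | Suc s \<Rightarrow> int (Suc (Suc k) choose (2 * s + 1)))"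
    by (simp add: Suc coeff_pCons split: nat.split)
  with B show ?case by blast
qed

section \<open>The fundamental modules of type A\<close>

lemma cartan_matrix_A:
  assumes "i \<in> {1..n}" "j \<in> {1..n}"
  shows "cartan_matrix (TypeA n) i j = (if j = i then 2 else if j = i + 1 \<or> i = j + 1 then - 1 else 0)"
proof -
  have "{i, j} \<in> dynkin_edges (TypeA n) \<longleftrightarrow> j = i + 1 \<or> i = j + 1"
    using assms by (auto simp: doubleton_eq_iff)
  then show ?thesis by (auto simp: cartan_matrix_def simp del: dynkin_edges.simps)
qed

lemma coroot_value_A:
  assumes "\<forall>i. i \<notin> {1..n} \<longrightarrow> c i = 0" "i \<in> {1..n}"
  shows "coroot_value (cartan_matrix (TypeA n)) n m c i =
    (if i = m then 1 else 0) - (2 * c i - c (i - 1) - c (i + 1))"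
proof -
  have "(\<Sum>j=1..n. cartan_matrix (TypeA n) i j * c j) =
      (\<Sum>j=1..n. (if j = i then 2 * c i else 0) - (if j = i - 1 then c (i - 1) else 0)
        - (if j = i + 1 then c (i + 1) else 0))"
    by (rule sum.cong) (use assms(2) in \<open>auto simp: cartan_matrix_A\<close>)
  also have "\<dots> = 2 * c i - c (i - 1) - c (i + 1)"
    using assms(2) assms(1)[rule_format, of "i - 1"] assms(1)[rule_format, of "i + 1"] by (auto simp: sum_subtractf)
  finally show ?thesis by (simp add: coroot_value_def)
qed

text \<open>
  By convexity the increments do not decrease, and the first one is nonnegative. If one of
  them vanishes, then so do all earlier ones, and the sequence is still 0.
\<close>

lemma subharmonic_increasing:
  fixes c :: "nat \<Rightarrow> int"
  assumes "c 0 = 0" "\<And>i. 0 \<le> c i"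
    and "\<And>i. 1 \<le> i \<Longrightarrow> i < p \<Longrightarrow> 2 * c i \<le> c (i - 1) + c (i + 1)"
  shows "i < p \<Longrightarrow> c i \<le> c (Suc i) \<and> (c (Suc i) \<noteq> 0 \<longrightarrow> c i < c (Suc i))"
proof (induction i)
  case 0
  then show ?case using assms(1) assms(2)[of 1] by simp
next
  case (Suc i)
  then have "2 * c (Suc i) \<le> c i + c (Suc (Suc i))" using assms(3)[of "Suc i"] by simp
  then show ?case using Suc assms(2)[of i] assms(2)[of "Suc i"] by (cases "c (Suc i) = 0") auto
qed

text \<open>
  Dominance says that \<open>c\<close> is convex away from \<open>m\<close>, with a defect of at most 1 at \<open>m\<close>. If \<open>c\<^sub>m\<close> were
  positive, then convexity would make both neighbours smaller, so the second difference at
  \<open>m\<close> would be at most \<open>-2\<close>. Hence \<open>c\<^sub>m = 0\<close>, and convexity on both sides gives 0 everywhere.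
\<close>

lemma dominant_A:
  assumes c: "c \<in> root_cone n" and dom: "dominant (cartan_matrix (TypeA n)) n m c"
    and m: "1 \<le> m" "m \<le> n"
  shows "c = (\<lambda>_. 0)"
proof -
  have nonneg: "0 \<le> c i" for i using c by (auto simp: root_cone_def)
  have out: "\<forall>i. i \<notin> {1..n} \<longrightarrow> c i = 0" using c by (auto simp: root_cone_def)
  have sub: "2 * c i \<le> c (i - 1) + c (i + 1) + (if i = m then 1 else 0)" if "i \<in> {1..n}" for i
  proof -
    have "0 \<le> coroot_value (cartan_matrix (TypeA n)) n m c i" using dom that by (simp add: dominant_def)
    then show ?thesis unfolding coroot_value_A[OF out that] by simp
  qed
  have left: "c i \<le> c (Suc i) \<and> (c (Suc i) \<noteq> 0 \<longrightarrow> c i < c (Suc i))" if "i < m" for i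
  proof (rule subharmonic_increasing[OF _ nonneg _ that])
    show "c 0 = 0" using out by simp
    show "2 * c i \<le> c (i - 1) + c (i + 1)" if "1 \<le> i" "i < m" for i
      using sub[of i] that m by simp
  qed
  define d where "d i = c (n + 1 - i)" for i
  have right: "d i \<le> d (Suc i) \<and> (d (Suc i) \<noteq> 0 \<longrightarrow> d i < d (Suc i))" if "i < n + 1 - m" for i
  proof (rule subharmonic_increasing[OF _ _ _ that])
    show "d 0 = 0" using out by (simp add: d_def)
    show "0 \<le> d i" for i by (simp add: d_def nonneg)
    show "2 * d i \<le> d (i - 1) + d (i + 1)" if "1 \<le> i" "i < n + 1 - m" for i
    proof -
      have "n + 1 - i \<in> {1..n}" "n + 1 - i \<noteq> m" "n + 1 - i - 1 = n + 1 - (i + 1)"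
        "n + 1 - i + 1 = n + 1 - (i - 1)" using that m by auto
      then show ?thesis using sub[of "n + 1 - i"] by (simp add: d_def)
    qed
  qed
  have "c m = 0"
  proof (rule ccontr)
    assume cm: "c m \<noteq> 0"
    have "c (m - 1) < c m" using left[of "m - 1"] cm m by simp
    moreover have "c (m + 1) < c m"
      using right[of "n - m"] cm m by (simp add: d_def Suc_diff_le)
    ultimately show False using sub[of m] m by simp
  qed
  moreover have "c (m - i) = 0" if "c m = 0" for i
  proof (induction i)
    case (Suc i)
    show ?case
    proof (cases "i < m")
      case True
      then have "Suc (m - Suc i) = m - i" by simp
      then show ?thesis using left[of "m - Suc i"] nonneg[of "m - Suc i"] Suc True by simp
    qed (use Suc in simp)
  qed (use that in simp)
  moreover have "c (m + i) = 0" if "c m = 0" for i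
  proof (induction i)
    case (Suc i)
    then show ?case using right[of "n - (m + i)"] nonneg[of "m + Suc i"] out[rule_format, of "m + Suc i"]
      by (cases "m + i < n") (auto simp: d_def Suc_diff_le)
  qed (use that in simp)
  ultimately show ?thesis by (metis ext le_add_diff_inverse diff_diff_cancel nle_le)
qed

text \<open>
  The root coordinates of \<open>y\<^sub>1 \<epsilon>\<^sub>1 + \<dots> + y\<^sub>n\<^sub>+\<^sub>1 \<epsilon>\<^sub>n\<^sub>+\<^sub>1\<close>, a vector with sum 0, with respect to
  \<open>\<alpha>\<^sub>i = \<epsilon>\<^sub>i - \<epsilon>\<^sub>i\<^sub>+\<^sub>1\<close>.
\<close>

definition coords_A :: "nat \<Rightarrow> (nat \<Rightarrow> int) \<Rightarrow> nat \<Rightarrow> int" where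
  "coords_A n y i = (if i \<le> n then \<Sum>j=1..i. y j else 0)"

lemma coords_A_outside: "\<forall>i. i \<notin> {1..n} \<longrightarrow> coords_A n y i = 0"
proof (intro allI impI)
  fix i assume "i \<notin> {1..n}"
  then show "coords_A n y i = 0" by (cases "i = 0") (auto simp: coords_A_def)
qed

lemma coords_A_diff:
  assumes "i \<in> {1..n+1}" "(\<Sum>j=1..n+1. y j) = 0"
  shows "coords_A n y i - coords_A n y (i - 1) = y i"
proof -
  obtain k where k: "i = Suc k" using assms(1) by (cases i) auto
  show ?thesis using assms by (cases "i = n + 1") (auto simp: k coords_A_def)
qed

lemma coroot_value_coords_A:
  assumes "i \<in> {1..n}" "(\<Sum>j=1..n+1. y j) = 0"
  shows "coroot_value (cartan_matrix (TypeA n)) n m (coords_A n y) i =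
    (if i = m then 1 else 0) - (y i - y (i + 1))"
  using assms(1) coords_A_diff[of i n y] coords_A_diff[of "i + 1" n y] assms(2)
  unfolding coroot_value_A[OF coords_A_outside assms(1)] by simp

lemma coords_A_upd:
  assumes "i \<in> {1..n}"
  shows "coords_A n (y(i := y i + t, i + 1 := y (i + 1) - t)) = (coords_A n y)(i := coords_A n y i + t)"
proof
  fix k
  show "coords_A n (y(i := y i + t, i + 1 := y (i + 1) - t)) k = ((coords_A n y)(i := coords_A n y i + t)) k"
    using assms unfolding coords_A_def sum_fun_upd by auto
qed

definition words_A :: "nat \<Rightarrow> nat \<Rightarrow> bool list set" where
  "words_A n m = {xs. length xs = n + 1 \<and> count_list xs True = m}"

text \<open>
  The difference in \<open>\<epsilon>\<close>-coordinates between the highest weight \<open>\<epsilon>\<^sub>1 + \<dots> + \<epsilon>\<^sub>m\<close> and the weight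
  given by the letters True of \<open>xs\<close>. Positions are counted from 1 as in the weights, list
  indices from 0.
\<close>

definition defect_A :: "nat \<Rightarrow> bool list \<Rightarrow> nat \<Rightarrow> int" where
  "defect_A m xs j = of_bool (j \<le> m) - of_bool (xs ! (j - 1))"

lemma sum_of_bool_le: "(\<Sum>j=1..i. of_bool (j \<le> m)) = int (min i m)"
  by (induction i) auto

lemma sum_defect_A:
  "i \<le> length xs \<Longrightarrow> (\<Sum>j=1..i. defect_A m xs j) = int (min i m) - int (count_list (take i xs) True)"
  by (simp add: defect_A_def sum_subtractf sum_of_bool_le int_count_list_take del: One_nat_def)

lemma words_A_iff:
  assumes "m \<le> n"
  shows "xs \<in> words_A n m \<longleftrightarrow> length xs = n + 1 \<and> (\<Sum>j=1..n+1. defect_A m xs j) = 0"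
  using sum_defect_A[of "n + 1" xs m] assms by (auto simp: words_A_def min_def)

definition swap :: "nat \<Rightarrow> bool list \<Rightarrow> bool list" where
  "swap i xs = xs[i - 1 := xs ! i, i := xs ! (i - 1)]"

lemma swap_nth:
  assumes "1 \<le> i" "i < length xs"
  shows "swap i xs ! (i - Suc 0) = xs ! i" "swap i xs ! i = xs ! (i - Suc 0)"
    "1 \<le> j \<Longrightarrow> j \<noteq> i \<Longrightarrow> j \<noteq> i + 1 \<Longrightarrow> swap i xs ! (j - Suc 0) = xs ! (j - Suc 0)"
  using assms by (auto simp: swap_def nth_list_update)

text \<open>
  The i-th simple reflection exchanges the letters at \<open>i\<close> and \<open>i + 1\<close>, and the i-th coroot
  value is 1 exactly at a descent.
\<close>

lemma (in fundamental_module) covering_poly_A_words: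
  assumes "C = cartan_matrix (TypeA n)" "1 \<le> m" "m \<le> n"
  shows "weight_covering_poly sg H n \<alpha> sv act =
    (\<Sum>xs\<in>words_A n m. monom 1 (descents xs))"
proof -
  define enc where "enc xs = coords_A n (\<lambda>j. if j \<in> {1..n+1} then defect_A m xs j else 0)" for xs
  note W = words_A_iff[OF assms(3)]
  have s0: "(\<Sum>j=1..n+1. if j \<in> {1..n+1} then defect_A m xs j else 0) = 0" if "xs \<in> words_A n m" for xs
    using that by (simp add: W)
  have val: "coroot_value C n m (enc xs) i = of_bool (xs ! (i - 1)) - of_bool (xs ! i)"
    if "xs \<in> words_A n m" "i \<in> {1..n}" for xs i
    using that unfolding assms(1) enc_def
    by (subst coroot_value_coords_A[OF that(2) s0[OF that(1)]]) (auto simp: defect_A_def)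
  have "weight_covering_poly sg H n \<alpha> sv act =
      (\<Sum>xs\<in>words_A n m. monom 1 (card {i\<in>{1..n}. coroot_value C n m (enc xs) i = 1}))"
  proof (rule weight_covering_poly_minuscule)
    show "inj_on enc (words_A n m)"
    proof (rule inj_onI)
      fix xs ys assume xs: "xs \<in> words_A n m" and ys: "ys \<in> words_A n m" and eq: "enc xs = enc ys"
      show "xs = ys"
      proof (rule nth_equalityI)
        show "length xs = length ys" using xs ys by (simp add: words_A_def)
        fix i assume "i < length xs"
        then have i: "i + 1 \<in> {1..n+1}" using xs by (simp add: words_A_def)
        have "defect_A m xs (i + 1) = defect_A m ys (i + 1)"
          using coords_A_diff[OF i s0[OF xs]] coords_A_diff[OF i s0[OF ys]] eq i by (simp add: enc_def)
        then show "xs ! i = ys ! i" by (simp add: defect_A_def of_bool_eq_iff)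
      qed
    qed
    have cone: "enc xs \<in> root_cone n" if xs: "xs \<in> words_A n m" for xs
      unfolding root_cone_def
    proof (intro CollectI conjI allI impI)
      fix i
      have le: "count_list (take i xs) True \<le> m" "count_list (take i xs) True \<le> i"
        using xs count_list_append[of "take i xs" "drop i xs" True] count_le_length[of "take i xs" True]
        by (auto simp: words_A_def)
      show "0 \<le> enc xs i"
      proof (cases "i \<in> {1..n}")
        case True
        then have "enc xs i = (\<Sum>j=1..i. defect_A m xs j)"
          by (auto simp: enc_def coords_A_def)
        then show ?thesis using True xs le by (simp add: sum_defect_A words_A_def del: One_nat_def)
      qed (simp add: enc_def coords_A_outside)
    qed (simp add: enc_def coords_A_outside)
    show "reflection_closed C n m (enc ` words_A n m)"
      unfolding reflection_closed_def
    proof (intro conjI ballI)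
      show "enc ` words_A n m \<subseteq> root_cone n" using cone by blast
      fix c i assume "c \<in> enc ` words_A n m" and i: "i \<in> {1..n}"
      then obtain xs where xs: "xs \<in> words_A n m" "c = enc xs" by blast
      define t where "t = coroot_value C n m c i"
      let ?y = "\<lambda>xs j. if j \<in> {1..n+1} then defect_A m xs j else 0"
      have len: "length xs = n + 1" using xs by (simp add: words_A_def)
      have y: "?y (swap i xs) = (?y xs)(i := ?y xs i + t, i + 1 := ?y xs (i + 1) - t)"
      proof
        fix j
        show "?y (swap i xs) j = ((?y xs)(i := ?y xs i + t, i + 1 := ?y xs (i + 1) - t)) j"
          using val[OF xs(1) i] i len xs(2)
          by (auto simp: t_def defect_A_def swap_nth)
      qed
      have "(\<Sum>j=1..n+1. ?y (swap i xs) j) = 0"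
        unfolding y sum_fun_upd using i s0[OF xs(1)] by simp
      then have "swap i xs \<in> words_A n m" using len by (simp add: W swap_def)
      moreover have "enc (swap i xs) = c(i := c i + t)"
        using coords_A_upd[OF i, of "?y xs" t] unfolding enc_def y xs(2) .
      ultimately show "c(i := c i + coroot_value C n m c i) \<in> enc ` words_A n m"
        unfolding t_def by (metis imageI)
    qed
    show "(\<lambda>_. 0) \<in> enc ` words_A n m"
    proof (rule image_eqI)
      let ?xs = "replicate m True @ replicate (n + 1 - m) False"
      have "defect_A m ?xs j = 0" if "j \<in> {1..n+1}" for j
        using that assms(2,3) by (auto simp: defect_A_def nth_append)
      then show "(\<lambda>_. 0) = enc ?xs" by (auto simp: enc_def coords_A_def fun_eq_iff intro!: sum.neutral)
      have "count_list (replicate k b) True = (if b then k else 0)" for k b by (induction k) auto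
      then show "?xs \<in> words_A n m" using assms(3) by (simp add: words_A_def)
    qed
    show "c = (\<lambda>_. 0)" if "c \<in> root_cone n" "dominant C n m c" for c
      using dominant_A that assms by blast
    show "\<bar>coroot_value C n m (enc xs) i\<bar> \<le> 1" if "xs \<in> words_A n m" "i \<in> {1..n}" for xs i
      using val[OF that] by auto
  qed
  also have "\<dots> = (\<Sum>xs\<in>words_A n m. monom 1 (descents xs))"
  proof (rule sum.cong[OF refl])
    fix xs assume xs: "xs \<in> words_A n m"
    have "coroot_value C n m (enc xs) i = 1 \<longleftrightarrow> xs ! (i - 1) \<and> \<not> xs ! i" if "i \<in> {1..n}" for i
      unfolding val[OF xs that] by (cases "xs ! (i - 1)"; cases "xs ! i") simp_all
    moreover have "length xs = n + 1" using xs by (simp add: words_A_def)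
    ultimately have "{i\<in>{1..n}. coroot_value C n m (enc xs) i = 1} =
        {i\<in>{1..<length xs}. xs ! (i - 1) \<and> \<not> xs ! i}"
      by auto
    then show "monom 1 (card {i\<in>{1..n}. coroot_value C n m (enc xs) i = 1}) =
        (monom 1 (descents xs) :: int poly)"
      by (simp only: card_descents)
  qed
  finally show ?thesis .
qed

lemma (in fundamental_module) covering_poly_A:
  assumes "C = cartan_matrix (TypeA n)" "1 \<le> m" "m \<le> n"
  shows "weight_covering_poly sg H n \<alpha> sv act =
    (\<Sum>r\<le>n. monom (int ((m choose r) * ((n - m + 1) choose r))) r)"
proof (rule poly_eqI)
  fix r
  have "words_A n m = words m (n - m + 1)"
    using assms(3) by (auto simp: words_A_def words_def length_count_bool)
  then have "weight_covering_poly sg H n \<alpha> sv act = descent_poly (words m (n - m + 1))"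
    by (simp only: covering_poly_A_words[OF assms] descent_poly_def)
  then show "coeff (weight_covering_poly sg H n \<alpha> sv act) r =
      coeff (\<Sum>r\<le>n. monom (int ((m choose r) * ((n - m + 1) choose r))) r) r"
    using assms(3) by (auto simp: coeff_descent_poly_words coeff_sum coeff_monom binomial_eq_0)
qed

section \<open>Coordinates and dominant weights in type D\<close>

lemma cartan_matrix_D:
  assumes "i \<in> {1..n}" "j \<in> {1..n}" "4 \<le> n"
  shows "cartan_matrix (TypeD n) i j = (if j = i then 2
    else if j = i + 1 \<and> j < n \<or> i = j + 1 \<and> i < n \<or> i = n - 2 \<and> j = n \<or> j = n - 2 \<and> i = n then - 1 else 0)"
proof -
  have "{i, j} \<in> dynkin_edges (TypeD n) \<longleftrightarrow>
      j = i + 1 \<and> j < n \<or> i = j + 1 \<and> i < n \<or> i = n - 2 \<and> j = n \<or> j = n - 2 \<and> i = n"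
    using assms by (auto simp: doubleton_eq_iff)
  then show ?thesis by (auto simp: cartan_matrix_def simp del: dynkin_edges.simps)
qed

lemma coroot_value_D:
  assumes "\<forall>i. i \<notin> {1..n} \<longrightarrow> c i = 0" "i \<in> {1..n}" "4 \<le> n"
  shows "coroot_value (cartan_matrix (TypeD n)) n m c i = (if i = m then 1 else 0) - 2 * c i +
    (if i \<le> n - 3 then c (i - 1) + c (i + 1)
     else if i = n - 2 then c (n - 3) + c (n - 1) + c n else c (n - 2))"
proof -
  consider "i \<le> n - 3" | "i = n - 2" | "i = n - 1" | "i = n" using assms(2) by fastforce
  then have "(\<Sum>j=1..n. cartan_matrix (TypeD n) i j * c j) = 2 * c i -
    (if i \<le> n - 3 then c (i - 1) + c (i + 1)
     else if i = n - 2 then c (n - 3) + c (n - 1) + c n else c (n - 2))"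
  proof cases
    case 1
    have "(\<Sum>j=1..n. cartan_matrix (TypeD n) i j * c j) =
        (\<Sum>j=1..n. (if j = i then 2 * c i else 0) - (if j = i - 1 then c (i - 1) else 0)
          - (if j = i + 1 then c (i + 1) else 0))"
      by (rule sum.cong) (use 1 assms(2,3) in \<open>auto simp: cartan_matrix_D\<close>)
    also have "\<dots> = 2 * c i - c (i - 1) - c (i + 1)"
      using 1 assms(2,3) assms(1)[rule_format, of "i - 1"] by (auto simp: sum_subtractf)
    finally show ?thesis using 1 by simp
  next
    case 2
    obtain k where k: "n = k + 4" using assms(3) le_Suc_ex by (metis add.commute)
    have "(\<Sum>j=1..n. cartan_matrix (TypeD n) i j * c j) =
        (\<Sum>j=1..n. (if j = i then 2 * c i else 0) - (if j = n - 3 then c (n - 3) else 0)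
          - (if j = n - 1 then c (n - 1) else 0) - (if j = n then c n else 0))"
      by (rule sum.cong) (use 2 assms(2,3) k in \<open>auto simp: cartan_matrix_D\<close>)
    also have "\<dots> = 2 * c i - c (n - 3) - c (n - 1) - c n"
      using 2 assms(2,3) by (auto simp: sum_subtractf)
    finally show ?thesis using 2 k by simp
  next
    case 3
    obtain k where k: "n = k + 4" using assms(3) le_Suc_ex by (metis add.commute)
    have "(\<Sum>j=1..n. cartan_matrix (TypeD n) i j * c j) =
        (\<Sum>j=1..n. (if j = i then 2 * c i else 0) - (if j = n - 2 then c (n - 2) else 0))"
      by (rule sum.cong) (use 3 assms(2,3) in \<open>auto simp: cartan_matrix_D\<close>)
    also have "\<dots> = 2 * c i - c (n - 2)"
      using 3 assms(2,3) by (auto simp: sum_subtractf)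
    finally show ?thesis using 3 k by simp
  next
    case 4
    obtain k where k: "n = k + 4" using assms(3) le_Suc_ex by (metis add.commute)
    have "(\<Sum>j=1..n. cartan_matrix (TypeD n) i j * c j) =
        (\<Sum>j=1..n. (if j = i then 2 * c i else 0) - (if j = n - 2 then c (n - 2) else 0))"
      by (rule sum.cong) (use 4 assms(2,3) in \<open>auto simp: cartan_matrix_D\<close>)
    also have "\<dots> = 2 * c i - c (n - 2)"
      using 4 assms(2,3) by (auto simp: sum_subtractf)
    finally show ?thesis using 4 k by simp
  qed
  then show ?thesis by (simp add: coroot_value_def)
qed

lemma dominant_D_inequalities:
  assumes c: "c \<in> root_cone n" and dom: "dominant (cartan_matrix (TypeD n)) n m c" and n: "4 \<le> n"
  shows "\<And>i. 1 \<le> i \<Longrightarrow> i \<le> n - 3 \<Longrightarrow> 2 * c i \<le> c (i - 1) + c (i + 1) + (if i = m then 1 else 0)"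
    "2 * c (n - 2) \<le> c (n - 3) + c (n - 1) + c n + (if n - 2 = m then 1 else 0)"
    "2 * c (n - 1) \<le> c (n - 2) + (if n - 1 = m then 1 else 0)"
    "2 * c n \<le> c (n - 2) + (if n = m then 1 else 0)"
proof -
  have out: "\<forall>i. i \<notin> {1..n} \<longrightarrow> c i = 0" using c by (auto simp: root_cone_def)
  obtain k where k: "n = k + 4" using n le_Suc_ex by (metis add.commute)
  show "2 * c i \<le> c (i - 1) + c (i + 1) + (if i = m then 1 else 0)" if "1 \<le> i" "i \<le> n - 3" for i
  proof -
    have i: "i \<in> {1..n}" using that by auto
    have "0 \<le> coroot_value (cartan_matrix (TypeD n)) n m c i" using dom i by (simp add: dominant_def)
    then show ?thesis unfolding coroot_value_D[OF out i n] using that(2) by simp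
  qed
  have i: "n - 2 \<in> {1..n}" "n - 1 \<in> {1..n}" "n \<in> {1..n}" using n by auto
  have "0 \<le> coroot_value (cartan_matrix (TypeD n)) n m c (n - 2)" using dom i by (simp add: dominant_def)
  then show "2 * c (n - 2) \<le> c (n - 3) + c (n - 1) + c n + (if n - 2 = m then 1 else 0)"
    unfolding coroot_value_D[OF out i(1) n] by (simp add: k)
  have "0 \<le> coroot_value (cartan_matrix (TypeD n)) n m c (n - 1)" using dom i by (simp add: dominant_def)
  then show "2 * c (n - 1) \<le> c (n - 2) + (if n - 1 = m then 1 else 0)"
    unfolding coroot_value_D[OF out i(2) n] by (simp add: k)
  have "0 \<le> coroot_value (cartan_matrix (TypeD n)) n m c n" using dom i by (simp add: dominant_def)
  then show "2 * c n \<le> c (n - 2) + (if n = m then 1 else 0)"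
    unfolding coroot_value_D[OF out i(3) n] by (simp add: k)
qed

text \<open>
  As in type A the coordinates increase up to \<open>c\<^sub>n\<^sub>-\<^sub>2\<close>, strictly where positive. A positive
  \<open>c\<^sub>n\<^sub>-\<^sub>2\<close> would give \<open>c\<^sub>n\<^sub>-\<^sub>2 + 1 \<le> c\<^sub>n\<^sub>-\<^sub>1 + c\<^sub>n\<close>, while twice the right-hand side is at most
  \<open>2 * c\<^sub>n\<^sub>-\<^sub>2 + 1\<close>.
\<close>

lemma dominant_D_spin:
  assumes c: "c \<in> root_cone n" and dom: "dominant (cartan_matrix (TypeD n)) n n c" and n: "4 \<le> n"
  shows "c = (\<lambda>_. 0)"
proof -
  note ineq = dominant_D_inequalities[OF assms]
  have nonneg: "0 \<le> c i" and out: "i \<notin> {1..n} \<Longrightarrow> c i = 0" for i using c by (auto simp: root_cone_def)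
  have left: "c i \<le> c (Suc i) \<and> (c (Suc i) \<noteq> 0 \<longrightarrow> c i < c (Suc i))" if "i < n - 2" for i
  proof (rule subharmonic_increasing[OF _ nonneg _ that])
    show "c 0 = 0" using out by simp
    show "2 * c i \<le> c (i - 1) + c (i + 1)" if "1 \<le> i" "i < n - 2" for i
    proof -
      have "i \<noteq> n" "i \<le> n - 3" using that by auto
      then show ?thesis using ineq(1)[of i] that(1) by simp
    qed
  qed
  have "c (n - 2) = 0"
  proof (rule ccontr)
    assume c2: "c (n - 2) \<noteq> 0"
    have "Suc (n - 3) = n - 2" using n by simp
    then have "c (n - 3) < c (n - 2)" using left[of "n - 3"] c2 n by simp
    moreover have "n - 2 \<noteq> n" "n - 1 \<noteq> n" using n by auto
    ultimately show False using ineq(2,3,4) by simp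
  qed
  moreover have "n - 1 \<noteq> n" using n by auto
  ultimately have end0: "c (n - 2) = 0" "c (n - 1) = 0" "c n = 0"
    using ineq(3,4) nonneg[of "n - 1"] nonneg[of n] by auto
  have "c (n - 2 - i) = 0" for i
  proof (induction i)
    case (Suc i)
    show ?case
    proof (cases "i < n - 2")
      case True
      then have "Suc (n - 2 - Suc i) = n - 2 - i" by simp
      then show ?thesis using left[of "n - 2 - Suc i"] nonneg[of "n - 2 - Suc i"] Suc True by simp
    qed (use Suc in simp)
  qed (use end0 in simp)
  then have "c i = 0" if "i \<le> n - 2" for i using that by (metis diff_diff_cancel)
  moreover have "i \<le> n - 2 \<or> i = n - 1 \<or> i = n \<or> i \<notin> {1..n}" for i by auto
  ultimately show ?thesis using end0 out by (metis ext)
qed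

text \<open>
  Seen from the branch node, convexity makes \<open>c\<^sub>1, \<dots>, c\<^sub>n\<^sub>-\<^sub>2\<close> decrease, so \<open>c\<^sub>1 \<le> 1\<close>. If \<open>c\<^sub>1 = 1\<close>,
  then convexity seen from node 1 makes the same sequence increase, so it is constantly 1;
  then the branch node forces \<open>c\<^sub>n\<^sub>-\<^sub>1 + c\<^sub>n \<ge> 1\<close>, but both terms are at most \<open>1 / 2\<close>, hence 0.
\<close>

lemma dominant_D_vector:
  assumes c: "c \<in> root_cone n" and dom: "dominant (cartan_matrix (TypeD n)) n 1 c" and n: "4 \<le> n"
  shows "c = (\<lambda>_. 0)"
proof -
  note ineq = dominant_D_inequalities[OF assms]
  have nonneg: "0 \<le> c i" and out: "i \<notin> {1..n} \<Longrightarrow> c i = 0" for i using c by (auto simp: root_cone_def)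
  obtain k where k: "n = k + 4" using n le_Suc_ex by (metis add.commute)
  have step: "c (Suc (k + 2 - i - 1)) \<le> c (k + 2 - i - 1)" if "i < k + 1" for i
    using that
  proof (induction i)
    case 0
    show ?case using ineq(2-4) by (simp add: k)
  next
    case (Suc i)
    then have "Suc (k - i) \<le> n - 3" "Suc (k - i) \<noteq> 1" by (auto simp: k)
    with ineq(1)[of "Suc (k - i)"] have "2 * c (Suc (k - i)) \<le> c (k - i) + c (k - i + 2)"
      by simp
    moreover have "c (Suc (Suc (k - i))) \<le> c (Suc (k - i))"
      using Suc by (simp add: Suc_diff_le)
    ultimately show ?case using Suc.prems by (simp add: Suc_diff_le)
  qed
  have decr: "c (Suc i) \<le> c i" if "1 \<le> i" "i \<le> k + 1" for i
    using step[of "k + 1 - i"] that by simp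
  have mono: "c (k + 2) \<le> c i \<and> c i \<le> c 1" if "1 \<le> i" "i \<le> k + 2" for i
  proof
    show "c (k + 2) \<le> c i" using that(2,1)
    proof (induction rule: inc_induct)
      case (step j) then show ?case using decr[of j] by simp
    qed simp
    show "c i \<le> c 1" using that
    proof (induction i rule: dec_induct)
      case (step j) then show ?case using decr[of j] by simp
    qed simp
  qed
  have c0: "c 0 = 0" using out by simp
  have "c 1 = 0"
  proof (rule ccontr)
    assume "c 1 \<noteq> 0"
    then have c1: "1 \<le> c 1" using nonneg[of 1] by simp
    have grow: "c 1 \<le> c (Suc i) \<and> c (Suc i) \<le> c (Suc (Suc i))" if "i \<le> k" for i
      using that
    proof (induction i)
      case 0
      then show ?case using ineq(1)[of 1] c0 c1 by (simp add: k)
    next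
      case (Suc i)
      then have "2 * c (Suc (Suc i)) \<le> c (Suc i) + c (Suc (Suc (Suc i)))"
        using ineq(1)[of "Suc (Suc i)"] by (simp add: k)
      then show ?case using Suc by simp
    qed
    have "c 1 \<le> 1" using ineq(1)[of 1] decr[of 1] c0 by (simp add: k)
    moreover have "c (k + 1) = c (k + 2)" "c 1 \<le> c (k + 2)" "c (k + 2) \<le> c 1"
      using grow[of k] decr[of "k + 1"] mono[of "k + 2"] by auto
    moreover have "2 * c (k + 2) \<le> c (k + 1) + c (k + 3) + c (k + 4)" "2 * c (k + 3) \<le> c (k + 2)"
      "2 * c (k + 4) \<le> c (k + 2)"
      using ineq(2-4) by (simp_all add: k eval_nat_numeral)
    ultimately show False using c1 by presburger
  qed
  then have low: "c i = 0" if "i \<le> k + 2" for i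
    using mono[of i] nonneg[of i] c0 that by (cases "i = 0") auto
  moreover have "c (k + 3) = 0" "c (k + 4) = 0"
    using ineq(3,4) low[of "k + 2"] nonneg[of "k + 3"] nonneg[of "k + 4"]
    by (simp_all add: k eval_nat_numeral)
  moreover have "i \<le> k + 2 \<or> i = k + 3 \<or> i = k + 4 \<or> i \<notin> {1..n}" for i by (auto simp: k)
  ultimately show ?thesis using out by (metis ext)
qed

text \<open>
  The root coordinates of \<open>y\<^sub>1 \<epsilon>\<^sub>1 + \<dots> + y\<^sub>n \<epsilon>\<^sub>n\<close>, a vector with even sum, with respect to
  \<open>\<alpha>\<^sub>i = \<epsilon>\<^sub>i - \<epsilon>\<^sub>i\<^sub>+\<^sub>1\<close> for \<open>i < n\<close> and \<open>\<alpha>\<^sub>n = \<epsilon>\<^sub>n\<^sub>-\<^sub>1 + \<epsilon>\<^sub>n\<close>.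
\<close>

definition coords_D :: "nat \<Rightarrow> (nat \<Rightarrow> int) \<Rightarrow> nat \<Rightarrow> int" where
  "coords_D n y i =
     (if i \<le> n - 2 then \<Sum>j=1..i. y j
      else if i = n - 1 then (\<Sum>j=1..n. y j) div 2 - y n
      else if i = n then (\<Sum>j=1..n. y j) div 2
      else 0)"

lemma coords_D_outside: "\<forall>i. i \<notin> {1..n} \<longrightarrow> coords_D n y i = 0"
proof (intro allI impI)
  fix i assume "i \<notin> {1..n}"
  then show "coords_D n y i = 0" by (cases "i = 0") (auto simp: coords_D_def)
qed

text \<open>
  The entries of \<open>y\<close> are linear in its root coordinates; from this both the coroot values
  and the injectivity of \<open>coords_D\<close> are read off.
\<close>

lemma coords_D_diff:
  assumes "4 \<le> n" "even (\<Sum>j=1..n. y j)"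
  shows "1 \<le> i \<Longrightarrow> i \<le> n - 2 \<Longrightarrow> y i = coords_D n y i - coords_D n y (i - 1)"
    "y (n - 1) = coords_D n y (n - 1) + coords_D n y n - coords_D n y (n - 2)"
    "y n = coords_D n y n - coords_D n y (n - 1)"
proof -
  obtain k where k: "n = k + 4" using assms(1) le_Suc_ex by (metis add.commute)
  obtain h where h: "(\<Sum>j=1..n. y j) = 2 * h" using assms(2) by (rule evenE)
  have last: "(\<Sum>j=1..n. y j) = (\<Sum>j=1..k+2. y j) + y (k + 3) + y (k + 4)"
    by (simp add: k eval_nat_numeral)
  show "y i = coords_D n y i - coords_D n y (i - 1)" if "1 \<le> i" "i \<le> n - 2"
    using that by (cases i) (auto simp: coords_D_def)
  have vals: "coords_D n y (k + 2) = (\<Sum>j=1..k+2. y j)" "coords_D n y (k + 3) = h - y (k + 4)"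
    "coords_D n y (k + 4) = h"
    using h by (simp_all add: coords_D_def k)
  show "y (n - 1) = coords_D n y (n - 1) + coords_D n y n - coords_D n y (n - 2)"
    using vals h last by (simp add: k eval_nat_numeral)
  show "y n = coords_D n y n - coords_D n y (n - 1)"
    using vals by (simp add: k eval_nat_numeral)
qed

lemma coroot_value_coords_D:
  assumes n: "4 \<le> n" "even (\<Sum>j=1..n. y j)" and i: "i \<in> {1..n}"
  shows "coroot_value (cartan_matrix (TypeD n)) n m (coords_D n y) i =
    (if i = m then 1 else 0) - (if i = n then y (n - 1) + y n else y i - y (i + 1))"
proof -
  obtain k where k: "n = k + 4" using n(1) le_Suc_ex by (metis add.commute)
  note D = coords_D_diff[OF n]
  consider "i \<le> n - 3" | "i = n - 2" | "i = n - 1" | "i = n" using i by fastforce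
  then show ?thesis
  proof cases
    case 1
    then show ?thesis using D(1)[of i] D(1)[of "i + 1"] i n(1)
      unfolding coroot_value_D[OF coords_D_outside i n(1)] by auto
  next
    case 2
    then show ?thesis using D(1)[of "n - 2"] D(2,3)
      unfolding coroot_value_D[OF coords_D_outside i n(1)] by (simp add: k eval_nat_numeral)
  next
    case 3
    then show ?thesis using D(2,3)
      unfolding coroot_value_D[OF coords_D_outside i n(1)] by (simp add: k eval_nat_numeral)
  next
    case 4
    then show ?thesis using D(2,3)
      unfolding coroot_value_D[OF coords_D_outside i n(1)] by (simp add: k eval_nat_numeral)
  qed
qed

text \<open>
  Addition of \<open>t * \<alpha>\<^sub>i\<close> in \<open>\<epsilon>\<close>-coordinates.
\<close>

definition shift_D :: "nat \<Rightarrow> nat \<Rightarrow> int \<Rightarrow> (nat \<Rightarrow> int) \<Rightarrow> nat \<Rightarrow> int" where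
  "shift_D n i t y =
     (if i = n then y(n - 1 := y (n - 1) + t, n := y n + t)
      else y(i := y i + t, i + 1 := y (i + 1) - t))"

lemma sum_shift_D:
  assumes "i \<in> {1..n}" "4 \<le> n"
  shows "(\<Sum>j=1..n. shift_D n i t y j) = (\<Sum>j=1..n. y j) + (if i = n then 2 * t else 0)"
  unfolding shift_D_def using assms
  by (auto simp: sum_fun_upd simp del: One_nat_def fun_upd_apply) auto

lemma coords_D_shift:
  assumes "i \<in> {1..n}" "4 \<le> n"
  shows "coords_D n (shift_D n i t y) = (coords_D n y)(i := coords_D n y i + t)"
proof
  fix j
  have "(\<Sum>l=1..j. shift_D n i t y l) = (\<Sum>l=1..j. y l) + (if j = i then t else 0)" if "j \<le> n - 2"
    using that assms unfolding shift_D_def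
    by (auto simp: sum_fun_upd simp del: One_nat_def fun_upd_apply) auto
  note init = this
  have last: "shift_D n i t y n = y n + (if i = n then t else if i = n - 1 then - t else 0)"
    using assms by (auto simp: shift_D_def)
  consider "j \<le> n - 2" | "j = n - 1" | "j = n" | "n < j" by linarith
  then show "coords_D n (shift_D n i t y) j = ((coords_D n y)(i := coords_D n y i + t)) j"
  proof cases
    case 1
    then show ?thesis by (simp add: coords_D_def init del: One_nat_def)
  next
    case 2
    then have "\<not> j \<le> n - 2" "j \<noteq> n" using assms by auto
    then show ?thesis using 2 assms(1) by (simp add: coords_D_def last sum_shift_D[OF assms] del: One_nat_def)
  next
    case 3
    then have "\<not> j \<le> n - 2" "j \<noteq> n - 1" "i \<noteq> i - 1" using assms by auto
    then show ?thesis using 3 assms(1) by (simp add: coords_D_def sum_shift_D[OF assms] del: One_nat_def)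
  next
    case 4
    then have "\<not> j \<le> n - 2" "j \<noteq> n - 1" "j \<noteq> n" "j \<noteq> i" using assms by auto
    then show ?thesis by (simp add: coords_D_def del: One_nat_def)
  qed
qed

lemma coords_D_inj:
  assumes "4 \<le> n" "even (\<Sum>j=1..n. y j)" "even (\<Sum>j=1..n. z j)" "coords_D n y = coords_D n z" "j \<in> {1..n}"
  shows "y j = z j"
proof -
  consider "j \<le> n - 2" | "j = n - 1" | "j = n" using assms(5) by fastforce
  then show ?thesis
  proof cases
    case 1
    then show ?thesis
      using coords_D_diff(1)[OF assms(1,2), of j] coords_D_diff(1)[OF assms(1,3), of j] assms(4,5) by simp
  next
    case 2
    then show ?thesis
      using coords_D_diff(2)[OF assms(1,2)] coords_D_diff(2)[OF assms(1,3)] assms(4) by simp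
  next
    case 3
    then show ?thesis
      using coords_D_diff(3)[OF assms(1,2)] coords_D_diff(3)[OF assms(1,3)] assms(4) by simp
  qed
qed

lemma coords_D_cong:
  assumes "1 \<le> n" "\<And>j. j \<in> {1..n} \<Longrightarrow> y j = z j"
  shows "coords_D n y = coords_D n z"
proof
  fix i
  have sum: "(\<Sum>j=1..l. y j) = (\<Sum>j=1..l. z j)" if "l \<le> n" for l
    by (rule sum.cong) (use that assms in auto)
  have "i \<le> n - 2 \<Longrightarrow> (\<Sum>j=1..i. y j) = (\<Sum>j=1..i. z j)" by (rule sum) simp
  with sum[of n] show "coords_D n y i = coords_D n z i"
    using assms by (auto simp: coords_D_def simp del: One_nat_def)
qed

lemma coords_D_root_cone:
  assumes "2 \<le> n" "\<And>i. i \<le> n \<Longrightarrow> 0 \<le> (\<Sum>j=1..i. y j)" "y n \<le> (\<Sum>j=1..n. y j) div 2"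
  shows "coords_D n y \<in> root_cone n"
  unfolding root_cone_def
proof (intro CollectI conjI allI)
  show "0 \<le> coords_D n y i" for i
    using assms(2)[of i] assms(2)[of n] assms(3) by (auto simp: coords_D_def)
  show "i \<notin> {1..n} \<longrightarrow> coords_D n y i = 0" for i using coords_D_outside by blast
qed

text \<open>
  The minuscule case in \<open>\<epsilon>\<close>-coordinates: \<open>y x\<close> is the difference between the highest weight
  and the weight of \<open>x\<close>, and \<open>val x i\<close> is the value of the latter at the i-th simple coroot.
\<close>

lemma (in fundamental_module) weight_covering_poly_D:
  assumes C: "C = cartan_matrix (TypeD n)" and n: "4 \<le> n"
    and dom: "\<And>c. c \<in> root_cone n \<Longrightarrow> dominant C n m c \<Longrightarrow> c = (\<lambda>_. 0)"
    and even: "\<And>x. x \<in> X \<Longrightarrow> even (\<Sum>j=1..n. y x j)"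
    and inj: "\<And>x x'. x \<in> X \<Longrightarrow> x' \<in> X \<Longrightarrow> (\<And>j. j \<in> {1..n} \<Longrightarrow> y x j = y x' j) \<Longrightarrow> x = x'"
    and cone: "\<And>x. x \<in> X \<Longrightarrow> coords_D n (y x) \<in> root_cone n"
    and val: "\<And>x i. x \<in> X \<Longrightarrow> i \<in> {1..n} \<Longrightarrow>
      (if i = m then 1 else 0) - (if i = n then y x (n - 1) + y x n else y x i - y x (i + 1)) = val x i"
    and small: "\<And>x i. x \<in> X \<Longrightarrow> i \<in> {1..n} \<Longrightarrow> \<bar>val x i\<bar> \<le> 1"
    and reflect: "\<And>x i. x \<in> X \<Longrightarrow> i \<in> {1..n} \<Longrightarrow>
      \<exists>x'\<in>X. \<forall>j\<in>{1..n}. y x' j = shift_D n i (val x i) (y x) j"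
    and zero: "x0 \<in> X" "\<And>j. j \<in> {1..n} \<Longrightarrow> y x0 j = 0"
  shows "weight_covering_poly sg H n \<alpha> sv act = (\<Sum>x\<in>X. monom 1 (card {i\<in>{1..n}. val x i = 1}))"
proof -
  define enc where "enc x = coords_D n (y x)" for x
  have val': "coroot_value C n m (enc x) i = val x i" if "x \<in> X" "i \<in> {1..n}" for x i
    unfolding C enc_def coroot_value_coords_D[OF n even[OF that(1)] that(2)] val[OF that] ..
  have "weight_covering_poly sg H n \<alpha> sv act =
      (\<Sum>x\<in>X. monom 1 (card {i\<in>{1..n}. coroot_value C n m (enc x) i = 1}))"
  proof (rule weight_covering_poly_minuscule)
    show "inj_on enc X"
    proof (rule inj_onI)
      fix x x' assume x: "x \<in> X" "x' \<in> X" "enc x = enc x'"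
      show "x = x'"
        by (rule inj[OF x(1,2)], rule coords_D_inj[OF n even[OF x(1)] even[OF x(2)] x(3)[unfolded enc_def]])
    qed
    show "reflection_closed C n m (enc ` X)"
      unfolding reflection_closed_def
    proof (intro conjI ballI)
      show "enc ` X \<subseteq> root_cone n" using cone by (auto simp: enc_def)
      fix c i assume "c \<in> enc ` X" and i: "i \<in> {1..n}"
      then obtain x where x: "x \<in> X" "c = enc x" by blast
      obtain x' where x': "x' \<in> X" "\<forall>j\<in>{1..n}. y x' j = shift_D n i (val x i) (y x) j"
        using reflect[OF x(1) i] by blast
      have "enc x' = coords_D n (shift_D n i (val x i) (y x))"
        unfolding enc_def by (rule coords_D_cong) (use n x' in auto)
      also have "\<dots> = c(i := c i + val x i)" unfolding coords_D_shift[OF i n] x(2) enc_def ..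
      finally show "c(i := c i + coroot_value C n m c i) \<in> enc ` X"
        using x' val'[OF x(1) i] x(2) by (metis imageI)
    qed
    show "(\<lambda>_. 0) \<in> enc ` X"
    proof (rule image_eqI[OF _ zero(1)])
      have "enc x0 = coords_D n (\<lambda>_. 0)"
        unfolding enc_def by (rule coords_D_cong) (use n zero in auto)
      then show "(\<lambda>_. 0) = enc x0" by (simp add: coords_D_def fun_eq_iff)
    qed
  qed (use dom small val' in auto)
  also have "\<dots> = (\<Sum>x\<in>X. monom 1 (card {i\<in>{1..n}. val x i = 1}))"
    by (intro sum.cong refl arg_cong2[where f = monom] arg_cong[where f = card]) (use val' in auto)
  finally show ?thesis .
qed

section \<open>The half-spin module of type D\<close>

definition words_D :: "nat \<Rightarrow> bool list set" where
  "words_D n = {xs. length xs = n \<and> even (count_list xs False)}"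

text \<open>
  A word stands for the weight with \<open>\<epsilon>\<close>-coordinates \<open>1 / 2\<close> at the letters True and \<open>- 1 / 2\<close> at
  the letters False; the highest weight is the constant word True.
\<close>

definition defect_spin :: "bool list \<Rightarrow> nat \<Rightarrow> int" where
  "defect_spin xs j = of_bool (\<not> xs ! (j - 1))"

lemma sum_defect_spin:
  "i \<le> length xs \<Longrightarrow> (\<Sum>j=1..i. defect_spin xs j) = int (count_list (take i xs) False)"
  by (simp add: defect_spin_def int_count_list_take del: One_nat_def)

lemma words_D_iff:
  "xs \<in> words_D n \<longleftrightarrow> length xs = n \<and> even (\<Sum>j=1..n. defect_spin xs j)"
  using sum_defect_spin[of n xs] by (auto simp: words_D_def simp del: One_nat_def)

text \<open>
  The last simple reflection: it exchanges the last two \<open>\<epsilon>\<close>-coordinates and changes their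
  signs.
\<close>

definition swap_flip :: "nat \<Rightarrow> bool list \<Rightarrow> bool list" where
  "swap_flip n xs = xs[n - 2 := \<not> xs ! (n - 1), n - 1 := \<not> xs ! (n - 2)]"

lemma swap_flip_nth:
  assumes "2 \<le> n" "length xs = n"
  shows "swap_flip n xs ! (n - Suc (Suc 0)) = (\<not> xs ! (n - Suc 0))"
    "swap_flip n xs ! (n - Suc 0) = (\<not> xs ! (n - Suc (Suc 0)))"
    "j < n - 2 \<Longrightarrow> swap_flip n xs ! j = xs ! j"
  using assms by (auto simp: swap_flip_def nth_list_update numeral_2_eq_2)

definition spin_value :: "nat \<Rightarrow> bool list \<Rightarrow> nat \<Rightarrow> int" where
  "spin_value n xs i = (if i = n then of_bool (xs ! (n - 2)) - of_bool (\<not> xs ! (n - 1))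
     else of_bool (xs ! (i - 1)) - of_bool (xs ! i))"

lemma (in fundamental_module) covering_poly_spin_words:
  assumes C: "C = cartan_matrix (TypeD n)" and n: "4 \<le> n" and m: "m = n"
  shows "weight_covering_poly sg H n \<alpha> sv act =
    (\<Sum>xs\<in>words_D n. monom 1 (card {i\<in>{1..n}. spin_value n xs i = 1}))"
proof (rule weight_covering_poly_D[OF C n])
  show "c = (\<lambda>_. 0)" if "c \<in> root_cone n" "dominant C n m c" for c
    using dominant_D_spin that n m C by blast
  show "even (\<Sum>j=1..n. defect_spin xs j)" if "xs \<in> words_D n" for xs
    using that words_D_iff by blast
  show "xs = ys" if xs: "xs \<in> words_D n" "ys \<in> words_D n"
    and eq: "\<And>j. j \<in> {1..n} \<Longrightarrow> defect_spin xs j = defect_spin ys j" for xs ys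
  proof (rule nth_equalityI)
    show "length xs = length ys" using xs by (simp add: words_D_def)
    show "xs ! i = ys ! i" if "i < length xs" for i
      using eq[of "i + 1"] that xs(1) by (auto simp: defect_spin_def words_D_def)
  qed
  show "coords_D n (defect_spin xs) \<in> root_cone n" if xs: "xs \<in> words_D n" for xs
  proof (rule coords_D_root_cone)
    have pos: "0 \<le> defect_spin xs j" "defect_spin xs j \<le> 1" for j by (auto simp: defect_spin_def)
    show "0 \<le> (\<Sum>j=1..i. defect_spin xs j)" for i by (rule sum_nonneg) (use pos in simp)
    have "defect_spin xs n \<le> (\<Sum>j=1..n. defect_spin xs j)"
      by (rule member_le_sum) (use pos n in auto)
    moreover have "even (\<Sum>j=1..n. defect_spin xs j)" using xs words_D_iff by blast
    ultimately show "defect_spin xs n \<le> (\<Sum>j=1..n. defect_spin xs j) div 2"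
      using pos[of n] by presburger
  qed (use n in simp)
  show "(if i = m then 1 else 0) - (if i = n then defect_spin xs (n - 1) + defect_spin xs n
      else defect_spin xs i - defect_spin xs (i + 1)) = spin_value n xs i"
    if "xs \<in> words_D n" "i \<in> {1..n}" for xs i
    using m by (auto simp: defect_spin_def spin_value_def numeral_2_eq_2)
  show "\<bar>spin_value n xs i\<bar> \<le> 1" for xs i by (auto simp: spin_value_def)
  show "\<exists>ys\<in>words_D n. \<forall>j\<in>{1..n}. defect_spin ys j = shift_D n i (spin_value n xs i) (defect_spin xs) j"
    if xs: "xs \<in> words_D n" and i: "i \<in> {1..n}" for xs i
  proof -
    define ys where "ys = (if i = n then swap_flip n xs else swap i xs)"
    have len: "length xs = n" using xs by (simp add: words_D_def)
    have eq: "defect_spin ys j = shift_D n i (spin_value n xs i) (defect_spin xs) j"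
      if j: "j \<in> {1..n}" for j
    proof (cases "i = n")
      case True
      consider "j = n" | "j = n - 1" | "j - 1 < n - 2" "j \<noteq> n" "j \<noteq> n - 1" using j by fastforce
      then show ?thesis
      proof cases
        case 1
        then show ?thesis using True n len swap_flip_nth(2)[of n xs]
          by (simp add: ys_def shift_D_def defect_spin_def spin_value_def numeral_2_eq_2)
      next
        case 2
        moreover have "n - Suc 0 \<noteq> n" using n by simp
        ultimately show ?thesis using True n len swap_flip_nth(1)[of n xs]
          by (simp add: ys_def shift_D_def defect_spin_def spin_value_def numeral_2_eq_2)
      next
        case 3
        then show ?thesis using True n len swap_flip_nth(3)[of n xs "j - 1"]
          by (simp add: ys_def shift_D_def defect_spin_def)
      qed
    next
      case False
      then have i': "1 \<le> i" "i < length xs" using i len by auto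
      consider "j = i" | "j = i + 1" | "j \<noteq> i" "j \<noteq> i + 1" by blast
      then show ?thesis
      proof cases
        case 1
        then show ?thesis using False swap_nth(1)[OF i']
          by (simp add: ys_def shift_D_def defect_spin_def spin_value_def)
      next
        case 2
        then show ?thesis using False swap_nth(2)[OF i']
          by (simp add: ys_def shift_D_def defect_spin_def spin_value_def)
      next
        case 3
        then show ?thesis using False swap_nth(3)[OF i', of j] j
          by (simp add: ys_def shift_D_def defect_spin_def)
      qed
    qed
    have "(\<Sum>j=1..n. defect_spin ys j) = (\<Sum>j=1..n. shift_D n i (spin_value n xs i) (defect_spin xs) j)"
      by (rule sum.cong) (use eq in auto)
    then have "even (\<Sum>j=1..n. defect_spin ys j)"
      unfolding sum_shift_D[OF i n] using xs words_D_iff[of xs n] by auto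
    then have "ys \<in> words_D n" using len by (simp add: words_D_iff ys_def swap_def swap_flip_def)
    then show ?thesis using eq by blast
  qed
  show "replicate n True \<in> words_D n"
  proof -
    have "count_list (replicate n True) False = 0" by (induction n) auto
    then show ?thesis by (simp add: words_D_def)
  qed
  show "defect_spin (replicate n True) j = 0" if "j \<in> {1..n}" for j
    using that by (auto simp: defect_spin_def)
qed

text \<open>
  At most one of the last two coroots has value 1, and one of them has it exactly if the
  letter before the last is True. This is the condition for a descent at the end once the
  last letter is replaced by False.
\<close>

lemma card_spin_value:
  assumes "length xs = n" "2 \<le> n"
  shows "card {i\<in>{1..n}. spin_value n xs i = 1} = descents (butlast xs @ [False])"
proof -
  let ?z = "butlast xs @ [False]"
  define A where "A = {i\<in>{1..n-2}. xs ! (i - 1) \<and> \<not> xs ! i}"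
  have one: "spin_value n xs i = 1 \<longleftrightarrow>
      (if i = n then xs ! (n - 2) \<and> xs ! (n - 1) else xs ! (i - 1) \<and> \<not> xs ! i)" for i
    by (simp add: spin_value_def)
  have split: "i \<in> {1..n} \<longleftrightarrow> i \<in> {1..n-2} \<or> i = n - 1 \<or> i = n" for i using assms(2) by auto
  have n12: "n - 1 - 1 = n - 2" "n - 1 \<noteq> n" "n - 1 \<notin> {1..n-2}" "n \<notin> {1..n-2}"
    using assms(2) by auto
  have "{i\<in>{1..n}. spin_value n xs i = 1} =
      A \<union> (if xs ! (n - 2) then (if xs ! (n - 1) then {n} else {n - 1}) else {})"
    unfolding one split A_def using n12 by auto
  moreover have "{i\<in>{1..<length ?z}. ?z ! (i - 1) \<and> \<not> ?z ! i} = A \<union> (if xs ! (n - 2) then {n - 1} else {})"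
  proof -
    have nth: "?z ! i = xs ! i" if "i < n - 1" for i using that assms by (simp add: nth_append nth_butlast)
    have last: "?z ! (n - 1) = False" using assms by (simp add: nth_append)
    have len: "i \<in> {1..<length ?z} \<longleftrightarrow> i \<in> {1..n-2} \<or> i = n - 1" for i using assms by auto
    have "?z ! (i - 1) \<and> \<not> ?z ! i \<longleftrightarrow> xs ! (i - 1) \<and> \<not> xs ! i" if "i \<in> {1..n-2}" for i
    proof -
      have "i < n - 1" "i - 1 < n - 1" using that by auto
      then show ?thesis by (simp only: nth)
    qed
    moreover have "?z ! (n - 1 - 1) \<and> \<not> ?z ! (n - 1) \<longleftrightarrow> xs ! (n - 2)"
      using last nth[of "n - 2"] n12(1) assms(2) by auto
    ultimately show ?thesis unfolding len A_def using n12 by auto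
  qed
  moreover have "card (A \<union> {n}) = card A + 1" "card (A \<union> {n - 1}) = card A + 1"
    using n12 by (auto simp: A_def)
  ultimately show ?thesis using card_descents[of ?z] by (auto split: if_splits)
qed

text \<open>
  The parity condition determines the last letter from the others.
\<close>

lemma bij_betw_butlast_words_D:
  assumes "1 \<le> n"
  shows "bij_betw butlast (words_D n) {xs. length xs = n - 1}"
proof (rule bij_betw_byWitness[where f' = "\<lambda>xs. xs @ [even (count_list xs False)]"])
  show "\<forall>xs\<in>words_D n. butlast xs @ [even (count_list (butlast xs) False)] = xs"
  proof
    fix xs assume xs: "xs \<in> words_D n"
    then have ne: "xs \<noteq> []" using assms by (auto simp: words_D_def)
    then have "count_list xs False = count_list (butlast xs) False + (if last xs then 0 else 1)"
      using count_list_append[of "butlast xs" "[last xs]" False] by simp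
    then have "even (count_list (butlast xs) False) = last xs"
      using xs by (auto simp: words_D_def split: if_splits)
    then show "butlast xs @ [even (count_list (butlast xs) False)] = xs" using ne by simp
  qed
qed (use assms in \<open>auto simp: words_D_def\<close>)

lemma (in fundamental_module) covering_poly_spin:
  assumes C: "C = cartan_matrix (TypeD n)" and n: "4 \<le> n" and m: "m = n"
  shows "weight_covering_poly sg H n \<alpha> sv act = (\<Sum>r\<le>n. monom (int (n choose (2 * r))) r)"
proof (rule poly_eqI)
  fix r
  let ?L = "{xs :: bool list. length xs = n - 1}"
  have "weight_covering_poly sg H n \<alpha> sv act =
      (\<Sum>xs\<in>words_D n. monom 1 (descents (butlast xs @ [False])))"
    unfolding covering_poly_spin_words[OF assms]
    by (intro sum.cong refl arg_cong2[where f = monom] card_spin_value) (use n in \<open>auto simp: words_D_def\<close>)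
  also have "\<dots> = (\<Sum>xs\<in>?L. monom 1 (descents (xs @ [False])))"
    using n by (intro sum.reindex_bij_betw[OF bij_betw_butlast_words_D]) simp
  also have "\<dots> = descent_poly ((\<lambda>xs. xs @ [False]) ` ?L)"
    by (simp add: descent_poly_def sum.reindex inj_on_def)
  finally show "coeff (weight_covering_poly sg H n \<alpha> sv act) r =
      coeff (\<Sum>r\<le>n. monom (int (n choose (2 * r))) r) r"
    using coeff_descent_poly_append_False[of "n - 1" r] n
    by (auto simp: coeff_sum coeff_monom binomial_eq_0)
qed

section \<open>The vector module of type D\<close>

text \<open>
  The pair \<open>(k, s)\<close> with a sign \<open>s\<close> stands for the weight \<open>s * \<epsilon>\<^sub>k\<close>; the highest weight is \<open>\<epsilon>\<^sub>1\<close>.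
\<close>

definition defect_vector :: "nat \<times> int \<Rightarrow> nat \<Rightarrow> int" where
  "defect_vector x j = of_bool (j = 1) - snd x * of_bool (j = fst x)"

definition vector_value :: "nat \<Rightarrow> nat \<times> int \<Rightarrow> nat \<Rightarrow> int" where
  "vector_value n x i = snd x *
     (if i = n then of_bool (fst x = n - 1) + of_bool (fst x = n)
      else of_bool (i = fst x) - of_bool (i + 1 = fst x))"

lemma sum_defect_vector:
  "1 \<le> k \<Longrightarrow> (\<Sum>j=1..i. defect_vector (k, s) j) = of_bool (1 \<le> i) - s * of_bool (k \<le> i)"
  by (simp add: defect_vector_def sum_subtractf flip: sum_distrib_left)

lemma (in fundamental_module) covering_poly_vector_sum:
  assumes C: "C = cartan_matrix (TypeD n)" and n: "4 \<le> n" and m: "m = 1"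
  shows "weight_covering_poly sg H n \<alpha> sv act =
    (\<Sum>x\<in>{1..n} \<times> {1, -1}. monom 1 (card {i\<in>{1..n}. vector_value n x i = 1}))"
proof (rule weight_covering_poly_D[OF C n])
  let ?X = "{1..n} \<times> {1, -1 :: int}"
  show "c = (\<lambda>_. 0)" if "c \<in> root_cone n" "dominant C n m c" for c
    using dominant_D_vector that n m C by blast
  show "even (\<Sum>j=1..n. defect_vector x j)" if "x \<in> ?X" for x
    using that n by (cases x) (auto simp: sum_defect_vector simp del: One_nat_def)
  show "x = x'" if x: "x \<in> ?X" "x' \<in> ?X"
    and eq: "\<And>j. j \<in> {1..n} \<Longrightarrow> defect_vector x j = defect_vector x' j" for x x'
  proof -
    have "snd x * of_bool (fst x = j) = snd x' * of_bool (fst x' = j)" if "j \<in> {1..n}" for j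
      using eq[OF that] by (auto simp: defect_vector_def split: if_splits)
    from this[of "fst x"] this[of "fst x'"] show ?thesis
      using x by (cases x; cases x') (auto simp: of_bool_def split: if_splits)
  qed
  show "coords_D n (defect_vector x) \<in> root_cone n" if x: "x \<in> ?X" for x
  proof (rule coords_D_root_cone)
    obtain k s where ks: "x = (k, s)" "1 \<le> k" "k \<le> n" "s = 1 \<or> s = -1" using x by auto
    show "0 \<le> (\<Sum>j=1..i. defect_vector x j)" if "i \<le> n" for i
      using ks by (auto simp: sum_defect_vector simp del: One_nat_def)
    show "defect_vector x n \<le> (\<Sum>j=1..n. defect_vector x j) div 2"
      using ks n unfolding ks(1) sum_defect_vector[OF ks(2)] by (auto simp: defect_vector_def)
  qed (use n in simp)
  show "(if i = m then 1 else 0) - (if i = n then defect_vector x (n - 1) + defect_vector x n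
      else defect_vector x i - defect_vector x (i + 1)) = vector_value n x i"
    if "x \<in> ?X" "i \<in> {1..n}" for x i
    using m n that(2) by (auto simp: defect_vector_def vector_value_def algebra_simps)
  show "\<bar>vector_value n x i\<bar> \<le> 1" if "x \<in> ?X" for x i
    using that by (auto simp: vector_value_def)
  show "\<exists>x'\<in>?X. \<forall>j\<in>{1..n}. defect_vector x' j = shift_D n i (vector_value n x i) (defect_vector x) j"
    if x: "x \<in> ?X" and i: "i \<in> {1..n}" for x i
  proof -
    obtain k s where ks: "x = (k, s)" "1 \<le> k" "k \<le> n" "s = 1 \<or> s = -1" using x by auto
    define x' where "x' = (if i = n then (if k = n then (n - 1, - s) else if k = n - 1 then (n, - s) else (k, s))
      else (if k = i then (i + 1, s) else if k = i + 1 then (i, s) else (k, s)))"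
    have "x' \<in> ?X" using ks i n by (auto simp: x'_def)
    moreover have "defect_vector x' j = shift_D n i (vector_value n x i) (defect_vector x) j"
      if "j \<in> {1..n}" for j
      using ks(2-4) i n that unfolding ks(1)
      by (auto simp: x'_def shift_D_def vector_value_def defect_vector_def)
    ultimately show ?thesis by blast
  qed
  show "(1, 1) \<in> ?X" using n by simp
  show "defect_vector (1, 1) j = 0" for j by (simp add: defect_vector_def)
qed

text \<open>
  The weights of the vector module form two chains joined by a square: only \<open>\<epsilon>\<^sub>n\<^sub>-\<^sub>1\<close> covers
  two weights, namely \<open>\<epsilon>\<^sub>n\<close> and \<open>-\<epsilon>\<^sub>n\<close>, and only the lowest weight \<open>-\<epsilon>\<^sub>1\<close> covers none.
\<close>

lemma card_vector_value:
  assumes "4 \<le> n" "1 \<le> k" "k \<le> n"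
  shows "card {i\<in>{1..n}. vector_value n (k, 1) i = 1} = (if k = n - 1 then 2 else 1)"
    "card {i\<in>{1..n}. vector_value n (k, - 1) i = 1} = (if k = 1 then 0 else 1)"
proof -
  have "{i\<in>{1..n}. vector_value n (k, 1) i = 1} = (if k = n - 1 then {n - 1, n} else {k})"
    using assms by (auto simp: vector_value_def split: if_splits)
  then show "card {i\<in>{1..n}. vector_value n (k, 1) i = 1} = (if k = n - 1 then 2 else 1)"
    using assms by simp
  have "{i\<in>{1..n}. vector_value n (k, - 1) i = 1} = (if k = 1 then {} else {k - 1})"
    using assms by (auto simp: vector_value_def split: if_splits)
  then show "card {i\<in>{1..n}. vector_value n (k, - 1) i = 1} = (if k = 1 then 0 else 1)"
    by simp
qed

lemma (in fundamental_module) covering_poly_vector: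
  assumes C: "C = cartan_matrix (TypeD n)" and n: "4 \<le> n" and m: "m = 1"
  shows "weight_covering_poly sg H n \<alpha> sv act = [:1, 2 * int n - 2, 1:]"
proof -
  let ?t = "monom (1::int) 1"
  have "weight_covering_poly sg H n \<alpha> sv act =
      (\<Sum>k\<in>{1..n}. \<Sum>s\<in>{1, -1}. monom 1 (card {i\<in>{1..n}. vector_value n (k, s) i = 1}))"
    unfolding covering_poly_vector_sum[OF assms] sum.cartesian_product by (rule sum.cong) auto
  also have "\<dots> = (\<Sum>k\<in>{1..n}. monom 1 (if k = n - 1 then 2 else 1) + monom 1 (if k = 1 then 0 else 1))"
  proof (rule sum.cong[OF refl])
    fix k assume "k \<in> {1..n}"
    then show "(\<Sum>s\<in>{1, -1}. monom 1 (card {i\<in>{1..n}. vector_value n (k, s) i = 1})) =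
        (monom 1 (if k = n - 1 then 2 else 1) + monom 1 (if k = 1 then 0 else 1) :: int poly)"
      using card_vector_value[OF n, of k] by simp
  qed
  also have "\<dots> = (\<Sum>k\<in>{1..n}. ?t + ?t + (if k = n - 1 then monom 1 2 - ?t else 0) + (if k = 1 then 1 - ?t else 0))"
    by (rule sum.cong) auto
  also have "\<dots> = of_nat n * (?t + ?t) + (monom 1 2 - ?t) + (1 - ?t)"
  proof -
    have "Suc 0 \<le> n - Suc 0" using n by simp
    then show ?thesis using n by (simp add: sum.distrib)
  qed
  also have "\<dots> = [:1, 2 * int n - 2, 1:]"
    by (simp add: monom_altdef of_nat_poly power2_eq_square one_pCons algebra_simps)
  finally show ?thesis .
qed

section \<open>Weight systems given by lists\<close>

text \<open>
  Root coordinates are numbered from 1, list entries from 0; the same shift relates the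
  arguments of \<open>list_value\<close> and of \<open>coroot_value\<close>.
\<close>

definition list_coords :: "int list \<Rightarrow> nat \<Rightarrow> int" where
  "list_coords xs i = (if 1 \<le> i \<and> i \<le> length xs then xs ! (i - 1) else 0)"

definition list_value :: "int list list \<Rightarrow> nat \<Rightarrow> int list \<Rightarrow> nat \<Rightarrow> int" where
  "list_value A m xs i = (if Suc i = m then 1 else 0) - sum_list (map2 (*) (A ! i) xs)"

definition reflection_closed_list :: "int list list \<Rightarrow> nat \<Rightarrow> nat \<Rightarrow> int list list \<Rightarrow> bool" where
  "reflection_closed_list A m n L \<longleftrightarrow>
     (\<forall>xs\<in>set L. length xs = n \<and> (\<forall>x\<in>set xs. 0 \<le> x) \<and>
        (\<forall>i\<in>set [0..<n]. List.member L (xs[i := xs ! i + list_value A m xs i])))"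

definition covered_count :: "nat \<Rightarrow> int list list \<Rightarrow> int list \<Rightarrow> nat" where
  "covered_count n L xs = length (filter (\<lambda>i. List.member L (xs[i := xs ! i + 1])) [0..<n])"

lemma list_coords_upd:
  "i < length xs \<Longrightarrow> list_coords (xs[i := xs ! i + t]) = (list_coords xs)(Suc i := list_coords xs (Suc i) + t)"
  by (auto simp: list_coords_def fun_eq_iff nth_list_update)

lemma inj_on_list_coords: "inj_on list_coords {xs. length xs = n}"
proof (rule inj_onI)
  fix xs ys assume "xs \<in> {xs. length xs = n}" "ys \<in> {xs. length xs = n}" "list_coords xs = list_coords ys"
  then have len: "length xs = n" "length ys = n" and eq: "list_coords xs (Suc i) = list_coords ys (Suc i)" for i
    by auto
  show "xs = ys"
  proof (rule nth_equalityI)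
    show "length xs = length ys" using len by simp
    show "xs ! i = ys ! i" if "i < length xs" for i
      using eq[of i] that len by (simp add: list_coords_def)
  qed
qed

lemma coroot_value_list_coords:
  assumes "length xs = n" "i < n" "length (A ! i) = n"
    and "\<And>j. j < n \<Longrightarrow> A ! i ! j = C (Suc i) (Suc j)"
  shows "coroot_value C n m (list_coords xs) (Suc i) = list_value A m xs i"
proof -
  have "sum_list (map2 (*) (A ! i) xs) = (\<Sum>j<n. A ! i ! j * xs ! j)"
    using assms(1,3) by (simp add: sum_list_sum_nth atLeast0LessThan)
  also have "\<dots> = (\<Sum>j<n. C (Suc i) (Suc j) * list_coords xs (Suc j))"
    by (rule sum.cong) (use assms in \<open>auto simp: list_coords_def\<close>)
  also have "\<dots> = (\<Sum>j=1..n. C (Suc i) j * list_coords xs j)"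
    by (simp add: sum.atLeast1_atMost_eq)
  finally show ?thesis by (simp add: coroot_value_def list_value_def)
qed

text \<open>
  Stability under reflections and the numbers of covered elements are finite computations
  with lists, so only the dominant vectors need an argument.
\<close>

lemma (in fundamental_module) weight_covering_poly_list:
  assumes A: "\<And>i. i < n \<Longrightarrow> length (A ! i) = n"
      "\<And>i j. i < n \<Longrightarrow> j < n \<Longrightarrow> A ! i ! j = C (Suc i) (Suc j)"
    and closed: "reflection_closed_list A m n L" and L: "distinct L"
    and dom: "\<And>c. c \<in> root_cone n \<Longrightarrow> dominant C n m c \<Longrightarrow>
      c \<in> list_coords ` set L \<and> c \<in> root_coords"
  shows "weight_covering_poly sg H n \<alpha> sv act = sum_list (map (monom 1) (map (covered_count n L) L))"
proof -
  have len: "length xs = n" if "xs \<in> set L" for xs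
    using closed that by (simp add: reflection_closed_list_def)
  have inj: "inj_on list_coords (set L)"
    by (rule inj_on_subset[OF inj_on_list_coords]) (use len in auto)
  have mem: "list_coords ys \<in> list_coords ` set L \<longleftrightarrow> ys \<in> set L" if "length ys = n" for ys
    using that len inj_on_list_coords[of n] by (auto simp: inj_on_def)
  have eq: "root_coords = list_coords ` set L"
  proof (rule root_coords_eqI[OF _ dom])
    show "reflection_closed C n m (list_coords ` set L)"
      unfolding reflection_closed_def
    proof (intro conjI ballI)
      show "list_coords ` set L \<subseteq> root_cone n"
        using closed by (auto simp: reflection_closed_list_def root_cone_def list_coords_def)
      fix c i assume "c \<in> list_coords ` set L" and i: "i \<in> {1..n}"
      then obtain xs where xs: "xs \<in> set L" "c = list_coords xs" by blast
      obtain k where k: "i = Suc k" "k < n" using i by (cases i) auto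
      have "xs[k := xs ! k + list_value A m xs k] \<in> set L"
        using closed xs k(2) by (auto simp: reflection_closed_list_def)
      then have "list_coords (xs[k := xs ! k + list_value A m xs k]) \<in> list_coords ` set L" by blast
      then show "c(i := c i + coroot_value C n m c i) \<in> list_coords ` set L"
        using k len[OF xs(1)] A xs(2)
        by (simp add: list_coords_upd coroot_value_list_coords[of xs n k A])
    qed
  qed
  have count: "card {i\<in>{1..n}. (list_coords xs)(i := list_coords xs i + 1) \<in> list_coords ` set L} =
      covered_count n L xs" if xs: "xs \<in> set L" for xs
  proof -
    have iff: "(list_coords xs)(Suc k := list_coords xs (Suc k) + 1) \<in> list_coords ` set L \<longleftrightarrow>
        List.member L (xs[k := xs ! k + 1])" if "k < n" for k
      using that len[OF xs] mem[of "xs[k := xs ! k + 1]"]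
      by (simp add: list_coords_upd[of k xs 1, symmetric])
    have "{i\<in>{1..n}. (list_coords xs)(i := list_coords xs i + 1) \<in> list_coords ` set L} =
        Suc ` {k\<in>{0..<n}. (list_coords xs)(Suc k := list_coords xs (Suc k) + 1) \<in> list_coords ` set L}"
    proof (rule set_eqI)
      fix i
      show "i \<in> {i\<in>{1..n}. (list_coords xs)(i := list_coords xs i + 1) \<in> list_coords ` set L} \<longleftrightarrow>
          i \<in> Suc ` {k\<in>{0..<n}. (list_coords xs)(Suc k := list_coords xs (Suc k) + 1) \<in> list_coords ` set L}"
        by (cases i) auto
    qed
    also have "{k\<in>{0..<n}. (list_coords xs)(Suc k := list_coords xs (Suc k) + 1) \<in> list_coords ` set L} =
        set (filter (\<lambda>k. List.member L (xs[k := xs ! k + 1])) [0..<n])"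
      using iff by auto
    also have "card (Suc ` \<dots>) = covered_count n L xs"
      unfolding covered_count_def
      by (simp only: card_image[OF inj_on_subset[OF inj_Suc subset_UNIV]] distinct_card distinct_filter distinct_upt)
    finally show ?thesis .
  qed
  have "weight_covering_poly sg H n \<alpha> sv act = (\<Sum>xs\<in>set L. monom 1 (covered_count n L xs))"
    unfolding weight_covering_poly_eq eq sum.reindex[OF inj] comp_def
    by (rule sum.cong[OF refl]) (simp only: count)
  also have "\<dots> = sum_list (map (monom 1) (map (covered_count n L) L))"
    using L by (simp add: sum_list_distinct_conv_sum_set comp_def)
  finally show ?thesis .
qed

lemma (in fundamental_module) weight_covering_poly_minuscule_list:
  assumes A: "\<And>i. i < n \<Longrightarrow> length (A ! i) = n"
      "\<And>i j. i < n \<Longrightarrow> j < n \<Longrightarrow> A ! i ! j = C (Suc i) (Suc j)"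
    and L: "reflection_closed_list A m n L" "distinct L" "replicate n 0 \<in> set L"
    and dom: "\<And>c. c \<in> root_cone n \<Longrightarrow> dominant C n m c \<Longrightarrow> c = (\<lambda>_. 0)"
  shows "weight_covering_poly sg H n \<alpha> sv act = sum_list (map (monom 1) (map (covered_count n L) L))"
proof (rule weight_covering_poly_list[OF A L(1,2)])
  fix c assume "c \<in> root_cone n" "dominant C n m c"
  then have "c = (\<lambda>_. 0)" by (rule dom)
  moreover have "list_coords (replicate n 0) = (\<lambda>_. 0)"
    by (auto simp: list_coords_def fun_eq_iff)
  ultimately show "c \<in> list_coords ` set L \<and> c \<in> root_coords"
    using L(3) zero_root_coords by (metis imageI)
qed

lemma dominant_list_value:
  assumes A: "\<And>i. i < n \<Longrightarrow> length (A ! i) = n"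
      "\<And>i j. i < n \<Longrightarrow> j < n \<Longrightarrow> A ! i ! j = C (Suc i) (Suc j)"
    and c: "c \<in> root_cone n" "dominant C n m c" and i: "i < n"
  shows "0 \<le> list_value A m (map c [1..<Suc n]) i"
proof -
  have "c = list_coords (map c [1..<Suc n])"
  proof
    fix i
    have "map c [1..<Suc n] ! (i - 1) = c i" if "1 \<le> i" "i \<le> n" 
      using that by (subst nth_map) (auto simp del: upt_Suc)
    then show "c i = list_coords (map c [1..<Suc n]) i" using c(1)
      by (auto simp: list_coords_def root_cone_def simp del: upt_Suc)
  qed
  then have "list_value A m (map c [1..<Suc n]) i = coroot_value C n m c (Suc i)"
    using coroot_value_list_coords[of "map c [1..<Suc n]" n i A C m] A i by (simp del: upt_Suc)
  then show ?thesis using c(2) i by (simp add: dominant_def)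
qed

lemma cartan_matrix_E:
  assumes "4 \<le> n"
  shows "cartan_matrix (TypeE n) i j = (if i = j then 2
    else if j = i + 1 \<and> 1 \<le> i \<and> j < n \<or> i = j + 1 \<and> 1 \<le> j \<and> i < n \<or>
      i = n - 3 \<and> j = n \<or> j = n - 3 \<and> i = n then - 1 else 0)"
proof -
  have "{i, j} \<in> dynkin_edges (TypeE n) \<longleftrightarrow> j = i + 1 \<and> 1 \<le> i \<and> j < n \<or>
      i = j + 1 \<and> 1 \<le> j \<and> i < n \<or> i = n - 3 \<and> j = n \<or> j = n - 3 \<and> i = n"
    using assms by (auto simp: doubleton_eq_iff)
  then show ?thesis by (auto simp: cartan_matrix_def simp del: dynkin_edges.simps)
qed

lemma cartan_matrix_C:
  "cartan_matrix (TypeC n) i j = (if i = j then 2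
    else if j = i + 1 \<and> 1 \<le> i \<and> i < n \<or> i = j + 1 \<and> 1 \<le> j \<and> j < n
      then (if i = n - 1 \<and> j = n then - 2 else - 1) else 0)"
proof -
  have "{i, j} \<in> dynkin_edges (TypeC n) \<longleftrightarrow> j = i + 1 \<and> 1 \<le> i \<and> i < n \<or> i = j + 1 \<and> 1 \<le> j \<and> j < n"
    by (auto simp: doubleton_eq_iff)
  then show ?thesis by (auto simp: cartan_matrix_def simp del: dynkin_edges.simps)
qed

section \<open>The modules of type C3, E6 and E7\<close>

definition matrix_C3 :: "int list list" where
  "matrix_C3 =
    [[2,-1,0], [-1,2,-2], [0,-1,2]]"

text \<open>
  The root coordinates of the 8 conjugates of the highest weight and of the 6 conjugates
  of \<open>[0, 1, 1]\<close>, which is the first fundamental weight.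
\<close>

definition weights_C3 :: "int list list" where
  "weights_C3 =
    [[0,0,0], [0,0,1], [0,1,1], [1,1,1], [0,2,1], [1,2,1], [0,2,2], [2,2,1], [1,2,2], [2,2,2],
     [1,3,2], [2,3,2], [2,4,2], [2,4,3]]"

lemma matrix_C3: "i < 3 \<Longrightarrow> j < 3 \<Longrightarrow> matrix_C3 ! i ! j = cartan_matrix (TypeC 3) (Suc i) (Suc j)"
  by (auto simp: less_Suc_eq numeral_eq_Suc cartan_matrix_C matrix_C3_def)

lemma matrix_shape_C3: "i < 3 \<Longrightarrow> length (matrix_C3 ! i) = 3"
  by (auto simp: less_Suc_eq numeral_eq_Suc matrix_C3_def)

lemma reflection_closed_C3: "reflection_closed_list matrix_C3 3 3 weights_C3"
  by code_simp

lemma distinct_C3: "distinct weights_C3"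
  by code_simp

lemma covered_count_C3: "map (covered_count 3 weights_C3) weights_C3 =
   [1, 1, 2, 1, 2, 2, 1, 1, 2, 1, 1, 1, 1, 0]"
  by code_simp

definition matrix_E6 :: "int list list" where
  "matrix_E6 =
    [[2,-1,0,0,0,0], [-1,2,-1,0,0,0], [0,-1,2,-1,0,-1], [0,0,-1,2,-1,0], [0,0,0,-1,2,0],
     [0,0,-1,0,0,2]]"

definition weights_E6 :: "int list list" where
  "weights_E6 =
    [[0,0,0,0,0,0], [1,0,0,0,0,0], [1,1,0,0,0,0], [1,1,1,0,0,0], [1,1,1,1,0,0], [1,1,1,0,0,1],
     [1,1,1,1,1,0], [1,1,1,1,0,1], [1,1,2,1,0,1], [1,1,1,1,1,1], [1,2,2,1,0,1], [1,1,2,1,1,1],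
     [2,2,2,1,0,1], [1,2,2,1,1,1], [1,1,2,2,1,1], [2,2,2,1,1,1], [1,2,2,2,1,1], [2,2,2,2,1,1],
     [1,2,3,2,1,1], [2,2,3,2,1,1], [1,2,3,2,1,2], [2,3,3,2,1,1], [2,2,3,2,1,2], [2,3,3,2,1,2],
     [2,3,4,2,1,2], [2,3,4,3,1,2], [2,3,4,3,2,2]]"

lemma matrix_E6: "i < 6 \<Longrightarrow> j < 6 \<Longrightarrow> matrix_E6 ! i ! j = cartan_matrix (TypeE 6) (Suc i) (Suc j)"
  by (auto simp: less_Suc_eq numeral_eq_Suc cartan_matrix_E matrix_E6_def)

lemma matrix_shape_E6: "i < 6 \<Longrightarrow> length (matrix_E6 ! i) = 6"
  by (auto simp: less_Suc_eq numeral_eq_Suc matrix_E6_def)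

lemma reflection_closed_E6: "reflection_closed_list matrix_E6 1 6 weights_E6"
  by code_simp

lemma distinct_E6: "distinct weights_E6"
  by code_simp

lemma covered_count_E6: "map (covered_count 6 weights_E6) weights_E6 =
   [1, 1, 1, 2, 2, 1, 1, 2, 2, 1, 2, 2, 1, 2, 1, 1, 2, 1, 2, 2, 1, 1, 1, 1, 1, 1, 0]"
  by code_simp

definition matrix_E7 :: "int list list" where
  "matrix_E7 =
    [[2,-1,0,0,0,0,0], [-1,2,-1,0,0,0,0], [0,-1,2,-1,0,0,0], [0,0,-1,2,-1,0,-1],
     [0,0,0,-1,2,-1,0], [0,0,0,0,-1,2,0], [0,0,0,-1,0,0,2]]"

definition weights_E7 :: "int list list" where
  "weights_E7 =
    [[0,0,0,0,0,0,0], [1,0,0,0,0,0,0], [1,1,0,0,0,0,0], [1,1,1,0,0,0,0], [1,1,1,1,0,0,0],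
     [1,1,1,1,1,0,0], [1,1,1,1,0,0,1], [1,1,1,1,1,1,0], [1,1,1,1,1,0,1], [1,1,1,2,1,0,1],
     [1,1,1,1,1,1,1], [1,1,2,2,1,0,1], [1,1,1,2,1,1,1], [1,2,2,2,1,0,1], [1,1,2,2,1,1,1],
     [1,1,1,2,2,1,1], [2,2,2,2,1,0,1], [1,2,2,2,1,1,1], [1,1,2,2,2,1,1], [2,2,2,2,1,1,1],
     [1,2,2,2,2,1,1], [1,1,2,3,2,1,1], [2,2,2,2,2,1,1], [1,2,2,3,2,1,1], [1,1,2,3,2,1,2],
     [2,2,2,3,2,1,1], [1,2,3,3,2,1,1], [1,2,2,3,2,1,2], [2,2,3,3,2,1,1], [2,2,2,3,2,1,2],
     [1,2,3,3,2,1,2], [2,3,3,3,2,1,1], [2,2,3,3,2,1,2], [1,2,3,4,2,1,2], [2,3,3,3,2,1,2],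
     [2,2,3,4,2,1,2], [1,2,3,4,3,1,2], [2,3,3,4,2,1,2], [2,2,3,4,3,1,2], [1,2,3,4,3,2,2],
     [2,3,4,4,2,1,2], [2,3,3,4,3,1,2], [2,2,3,4,3,2,2], [2,3,4,4,3,1,2], [2,3,3,4,3,2,2],
     [2,3,4,5,3,1,2], [2,3,4,4,3,2,2], [2,3,4,5,3,2,2], [2,3,4,5,3,1,3], [2,3,4,5,4,2,2],
     [2,3,4,5,3,2,3], [2,3,4,5,4,2,3], [2,3,4,6,4,2,3], [2,3,5,6,4,2,3], [2,4,5,6,4,2,3],
     [3,4,5,6,4,2,3]]"

lemma matrix_E7: "i < 7 \<Longrightarrow> j < 7 \<Longrightarrow> matrix_E7 ! i ! j = cartan_matrix (TypeE 7) (Suc i) (Suc j)"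
  by (auto simp: less_Suc_eq numeral_eq_Suc cartan_matrix_E matrix_E7_def)

lemma matrix_shape_E7: "i < 7 \<Longrightarrow> length (matrix_E7 ! i) = 7"
  by (auto simp: less_Suc_eq numeral_eq_Suc matrix_E7_def)

lemma reflection_closed_E7: "reflection_closed_list matrix_E7 1 7 weights_E7"
  by code_simp

lemma distinct_E7: "distinct weights_E7"
  by code_simp

lemma covered_count_E7: "map (covered_count 7 weights_E7) weights_E7 =
   [1, 1, 1, 1, 2, 2, 1, 1, 2, 2, 1, 2, 2, 2, 2, 1, 1, 2, 2, 1, 2, 2, 1, 3, 1, 2, 2, 2, 2, 1,
    2, 1, 2, 2, 1, 2, 2, 2, 2, 1, 1, 2, 1, 2, 1, 2, 1, 2, 1, 1, 1, 1, 1, 1, 1, 0]"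
  by code_simp

text \<open>
  Linear arithmetic only bounds each coordinate by an entry of the first column of the
  inverse Cartan matrix. At node 5 this entry is \<open>2 / 3\<close>, so \<open>c\<^sub>5 = 0\<close>; deleting this node
  leaves a diagram of type D5, in which the same argument applies to \<open>c\<^sub>4\<close> and \<open>c\<^sub>6\<close>, and then a
  diagram of type A3.
\<close>

lemma dominant_E6:
  assumes "c \<in> root_cone 6" "dominant (cartan_matrix (TypeE 6)) 6 1 c"
  shows "c = (\<lambda>_. 0)"
proof -
  have nonneg: "0 \<le> c i" for i using assms(1) by (simp add: root_cone_def)
  have "[1..<Suc 6] = [1, 2, 3, 4, 5, 6]" by code_simp
  then have val: "0 \<le> list_value matrix_E6 1 [c 1, c 2, c 3, c 4, c 5, c 6] i" if "i < 6" for i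
    using dominant_list_value[OF matrix_shape_E6 matrix_E6 assms that] by simp
  have ineq: "2 * c 1 \<le> 1 + c 2" "2 * c 2 \<le> c 1 + c 3" "2 * c 3 \<le> c 2 + c 4 + c 6"
    "2 * c 4 \<le> c 3 + c 5" "2 * c 5 \<le> c 4" "2 * c 6 \<le> c 3"
    using val[of 0] val[of 1] val[of 2] val[of 3] val[of 4] val[of 5]
    by (simp_all add: list_value_def matrix_E6_def)
  have "c 5 \<le> 0" using ineq by linarith
  moreover from this have "c 4 \<le> 0" "c 6 \<le> 0" using ineq by linarith+
  moreover from this have "c 1 \<le> 0" "c 2 \<le> 0" "c 3 \<le> 0" using ineq by linarith+
  ultimately have "c 1 = 0" "c 2 = 0" "c 3 = 0" "c 4 = 0" "c 5 = 0" "c 6 = 0"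
    using nonneg by (simp_all add: order_antisym)
  moreover have "i = 1 \<or> i = 2 \<or> i = 3 \<or> i = 4 \<or> i = 5 \<or> i = 6 \<or> i \<notin> {1..6}" for i :: nat
    by auto
  moreover have "c i = 0" if "i \<notin> {1..6}" for i using assms(1) that by (simp add: root_cone_def)
  ultimately show ?thesis by (intro ext) (metis (full_types))
qed

text \<open>
  Here the bound at node 6 is 1. It is attained only if all inequalities are equalities,
  but then \<open>c\<^sub>1 = 3 / 2\<close>. After \<open>c\<^sub>6 = 0\<close> the remaining diagram has type D6, in which \<open>c\<^sub>5\<close> and \<open>c\<^sub>7\<close>
  are at most \<open>1 / 2\<close>, and what remains has type A4.
\<close>

lemma dominant_E7:
  assumes "c \<in> root_cone 7" "dominant (cartan_matrix (TypeE 7)) 7 1 c"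
  shows "c = (\<lambda>_. 0)"
proof -
  have nonneg: "0 \<le> c i" for i using assms(1) by (simp add: root_cone_def)
  have "[1..<Suc 7] = [1, 2, 3, 4, 5, 6, 7]" by code_simp
  then have val: "0 \<le> list_value matrix_E7 1 [c 1, c 2, c 3, c 4, c 5, c 6, c 7] i" if "i < 7" for i
    using dominant_list_value[OF matrix_shape_E7 matrix_E7 assms that] by simp
  have ineq: "2 * c 1 \<le> 1 + c 2" "2 * c 2 \<le> c 1 + c 3" "2 * c 3 \<le> c 2 + c 4"
    "2 * c 4 \<le> c 3 + c 5 + c 7" "2 * c 5 \<le> c 4 + c 6" "2 * c 6 \<le> c 5" "2 * c 7 \<le> c 4"
    using val[of 0] val[of 1] val[of 2] val[of 3] val[of 4] val[of 5] val[of 6]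
    by (simp_all add: list_value_def matrix_E7_def)
  have "c 6 \<le> 0"
  proof (rule ccontr)
    assume "\<not> c 6 \<le> 0"
    then have "2 * c 1 = 3" using ineq by linarith
    then show False by presburger
  qed
  moreover from this have "c 5 \<le> 0" "c 7 \<le> 0" using ineq by linarith+
  moreover from this have "c 1 \<le> 0" "c 2 \<le> 0" "c 3 \<le> 0" "c 4 \<le> 0" using ineq by linarith+
  ultimately have "c 1 = 0" "c 2 = 0" "c 3 = 0" "c 4 = 0" "c 5 = 0" "c 6 = 0" "c 7 = 0"
    using nonneg by (simp_all add: order_antisym)
  moreover have "i = 1 \<or> i = 2 \<or> i = 3 \<or> i = 4 \<or> i = 5 \<or> i = 6 \<or> i = 7 \<or> i \<notin> {1..7}" for i :: nat
    by auto
  moreover have "c i = 0" if "i \<notin> {1..7}" for i using assms(1) that by (simp add: root_cone_def)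
  ultimately show ?thesis by (intro ext) (metis (full_types))
qed

lemma dominant_C3:
  assumes "c \<in> root_cone 3" "dominant (cartan_matrix (TypeC 3)) 3 3 c"
  shows "c = list_coords [0, 0, 0] \<or> c = list_coords [0, 1, 1]"
proof -
  have nonneg: "0 \<le> c i" for i using assms(1) by (simp add: root_cone_def)
  have "[1..<Suc 3] = [1, 2, 3]" by code_simp
  then have val: "0 \<le> list_value matrix_C3 3 [c 1, c 2, c 3] i" if "i < 3" for i
    using dominant_list_value[OF matrix_shape_C3 matrix_C3 assms that] by simp
  have ineq: "2 * c 1 \<le> c 2" "2 * c 2 \<le> c 1 + 2 * c 3" "2 * c 3 \<le> 1 + c 2"
    using val[of 0] val[of 1] val[of 2] by (simp_all add: list_value_def matrix_C3_def)
  have "c 1 = 0 \<and> c 2 = 0 \<and> c 3 = 0 \<or> c 1 = 0 \<and> c 2 = 1 \<and> c 3 = 1"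
    using ineq nonneg[of 1] nonneg[of 2] nonneg[of 3] by presburger
  moreover have "c = list_coords [c 1, c 2, c 3]"
  proof
    fix i :: nat
    consider "i = 1" | "i = 2" | "i = 3" | "i \<notin> {1..3}" by fastforce
    then show "c i = list_coords [c 1, c 2, c 3] i"
      using assms(1) by cases (auto simp: list_coords_def root_cone_def)
  qed
  ultimately show ?thesis by metis
qed

lemma (in fundamental_module) covering_poly_E6:
  assumes "n = 6" "C = cartan_matrix (TypeE 6)" "m = 1"
  shows "weight_covering_poly sg H n \<alpha> sv act = [:1, 16, 10:]"
proof -
  have "weight_covering_poly sg H n \<alpha> sv act =
      sum_list (map (monom 1) (map (covered_count n weights_E6) weights_E6))"
  proof (rule weight_covering_poly_minuscule_list[where A = matrix_E6])
    show "c = (\<lambda>_. 0)" if "c \<in> root_cone n" "dominant C n m c" for c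
      using dominant_E6 that assms by blast
    show "replicate n 0 \<in> set weights_E6" by (simp add: assms weights_E6_def numeral_eq_Suc)
  qed (use assms matrix_E6 matrix_shape_E6 reflection_closed_E6 distinct_E6 in auto)
  also have "\<dots> = [:1, 16, 10:]"
    unfolding assms(1) covered_count_E6 by (simp add: monom_altdef power2_eq_square one_pCons)
  finally show ?thesis .
qed

lemma (in fundamental_module) covering_poly_E7:
  assumes "n = 7" "C = cartan_matrix (TypeE 7)" "m = 1"
  shows "weight_covering_poly sg H n \<alpha> sv act = [:1, 27, 27, 1:]"
proof -
  have "weight_covering_poly sg H n \<alpha> sv act =
      sum_list (map (monom 1) (map (covered_count n weights_E7) weights_E7))"
  proof (rule weight_covering_poly_minuscule_list[where A = matrix_E7])
    show "c = (\<lambda>_. 0)" if "c \<in> root_cone n" "dominant C n m c" for c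
      using dominant_E7 that assms by blast
    show "replicate n 0 \<in> set weights_E7" by (simp add: assms weights_E7_def numeral_eq_Suc)
  qed (use assms matrix_E7 matrix_shape_E7 reflection_closed_E7 distinct_E7 in auto)
  also have "\<dots> = [:1, 27, 27, 1:]"
    unfolding assms(1) covered_count_E7
    by (simp add: monom_altdef power2_eq_square power3_eq_cube one_pCons)
  finally show ?thesis .
qed

text \<open>
  The highest weight is not minuscule: besides it, the first fundamental weight is
  dominant. It is reached from the highest weight by subtracting the simple roots 3 and 2.
\<close>

lemma (in fundamental_module) covering_poly_C3:
  assumes "n = 3" "C = cartan_matrix (TypeC 3)" "m = 3"
  shows "weight_covering_poly sg H n \<alpha> sv act = [:1, 9, 4:]"
proof -
  have "weight_covering_poly sg H n \<alpha> sv act =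
      sum_list (map (monom 1) (map (covered_count n weights_C3) weights_C3))"
  proof (rule weight_covering_poly_list[where A = matrix_C3])
    show "c \<in> list_coords ` set weights_C3 \<and> c \<in> root_coords"
      if "c \<in> root_cone n" "dominant C n m c" for c
    proof -
      have zero: "list_coords [0, 0, 0] \<in> root_coords"
      proof -
        have "list_coords [0, 0, 0] = (\<lambda>_. 0)"
          by (auto simp: list_coords_def fun_eq_iff less_Suc_eq nth_Cons')
        then show ?thesis using zero_root_coords by simp
      qed
      have step: "list_coords (xs[i := xs ! i + 1]) \<in> root_coords"
        if "list_coords xs \<in> root_coords" "length xs = 3" "i < 3" "1 \<le> list_value matrix_C3 3 xs i" for xs i
        using root_coords_string[OF that(1), of "Suc i" 1] that(2-4)
          coroot_value_list_coords[of xs 3 i matrix_C3 C 3] matrix_C3 matrix_shape_C3 assms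
        by (simp add: list_coords_upd)
      have "list_coords [0, 0, 1] \<in> root_coords"
        using step[OF zero, of 2] by (simp add: list_value_def matrix_C3_def)
      from step[OF this, of 1] have "list_coords [0, 1, 1] \<in> root_coords"
        by (simp add: list_value_def matrix_C3_def)
      moreover have "[0, 0, 0] \<in> set weights_C3" "[0, 1, 1] \<in> set weights_C3"
        by (simp_all add: weights_C3_def)
      ultimately show ?thesis using dominant_C3[of c] that zero assms by blast
    qed
  qed (use assms matrix_C3 matrix_shape_C3 reflection_closed_C3 distinct_C3 in auto)
  also have "\<dots> = [:1, 9, 4:]"
    unfolding assms(1) covered_count_C3 by (simp add: monom_altdef power2_eq_square one_pCons)
  finally show ?thesis .
qed

theorem theorem5p3:
  fixes sg :: "'k::{alg_closed_field, field_char_0} \<Rightarrow> 'g::ab_group_add \<Rightarrow> 'g"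
    and br :: "'g \<Rightarrow> 'g \<Rightarrow> 'g"
    and H :: "'g set"
    and \<alpha> :: "nat \<Rightarrow> 'g \<Rightarrow> 'k"
    and hc :: "nat \<Rightarrow> 'g"
    and sv :: "'k \<Rightarrow> 'v::ab_group_add \<Rightarrow> 'v"
    and act :: "'g \<Rightarrow> 'v \<Rightarrow> 'v"
    and \<mu> :: "'g \<Rightarrow> 'k"
    and X :: dynkin_type
    and m n :: nat
  assumes "simple_lie_algebra sg br"
    and "cartan_subalgebra sg br H"
    and "root_datum_of_type X sg br H \<alpha> hc"
    and "simple_lie_module sg br sv act"
    and "highest_weight sg br H (rank X) \<alpha> sv act \<mu>"
    and "fundamental_weight sg H (rank X) hc m \<mu>"
  shows
    "(X = TypeA n \<and> 1 \<le> m \<and> m \<le> n \<longrightarrow>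
        weight_covering_poly sg H n \<alpha> sv act
          = (\<Sum>r\<le>n. monom (int ((m choose r) * ((n - m + 1) choose r))) r))
     \<and> (X = TypeD n \<and> 4 \<le> n \<and> m = n \<longrightarrow>
        weight_covering_poly sg H n \<alpha> sv act = (\<Sum>r\<le>n. monom (int (n choose (2 * r))) r))
     \<and> (X = TypeD n \<and> 4 \<le> n \<and> m = 1 \<longrightarrow>
        weight_covering_poly sg H n \<alpha> sv act = [:1, 2 * int n - 2, 1:])
     \<and> (X = TypeC 3 \<and> m = 3 \<longrightarrow>
        weight_covering_poly sg H 3 \<alpha> sv act = [:1, 9, 4:])
     \<and> (X = TypeE 6 \<and> m = 1 \<longrightarrow>
        weight_covering_poly sg H 6 \<alpha> sv act = [:1, 16, 10:])
     \<and> (X = TypeE 7 \<and> m = 1 \<longrightarrow>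
        weight_covering_poly sg H 7 \<alpha> sv act = [:1, 27, 27, 1:])"
proof -
  interpret fundamental_module sg br H sv act "rank X" \<alpha> hc "cartan_matrix X" m \<mu>
    by (intro fundamental_module.intro fundamental_module_axioms.intro)
      (use assms in \<open>auto simp: root_datum_of_type_def\<close>)
  show ?thesis
    using covering_poly_A covering_poly_spin covering_poly_vector
      covering_poly_C3 covering_poly_E6 covering_poly_E7
    by auto
qed

end
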